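(* Let $(X,d)$ be a $\delta$-hyperbolic space with base point $o$, let $d_a$ be the fixed metric on $X\cup\partial X$ described in the context, and let $G$ be a non-elementary subgroup of the group of isometries of $X$ acting properly discontinuously. Let $\mu$ be a probability measure on $G$ with a finite first moment and whose support generates $G$ as a semigroup. Let $\nu$ be the associated harmonic measure, $h=h(G,\mu)$ the asymptotic entropy and $l=l(G,\mu)$ the rate of escape. Then for $\nu$-almost every $\xi\in\partial X$, $$\overline{\dim}_P\,\nu(\xi)=\limsup_{r\to0}\frac{\log\nu(B(\xi,r))}{\log r}\le\frac{1}{\log a}\,\frac{h}{l},$$ where $B(\xi,r)$ is the ball of radius $r$ centred at $\xi$ in $(\partial X,d_a)$.
   Context: $\delta$-hyperbolic space: a proper geodesic metric space $(X,d)$ such that, with $(x|y)_o=\frac12[d(o,x)+d(o,y)-d(x,y)]$, one has $(x|z)_o\ge\min\{(x|y)_o,(y|z)_o\}-\delta$ for all $x,y,z,o\in X$. A base point $o\in X$ is fixed and $(x|y):=(x|y)_o$. The hyperbolic boundary $\partial X$ is the set of geodesic rays modulo equivalence (two rays are equivalent if they stay at bounded distance); the Gromov product extends to $X\cup\partial X$ by $(x|y)=\inf\liminf_n(x_n|y_n)$ over sequences $x_n\to x$, $y_n\to y$ in $X$, and $X\cup\partial X$ carries its usual compact topology, in which $x_n\to\xi\in\partial X$ iff $(\xi|x_n)\to\infty$. Metric: a parameter $a>1$ (in the admissible range $1<a<a_0$) and a metric $d_a$ on $X\cup\partial X$ inducing on it the usual compact topology of $X\cup\partial X$ (in which $x_n\to\xi\in\partial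 X$ iff $(\xi|x_n)\to\infty$) are fixed, such that for some constant $\lambda>0$: $d_a(x,y)\le\lambda a^{-(x|y)}$ for all $x,y\in X\cup\partial X$, and $d_a(x,y)\ge\lambda^{-1}a^{-(x|y)}$ for all $x,y\in\partial X$. Properly discontinuous: for every compact $K\subset X$ the set $\{g\in G: gK\cap K\neq\emptyset\}$ is finite. The limit set $\Lambda_G$ is the set of accumulation points in $\partial X$ of an orbit $Gx$, $x\in X$ (independent of $x$); $G$ is non-elementary if $\Lambda_G$ has more than two elements. Finite first moment: $\sum_{g\in G}\mu(g)d(o,go)<\infty$. Random walk: $x_0=e$, $x_n=h_1\cdots h_n$ with $(h_i)$ i.i.d. of law $\mu$; its position at time $n$ has law $\mu^n$, the $n$-th convolution power. When $G$ is a non-elementary group of isometries of the hyperbolic space $X$ acting properly discontinuously, and $\mu$ is a probability measure on $G$ with a finite first moment whose support generates $G$ as a semigroup, $x_no$ converges almost surely to a point $x_\infty\in\partial X$ (known fact); the harmonic measure $\nu$ is the distribution of $x_\infty$. The rate of escape is $l(G,\mu)=\lim_n\frac1n\sum_g\mu^n(g)d(o,go)$ and the asymptotic entropy is $h(G,\mu)=\lim_n\frac1nH(\mu^n)$, where $H(\lambda)=-\sum_g\lambda(g)\log\lambda(g)$. It is known that $l>0$ under these same assumptions on $G$ and $\mu$. *)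

theory Defs
  imports "HOL-Probability.Probability" "HOL-Algebra.Group"
begin

section \<open>Hyperbolic spaces\<close>

text \<open>The metric space \<open>X\<close> is the whole type \<open>'a :: metric_space\<close>.\<close>

definition proper_space :: "'a::metric_space itself \<Rightarrow> bool" where
  "proper_space _ \<longleftrightarrow> (\<forall>(x::'a) r. compact (cball x r))"

definition geodesic_space :: "'a::metric_space itself \<Rightarrow> bool" where
  "geodesic_space _ \<longleftrightarrow>
     (\<forall>x y::'a. \<exists>c::real \<Rightarrow> 'a. c 0 = x \<and> c (dist x y) = y \<and>
        (\<forall>s\<in>{0..dist x y}. \<forall>t\<in>{0..dist x y}. dist (c s) (c t) = \<bar>s - t\<bar>))"

definition gromov :: "'a::metric_space \<Rightarrow> 'a \<Rightarrow> 'a \<Rightarrow> real" where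
  "gromov b x y = (dist b x + dist b y - dist x y) / 2"

definition hyperbolic_space :: "'a::metric_space itself \<Rightarrow> real \<Rightarrow> bool" where
  "hyperbolic_space T \<delta> \<longleftrightarrow> proper_space T \<and> geodesic_space T \<and>
     (\<forall>x y z b::'a. gromov b x z \<ge> min (gromov b x y) (gromov b y z) - \<delta>)"

section \<open>The boundary and the extended Gromov product\<close>

text \<open>A ray is a function on \<open>\<real>\<close> of which only the values on \<open>[0,\<infinity>)\<close> matter: neither the
  ray condition nor the equivalence of rays sees the other values.\<close>

definition geodesic_rays :: "(real \<Rightarrow> 'a::metric_space) set" where
  "geodesic_rays = {c. \<forall>s\<ge>0. \<forall>t\<ge>0. dist (c s) (c t) = \<bar>s - t\<bar>}"

definition ray_equiv :: "((real \<Rightarrow> 'a::metric_space) \<times> (real \<Rightarrow> 'a)) set" where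
  "ray_equiv = {(c, c'). c \<in> geodesic_rays \<and> c' \<in> geodesic_rays \<and>
     (\<exists>C. \<forall>t\<ge>0. dist (c t) (c' t) \<le> C)}"

text \<open>Points of \<open>X \<union> \<partial>X\<close> are tagged; only classes of rays are admissible as ends.\<close>

datatype 'a hpoint = Inner 'a | End "(real \<Rightarrow> 'a) set"

definition hboundary :: "'a::metric_space hpoint set" where
  "hboundary = End ` (geodesic_rays // ray_equiv)"

definition hclosure :: "'a::metric_space hpoint set" where
  "hclosure = range Inner \<union> hboundary"

text \<open>Convergence of a sequence of points of \<open>X\<close> to a point of \<open>X \<union> \<partial>X\<close>.  The Gromov product
  with an end is itself defined through such sequences, so convergence to an end is expressed
  by means of the rays \<open>c\<close> of the class: \<open>(x\<^sub>n|c(t)) \<rightarrow> \<infinity>\<close> as \<open>n\<close> and \<open>t\<close> tend to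
  infinity jointly.\<close>

fun seq_tends :: "'a::metric_space \<Rightarrow> (nat \<Rightarrow> 'a) \<Rightarrow> 'a hpoint \<Rightarrow> bool" where
  "seq_tends b x (Inner p) \<longleftrightarrow> x \<longlonglongrightarrow> p"
| "seq_tends b x (End C) \<longleftrightarrow>
     (\<forall>c\<in>C. filterlim (\<lambda>(n, t). gromov b (x n) (c t)) at_top (sequentially \<times>\<^sub>F at_top))"

definition gromov_ext :: "'a::metric_space \<Rightarrow> 'a hpoint \<Rightarrow> 'a hpoint \<Rightarrow> ereal" where
  "gromov_ext b z w =
     Inf {liminf (\<lambda>n. ereal (gromov b (x n) (y n))) | x y. seq_tends b x z \<and> seq_tends b y w}"

section \<open>The topology of the compactification\<close>

text \<open>\<open>X\<close> is open and carries its own topology; the sets \<open>{z. (\<xi>|z) > R}\<close> form a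
  neighbourhood base at an end \<open>\<xi>\<close>.\<close>

definition hopen :: "'a::metric_space \<Rightarrow> 'a hpoint set \<Rightarrow> bool" where
  "hopen b U \<longleftrightarrow> U \<subseteq> hclosure \<and> open {x. Inner x \<in> U} \<and>
     (\<forall>\<xi>\<in>U \<inter> hboundary. \<exists>R::real. {z \<in> hclosure. gromov_ext b \<xi> z > ereal R} \<subseteq> U)"

definition htopology :: "'a::metric_space \<Rightarrow> 'a hpoint topology" where
  "htopology b = topology (hopen b)"

lemma istopology_hopen: "istopology (hopen b)"
  unfolding istopology_def
proof (intro conjI allI impI)
  fix S T :: "'a hpoint set"
  assume S: "hopen b S" and T: "hopen b T"
  have "\<exists>R::real. {z \<in> hclosure. gromov_ext b \<xi> z > ereal R} \<subseteq> S \<inter> T"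
    if xi: "\<xi> \<in> S \<inter> T \<inter> hboundary" for \<xi>
  proof -
    from S xi obtain R1 :: real
      where R1: "{z \<in> hclosure. gromov_ext b \<xi> z > ereal R1} \<subseteq> S"
      unfolding hopen_def by blast
    from T xi obtain R2 :: real
      where R2: "{z \<in> hclosure. gromov_ext b \<xi> z > ereal R2} \<subseteq> T"
      unfolding hopen_def by blast
    have "ereal R1 \<le> ereal (max R1 R2)" "ereal R2 \<le> ereal (max R1 R2)"
      by simp_all
    then have "{z \<in> hclosure. gromov_ext b \<xi> z > ereal (max R1 R2)} \<subseteq> S \<inter> T"
      using R1 R2 by (smt (verit) IntI mem_Collect_eq order_le_less_trans subset_iff)
    then show ?thesis by blast
  qed
  moreover have "{x. Inner x \<in> S \<inter> T} = {x. Inner x \<in> S} \<inter> {x. Inner x \<in> T}"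
    by blast
  ultimately show "hopen b (S \<inter> T)"
    using S T unfolding hopen_def by (auto intro: open_Int)
next
  fix K :: "'a hpoint set set"
  assume K: "\<forall>U\<in>K. hopen b U"
  have "{x. Inner x \<in> \<Union>K} = (\<Union>U\<in>K. {x. Inner x \<in> U})"
    by blast
  moreover have "open (\<Union>U\<in>K. {x. Inner x \<in> U})"
    using K unfolding hopen_def by blast
  moreover have "\<exists>R::real. {z \<in> hclosure. gromov_ext b \<xi> z > ereal R} \<subseteq> \<Union>K"
    if xi: "\<xi> \<in> \<Union>K \<inter> hboundary" for \<xi>
  proof -
    from xi obtain U where U: "U \<in> K" "\<xi> \<in> U \<inter> hboundary" by blast
    with K obtain R :: real where "{z \<in> hclosure. gromov_ext b \<xi> z > ereal R} \<subseteq> U"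
      unfolding hopen_def by meson
    with U(1) show ?thesis by blast
  qed
  ultimately show "hopen b (\<Union>K)"
    using K unfolding hopen_def by (auto simp: Sup_le_iff)
qed

lemma openin_htopology: "openin (htopology b) U \<longleftrightarrow> hopen b U"
  unfolding htopology_def by (simp add: istopology_hopen topology_inverse')

lemma topspace_htopology: "topspace (htopology b) = hclosure"
proof
  show "topspace (htopology b) \<subseteq> hclosure"
    by (auto simp: topspace_def openin_htopology hopen_def)
  have "{x. Inner x \<in> (hclosure :: 'a hpoint set)} = UNIV"
    by (auto simp: hclosure_def)
  then have "hopen b hclosure"
    unfolding hopen_def by auto
  then show "hclosure \<subseteq> topspace (htopology b)"
    by (auto simp: topspace_def openin_htopology)
qed

definition hboundary_borel :: "'a::metric_space \<Rightarrow> 'a hpoint measure" where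
  "hboundary_borel b = sigma hboundary {U. openin (subtopology (htopology b) hboundary) U}"

section \<open>The metric on the compactification\<close>

definition neg_powr :: "real \<Rightarrow> ereal \<Rightarrow> real" where
  "neg_powr a t = (if t = \<infinity> then 0 else a powr (- real_of_ereal t))"

definition visual_metric ::
    "'a::metric_space \<Rightarrow> real \<Rightarrow> ('a hpoint \<Rightarrow> 'a hpoint \<Rightarrow> real) \<Rightarrow> bool" where
  "visual_metric b a D \<longleftrightarrow>
     Metric_space hclosure D \<and> Metric_space.mtopology hclosure D = htopology b \<and>
     (\<exists>\<Lambda>>0. (\<forall>x\<in>hclosure. \<forall>y\<in>hclosure. D x y \<le> \<Lambda> * neg_powr a (gromov_ext b x y)) \<and>
            (\<forall>x\<in>hboundary. \<forall>y\<in>hboundary. D x y \<ge> inverse \<Lambda> * neg_powr a (gromov_ext b x y)))"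

section \<open>Groups of isometries\<close>

definition isometry_group :: "('a::metric_space \<Rightarrow> 'a) monoid" where
  "isometry_group =
     \<lparr>carrier = {f. surj f \<and> (\<forall>x y. dist (f x) (f y) = dist x y)}, mult = (\<circ>), one = id\<rparr>"

definition properly_discontinuous :: "('a::metric_space \<Rightarrow> 'a) set \<Rightarrow> bool" where
  "properly_discontinuous G \<longleftrightarrow> (\<forall>K. compact K \<longrightarrow> finite {g \<in> G. g ` K \<inter> K \<noteq> {}})"

text \<open>All orbits have the same accumulation points in \<open>\<partial>X\<close>; the orbit of \<open>b\<close> is used.\<close>

definition limit_set :: "'a::metric_space \<Rightarrow> ('a \<Rightarrow> 'a) set \<Rightarrow> 'a hpoint set" where
  "limit_set b G = (htopology b derived_set_of ((\<lambda>g. Inner (g b)) ` G)) \<inter> hboundary"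

definition non_elementary :: "'a::metric_space \<Rightarrow> ('a \<Rightarrow> 'a) set \<Rightarrow> bool" where
  "non_elementary b G \<longleftrightarrow> infinite (limit_set b G) \<or> card (limit_set b G) > 2"

inductive_set generated_semigroup :: "('a \<Rightarrow> 'a) set \<Rightarrow> ('a \<Rightarrow> 'a) set" for S where
  incl: "s \<in> S \<Longrightarrow> s \<in> generated_semigroup S"
| mult: "s \<in> generated_semigroup S \<Longrightarrow> t \<in> generated_semigroup S \<Longrightarrow> s \<circ> t \<in> generated_semigroup S"

section \<open>Random walks\<close>

text \<open>A group acting properly discontinuously on a proper space is countable, so a probability
  measure on it is a \<open>pmf\<close>.\<close>

definition finite_first_moment :: "'a::metric_space \<Rightarrow> ('a \<Rightarrow> 'a) pmf \<Rightarrow> bool" where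
  "finite_first_moment b \<mu> \<longleftrightarrow> integrable (measure_pmf \<mu>) (\<lambda>g. dist b (g b))"

primrec conv_power :: "('a \<Rightarrow> 'a) pmf \<Rightarrow> nat \<Rightarrow> ('a \<Rightarrow> 'a) pmf" where
  "conv_power \<mu> 0 = return_pmf id"
| "conv_power \<mu> (Suc n) = map_pmf (\<lambda>(g, h). g \<circ> h) (pair_pmf (conv_power \<mu> n) \<mu>)"

text \<open>The increment \<open>h\<^sub>n\<^sub>+\<^sub>1\<close> is the coordinate \<open>\<omega> n\<close>.\<close>

definition path_space :: "('a \<Rightarrow> 'a) pmf \<Rightarrow> (nat \<Rightarrow> 'a \<Rightarrow> 'a) measure" where
  "path_space \<mu> = (\<Pi>\<^sub>M n\<in>UNIV. measure_pmf \<mu>)"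

primrec walk :: "(nat \<Rightarrow> 'a \<Rightarrow> 'a) \<Rightarrow> nat \<Rightarrow> 'a \<Rightarrow> 'a" where
  "walk \<omega> 0 = id"
| "walk \<omega> (Suc n) = walk \<omega> n \<circ> \<omega> n"

text \<open>\<open>\<nu>\<close> is the law of a random variable that is almost surely the limit of \<open>x\<^sub>n b\<close>.  Such a
  variable is unique up to null sets, so there is at most one such \<open>\<nu>\<close>.\<close>

definition harmonic_measure ::
    "'a::metric_space \<Rightarrow> ('a \<Rightarrow> 'a) pmf \<Rightarrow> 'a hpoint measure \<Rightarrow> bool" where
  "harmonic_measure b \<mu> \<nu> \<longleftrightarrow>
     (\<exists>X\<in>measurable (path_space \<mu>) (hboundary_borel b).
        (AE \<omega> in path_space \<mu>.
           limitin (htopology b) (\<lambda>n. Inner (walk \<omega> n b)) (X \<omega>) sequentially) \<and>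
        \<nu> = distr (path_space \<mu>) (hboundary_borel b) X)"

definition rate_of_escape :: "'a::metric_space \<Rightarrow> ('a \<Rightarrow> 'a) pmf \<Rightarrow> real" where
  "rate_of_escape b \<mu> =
     lim (\<lambda>n. measure_pmf.expectation (conv_power \<mu> n) (\<lambda>g. dist b (g b)) / real n)"

text \<open>Entropies are extended real numbers: as orbit growth is not assumed to be exponential, a
  finite first moment does not force \<open>H(\<mu>) < \<infinity>\<close>.\<close>

definition entropy :: "'b pmf \<Rightarrow> ereal" where
  "entropy p = enn2ereal (\<integral>\<^sup>+ g. ennreal (- pmf p g * ln (pmf p g)) \<partial>count_space UNIV)"

definition asymptotic_entropy :: "('a \<Rightarrow> 'a) pmf \<Rightarrow> ereal" where
  "asymptotic_entropy \<mu> = lim (\<lambda>n. entropy (conv_power \<mu> n) / ereal (real n))"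

section \<open>Pointwise dimension\<close>

text \<open>The quotient is \<open>\<infinity>\<close> on balls of measure zero, following \<open>log 0 = -\<infinity>\<close>
  (whereas \<open>ln 0 = 0\<close> in HOL).\<close>

definition upper_pointwise_dim ::
    "'b set \<Rightarrow> ('b \<Rightarrow> 'b \<Rightarrow> real) \<Rightarrow> 'b measure \<Rightarrow> 'b \<Rightarrow> ereal" where
  "upper_pointwise_dim M D \<nu> \<xi> =
     Limsup (at_right 0) (\<lambda>r. let m = measure \<nu> (Metric_space.mball M D \<xi> r) in
       if m = 0 then \<infinity> else ereal (ln m / ln r))"

end

theory Submission
  imports Defs
begin

text \<open>
  Write \<open>x\<^sub>n\<close> for the walk, \<open>\<mu>\<^sup>n\<close> for its law at time \<open>n\<close>, \<open>|z| = d(b,z)\<close>, and \<open>\<xi>\<close> for the limit of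
  \<open>x\<^sub>nb\<close>.  If the walk sits at \<open>g\<close> at time \<open>n\<close>, then its limit is \<open>g\<eta>\<close>, where \<open>\<eta>\<close> has law \<open>\<nu>\<close> and is
  independent of \<open>g\<close>, and \<open>(g\<eta>|gb) = |gb| - (\<eta>|g\<^sup>-\<^sup>1b)\<close>.  Since \<open>\<nu>\<close> has no atoms, there is \<open>R\<close> with
  \<open>(\<eta>|z) \<le> R\<close> with probability at least \<open>1/2\<close> for every \<open>z\<close>.  Hence the ball at \<open>\<xi>\<close> of radius about
  \<open>a\<close> to the power \<open>-(x\<^sub>nb|\<xi>)\<close> has measure at least \<open>\<mu>\<^sup>n(x\<^sub>n) / 2\<close>.

  Along multiples of a fixed \<open>m\<close>, \<open>-log \<mu>\<^sup>n(x\<^sub>n)\<close> is bounded above by a Birkhoff sum with mean \<open>H(\<mu>\<^sup>m)\<close>,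
  and the Busemann function \<open>2(x\<^sub>nb|\<xi>) - |x\<^sub>nb| \<le> (x\<^sub>nb|\<xi>)\<close> is superadditive, hence bounded below by
  a Birkhoff sum.  Its mean at time \<open>m\<close> is \<open>E|x\<^sub>mb| - o(E|x\<^sub>mb|)\<close>, again because \<open>\<nu>\<close> has no atoms; as
  \<open>E|x\<^sub>mb|\<close> is unbounded, this also gives \<open>l > 0\<close>.

  If \<open>\<nu>\<close> had atoms, those of maximal mass would form a finite \<open>G\<close>-invariant set by stationarity.  Two
  such points confine the orbit to a neighbourhood of the geodesics between them, and a single one
  makes the Busemann function at it a quasimorphism on \<open>G\<close>; in both cases the limit set has at most
  two points.
\<close>

section \<open>Shifts of an independent sequence\<close>

text \<open>An upper bound for the dimension needs only lower bounds for \<open>horo\<close> and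
  upper bounds for \<open>info\<close> along paths. Hence the one-sided half of Birkhoff's theorem
  for blocks of length \<open>m\<close> is enough: letting \<open>m\<close> grow turns the block
  means into h and l, without pathwise limits of |x_n|/n or -log \<mu>^n(x_n)/n. Replacing (x_n
  b|\<xi>) by the smaller Busemann value is free to first order, since both grow like l n. The
  extended Gromov product is an infimum over all sequences, awkward for measurability and
  additivity. The random quantities are therefore upper or lower limits along the path itself;
  comparing them with ends costs multiples of \<delta>, that is, constant factors in radii. Uniform
  tightness of (\<eta>|z) follows from the absence of atoms because {(\<eta>|z) > j} has diameter
  O(a^(-j)): if such sets keep mass at least e, a point lying in infinitely many of them has mass at
  least e. H(\<mu>) may be infinite. Then so is every H(\<mu>^n) with n \<ge> 1, and the bound is
  trivial once l > 0.\<close>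

definition shift :: "nat \<Rightarrow> (nat \<Rightarrow> 'b) \<Rightarrow> nat \<Rightarrow> 'b" where
  "shift m \<omega> = (\<lambda>n. \<omega> (n + m))"

lemma shift_0 [simp]: "shift 0 \<omega> = \<omega>"
  by (simp add: shift_def)

lemma shift_shift [simp]: "shift m (shift n \<omega>) = shift (n + m) \<omega>"
  by (simp add: shift_def ac_simps)

lemma shift_comb_seq [simp]: "shift m (comb_seq m \<omega> \<omega>') = \<omega>'"
  by (simp add: shift_def comb_seq_add)

context sequence_space
begin

lemma measurable_shift [measurable]: "shift m \<in> measurable S S"
  unfolding shift_def by (rule measurable_PiM_single') (auto simp: space_PiM)

lemma distr_shift: "distr S S (shift m) = S"
proof -
  interpret SS: pair_prob_space S S ..
  have "distr S S (shift m) = distr (distr (S \<Otimes>\<^sub>M S) S (\<lambda>(\<omega>, \<omega>'). comb_seq m \<omega> \<omega>')) S (shift m)"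
    by (simp only: PiM_comb_seq)
  also have "\<dots> = distr (S \<Otimes>\<^sub>M S) S (shift m \<circ> (\<lambda>(\<omega>, \<omega>'). comb_seq m \<omega> \<omega>'))"
    by (rule distr_distr) auto
  also have "\<dots> = distr (S \<Otimes>\<^sub>M S) S snd"
    by (rule distr_cong) auto
  also have "\<dots> = S"
  proof (rule measure_eqI)
    fix A assume "A \<in> sets (distr (S \<Otimes>\<^sub>M S) S snd)"
    then have A: "A \<in> sets S" by simp
    then have "snd -` A \<inter> space (S \<Otimes>\<^sub>M S) = space S \<times> A"
      using sets.sets_into_space[OF A] by (auto simp: space_pair_measure)
    then show "emeasure (distr (S \<Otimes>\<^sub>M S) S snd) A = emeasure S A"
      using A by (simp add: emeasure_distr P.emeasure_pair_measure_Times P.emeasure_space_1)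
  qed simp
  finally show ?thesis .
qed

text \<open>A zero-one law by conditioning: an invariant \<open>A\<close> depends only on
  coordinates beyond any given index, hence is independent of every cylinder. Conditioning on
  \<open>A\<close> therefore does not change the law of the path, and the complement of
  \<open>A\<close> is null.\<close>

lemma shift_invariant_trivial:
  assumes A: "A \<in> sets S" and "m > 0"
    and inv: "\<And>\<omega>. \<omega> \<in> space S \<Longrightarrow> \<omega> \<in> A \<longleftrightarrow> shift m \<omega> \<in> A"
  shows "emeasure S A = 0 \<or> (AE \<omega> in S. \<omega> \<in> A)"
proof (cases "emeasure S A = 0")
  case False
  interpret SS: pair_prob_space S S ..
  have inv_mult: "\<omega> \<in> A \<longleftrightarrow> shift (k * m) \<omega> \<in> A" if "\<omega> \<in> space S" for \<omega> k
    using that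
  proof (induction k arbitrary: \<omega>)
    case (Suc k)
    have "shift m \<omega> \<in> space S"
      using measurable_space[OF measurable_shift Suc.prems] .
    then show ?case
      using inv[OF Suc.prems] Suc.IH[of "shift m \<omega>"] by simp
  qed simp
  have "uniform_measure S A = S"
  proof (rule PiM_eq)
    fix J :: "nat set" and F assume J: "finite J" "J \<subseteq> UNIV" "\<And>j. j \<in> J \<Longrightarrow> F j \<in> sets M"
    define C where "C = prod_emb UNIV (\<lambda>_. M) J (Pi\<^sub>E J F)"
    have C: "C \<in> sets S"
      unfolding C_def using J by (intro measurable_prod_emb sets_PiM_I_finite) auto
    obtain N where N: "\<And>j. j \<in> J \<Longrightarrow> j < N"
      using J(1) unfolding finite_nat_set_iff_bounded by auto
    \<comment> \<open>A multiple of \<open>m\<close>, so that \<open>A\<close> is invariant under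
      \<open>shift k\<close>, and beyond every coordinate that the cylinder \<open>C\<close>
      constrains.\<close>
    define k where "k = N * m"
    have k: "j < k" if "j \<in> J" for j
      using N[OF that] \<open>m > 0\<close> unfolding k_def
      by (metis less_le_trans mult.right_neutral mult_le_mono2 Suc_leI One_nat_def)
    have CC: "comb_seq k \<omega> \<omega>' \<in> C \<longleftrightarrow> \<omega> \<in> C" if "\<omega> \<in> space S" "\<omega>' \<in> space S" for \<omega> \<omega>'
    proof -
      have "(\<lambda>(\<omega>, \<omega>'). comb_seq k \<omega> \<omega>') (\<omega>, \<omega>') \<in> space S"
        by (rule measurable_space[OF measurable_comb_seq]) (use that in \<open>auto simp: space_pair_measure\<close>)
      then show ?thesis
        using that k by (simp add: C_def prod_emb_def PiE_iff space_PiM comb_seq_less cong: conj_cong)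
    qed
    have AA: "comb_seq k \<omega> \<omega>' \<in> A \<longleftrightarrow> \<omega>' \<in> A" if "\<omega> \<in> space S" "\<omega>' \<in> space S" for \<omega> \<omega>'
    proof -
      have "(\<lambda>(\<omega>, \<omega>'). comb_seq k \<omega> \<omega>') (\<omega>, \<omega>') \<in> space S"
        by (rule measurable_space[OF measurable_comb_seq]) (use that in \<open>auto simp: space_pair_measure\<close>)
      then show ?thesis
        using inv_mult[of "comb_seq k \<omega> \<omega>'" N] by (simp flip: k_def)
    qed
    have "emeasure S (A \<inter> C) = emeasure (distr (S \<Otimes>\<^sub>M S) S (\<lambda>(\<omega>, \<omega>'). comb_seq k \<omega> \<omega>')) (A \<inter> C)"
      by (simp only: PiM_comb_seq)
    also have "\<dots> = emeasure (S \<Otimes>\<^sub>M S) ((\<lambda>(\<omega>, \<omega>'). comb_seq k \<omega> \<omega>') -` (A \<inter> C) \<inter> space (S \<Otimes>\<^sub>M S))"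
      using A C by (intro emeasure_distr) auto
    also have "(\<lambda>(\<omega>, \<omega>'). comb_seq k \<omega> \<omega>') -` (A \<inter> C) \<inter> space (S \<Otimes>\<^sub>M S) = C \<times> A"
    proof (intro equalityI subsetI)
      fix p assume "p \<in> (\<lambda>(\<omega>, \<omega>'). comb_seq k \<omega> \<omega>') -` (A \<inter> C) \<inter> space (S \<Otimes>\<^sub>M S)"
      then show "p \<in> C \<times> A"
        by (cases p) (auto simp add: space_pair_measure CC AA)
    next
      fix p assume "p \<in> C \<times> A"
      then obtain \<omega> \<omega>' where p: "p = (\<omega>, \<omega>')" "\<omega> \<in> C" "\<omega>' \<in> A" by auto
      moreover from this have "\<omega> \<in> space S" "\<omega>' \<in> space S"
        using sets.sets_into_space[OF A] sets.sets_into_space[OF C] by (meson subsetD)+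
      ultimately show "p \<in> (\<lambda>(\<omega>, \<omega>'). comb_seq k \<omega> \<omega>') -` (A \<inter> C) \<inter> space (S \<Otimes>\<^sub>M S)"
        by (simp add: space_pair_measure CC AA)
    qed
    also have "emeasure (S \<Otimes>\<^sub>M S) (C \<times> A) = emeasure S C * emeasure S A"
      using A C by (intro P.emeasure_pair_measure_Times)
    finally have *: "emeasure S (A \<inter> C) = emeasure S C * emeasure S A" .
    have "emeasure (uniform_measure S A) C = emeasure S (A \<inter> C) / emeasure S A"
      using A C by simp
    also have "\<dots> = emeasure S C"
      unfolding * using False by (intro ennreal_mult_divide_eq) auto
    also have "\<dots> = (\<Prod>j\<in>J. emeasure M (F j))"
      unfolding C_def using J by (intro emeasure_PiM_emb) auto
    finally show "emeasure (uniform_measure S A) (prod_emb UNIV (\<lambda>_. M) J (Pi\<^sub>E J F)) = (\<Prod>j\<in>J. emeasure M (F j))"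
      unfolding C_def .
  qed simp
  then have "emeasure S (space S - A) = emeasure (uniform_measure S A) (space S - A)"
    by simp
  also have "\<dots> = 0"
    using A by simp
  finally have "AE \<omega> in S. \<omega> \<notin> space S - A"
    using A by (intro AE_not_in null_setsI) auto
  then show ?thesis by auto
qed simp


lemma integral_shift:
  assumes [measurable]: "f \<in> borel_measurable S"
  shows "integral\<^sup>L S (\<lambda>\<omega>. f (shift m \<omega>)) = (integral\<^sup>L S f :: real)"
  using integral_distr[of "shift m" S S f] by (simp add: distr_shift)

lemma integrable_shift:
  assumes "integrable S (f :: _ \<Rightarrow> real)"
  shows "integrable S (\<lambda>\<omega>. f (shift m \<omega>))"
  by (rule integrable_distr[of "shift m" S S]) (simp_all add: distr_shift assms)

lemma AE_shift:
  assumes "AE \<omega> in S. P \<omega>"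
  shows "AE \<omega> in S. P (shift m \<omega>)"
  by (rule AE_distrD[of "shift m" S S P]) (simp_all only: distr_shift measurable_shift assms)

text \<open>Garsia's argument: if the sums \<open>S\<^sub>k\<close> were unbounded above, then the differences
  \<open>M\<^sub>n\<^sub>+\<^sub>1 - M\<^sub>n \<circ> T = max (- (M\<^sub>n \<circ> T)) g\<close> of the running maxima, which have
  nonnegative integrals, would converge to \<open>g\<close>.\<close>

lemma shift_sums_bounded_above:
  fixes g :: "_ \<Rightarrow> real"
  assumes g: "integrable S g" and neg: "integral\<^sup>L S g < 0" and "m > 0"
  shows "AE \<omega> in S. \<exists>K. \<forall>k. (\<Sum>i<k. g (shift (i * m) \<omega>)) \<le> K"
proof -
  have [measurable]: "g \<in> borel_measurable S" using g by auto
  define s where "s k \<omega> = (\<Sum>i<k. g (shift (i * m) \<omega>))" for k \<omega>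
  have s_Suc: "s (Suc k) \<omega> = g \<omega> + s k (shift m \<omega>)" for k \<omega>
    unfolding s_def by (subst sum.lessThan_Suc_shift) (simp add: ac_simps)
  \<comment> \<open>Passing to the shifted path changes the sums only by the single value
    \<open>g \<omega>\<close>, so unboundedness above is an invariant event. By the zero-one law it
    suffices to refute that \<open>A\<close> has full measure.\<close>
  define A where "A = {\<omega> \<in> space S. \<forall>K::nat. \<exists>k. s k \<omega> > real K}"
  have [measurable]: "A \<in> sets S"
    unfolding A_def s_def by measurable
  have inv: "\<omega> \<in> A \<longleftrightarrow> shift m \<omega> \<in> A" if sp: "\<omega> \<in> space S" for \<omega>
  proof
    assume \<omega>: "\<omega> \<in> A"
    have "\<exists>k. s k (shift m \<omega>) > real K" for K
    proof -
      obtain k where k: "s k \<omega> > real (nat \<lceil>real K + \<bar>g \<omega>\<bar>\<rceil>)"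
        using \<omega> unfolding A_def by blast
      then have k': "s k \<omega> > real K + \<bar>g \<omega>\<bar>"
        by linarith
      then have "k \<noteq> 0" by (intro notI) (simp add: s_def)
      then obtain j where "k = Suc j" by (cases k) auto
      then show ?thesis using k' s_Suc[of j \<omega>] unfolding \<open>k = Suc j\<close> by (intro exI[of _ j]) linarith
    qed
    then show "shift m \<omega> \<in> A"
      using measurable_space[OF measurable_shift sp] by (auto simp: A_def)
  next
    assume \<omega>: "shift m \<omega> \<in> A"
    have "\<exists>k. s k \<omega> > real K" for K
    proof -
      obtain k where k: "s k (shift m \<omega>) > real (nat \<lceil>real K + \<bar>g \<omega>\<bar>\<rceil>)"
        using \<omega> unfolding A_def by blast
      then show ?thesis using s_Suc[of k \<omega>] by (intro exI[of _ "Suc k"]) linarith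
    qed
    then show "\<omega> \<in> A"
      using sp by (auto simp: A_def)
  qed
  have "\<not> (AE \<omega> in S. \<omega> \<in> A)"
  proof
    assume AE_A: "AE \<omega> in S. \<omega> \<in> A"
    define M' where "M' = rec_nat (\<lambda>_. 0) (\<lambda>n h \<omega>. max 0 (g \<omega> + h (shift m \<omega>)))"
    have M'_0: "M' 0 \<omega> = 0" and M'_Suc: "M' (Suc n) \<omega> = max 0 (g \<omega> + M' n (shift m \<omega>))" for n \<omega>
      by (simp_all add: M'_def)
    have M'_int: "integrable S (M' n)" for n
    proof (induction n)
      case (Suc n)
      have "integrable S (\<lambda>\<omega>. max 0 (g \<omega> + M' n (shift m \<omega>)))"
        by (intro integrable_max integrable_zero Bochner_Integration.integrable_add g integrable_shift Suc)
      then show ?case by (simp add: M'_Suc[abs_def])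
    qed (simp add: M'_0[abs_def])
    have [measurable]: "M' n \<in> borel_measurable S" for n
      using M'_int[of n] by auto
    have M'_mono: "M' n \<omega> \<le> M' (Suc n) \<omega>" for n \<omega>
    proof (induction n arbitrary: \<omega>)
      case (Suc n)
      show ?case
        using Suc[of "shift m \<omega>"] by (simp add: M'_Suc[of "Suc n"] M'_Suc[of n \<omega>] max.coboundedI2)
    qed (simp add: M'_0 M'_Suc)
    have M'_s: "s k \<omega> \<le> M' k \<omega>" for k \<omega>
    proof (induction k arbitrary: \<omega>)
      case (Suc k)
      show ?case
        using Suc[of "shift m \<omega>"] by (simp add: M'_Suc s_Suc max.coboundedI2)
    qed (simp add: M'_0 s_def)
    define d where "d n \<omega> = M' (Suc n) \<omega> - M' n (shift m \<omega>)" for n \<omega>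
    have d_eq: "d n \<omega> = max (- M' n (shift m \<omega>)) (g \<omega>)" for n \<omega>
      by (simp add: d_def M'_Suc max_def)
    have M'_nonneg: "0 \<le> M' n \<omega>" for n \<omega>
      by (cases n) (simp_all add: M'_0 M'_Suc)
    have lim: "(\<lambda>n. integral\<^sup>L S (d n)) \<longlonglongrightarrow> integral\<^sup>L S g"
    proof (rule integral_dominated_convergence[where w = "\<lambda>\<omega>. \<bar>g \<omega>\<bar>"])
      show "AE \<omega> in S. (\<lambda>n. d n \<omega>) \<longlonglongrightarrow> g \<omega>"
        using AE_shift[OF AE_A, of m]
      proof eventually_elim
        case (elim \<omega>)
        then obtain k where k: "s k (shift m \<omega>) > real (nat \<lceil>\<bar>g \<omega>\<bar>\<rceil>)"
          unfolding A_def by blast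
        have "d n \<omega> = g \<omega>" if "n \<ge> k" for n
        proof -
          have "M' k (shift m \<omega>) \<le> M' n (shift m \<omega>)"
            using lift_Suc_mono_le[of "\<lambda>n. M' n (shift m \<omega>)", OF M'_mono that] .
          then show ?thesis
            using k M'_s[of k "shift m \<omega>"] unfolding d_eq by linarith
        qed
        then show ?case
          by (intro tendsto_eventually) (auto simp: eventually_sequentially)
      qed
      \<comment> \<open>As \<open>M'\<close> is nonnegative, \<open>d n\<close> lies between
        \<open>g\<close> and \<open>max 0 g\<close>; this is what truncating the maxima at 0
        provides.\<close>
      show "AE \<omega> in S. norm (d n \<omega>) \<le> \<bar>g \<omega>\<bar>" for n
      proof (rule AE_I2)
        fix \<omega>
        show "norm (d n \<omega>) \<le> \<bar>g \<omega>\<bar>"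
          using M'_nonneg[of n "shift m \<omega>"] unfolding d_eq by (auto simp: max_def abs_if)
      qed
          show "d n \<in> borel_measurable S" for n
        unfolding d_def by measurable
    qed (use g in auto)
    have "integral\<^sup>L S (d n) \<ge> 0" for n
    proof -
      have "integral\<^sup>L S (d n) = integral\<^sup>L S (M' (Suc n)) - integral\<^sup>L S (M' n)"
        unfolding d_def
        by (subst Bochner_Integration.integral_diff) (auto simp: M'_int integrable_shift integral_shift)
      also have "\<dots> \<ge> 0"
        using integral_mono[OF M'_int M'_int M'_mono] by simp
      finally show ?thesis .
    qed
    then have "integral\<^sup>L S g \<ge> 0"
      by (intro LIMSEQ_le_const[OF lim]) auto
    with neg show False by simp
  qed
  with shift_invariant_trivial[of A m] inv \<open>m > 0\<close> have "emeasure S A = 0"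
    by auto
  then have "AE \<omega> in S. \<omega> \<notin> A"
    by (intro AE_not_in null_setsI) auto
  moreover have "AE \<omega> in S. \<omega> \<in> space S" by simp
  ultimately show ?thesis
  proof eventually_elim
    case (elim \<omega>)
    then obtain K :: nat where "\<And>k. s k \<omega> \<le> real K"
      by (auto simp: A_def not_less)
    then show ?case unfolding s_def by blast
  qed
qed

text \<open>The upper half of Birkhoff's theorem: for \<open>c'\<close> strictly between the mean
  and \<open>c\<close>, the sums of \<open>f - c'\<close> are bounded above, and the slack
  \<open>k * (c - c')\<close> eventually absorbs the bound.\<close>

lemma shift_sums_eventually_le:
  fixes f :: "_ \<Rightarrow> real"
  assumes f: "integrable S f" and c: "integral\<^sup>L S f < c" and "m > 0"
  shows "AE \<omega> in S. \<forall>\<^sub>F k in sequentially. (\<Sum>i<k. f (shift (i * m) \<omega>)) \<le> real k * c"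
proof -
  obtain c' where c': "integral\<^sup>L S f < c'" "c' < c"
    using dense[OF c] by auto
  have "AE \<omega> in S. \<exists>K. \<forall>k. (\<Sum>i<k. f (shift (i * m) \<omega>) - c') \<le> K"
    using f c' \<open>m > 0\<close> by (intro shift_sums_bounded_above) (auto simp: P.prob_space)
  then show ?thesis
  proof eventually_elim
    case (elim \<omega>)
    then obtain K where K: "\<And>k. (\<Sum>i<k. f (shift (i * m) \<omega>) - c') \<le> K" by blast
    obtain N :: nat where N: "K / (c - c') \<le> real N"
      using real_arch_simple by blast
    have "(\<Sum>i<k. f (shift (i * m) \<omega>)) \<le> real k * c" if "k \<ge> N" for k
    proof -
      have "K / (c - c') \<le> real k" using N that by linarith
      then have "K \<le> real k * (c - c')" using c' by (simp add: pos_divide_le_eq)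
      with K[of k] show ?thesis by (simp add: sum_subtractf algebra_simps)
    qed
    then show ?case by (auto simp: eventually_sequentially)
  qed
qed

end

section \<open>Gromov products\<close>

lemma gromov_commute: "gromov b x y = gromov b y x"
  by (simp add: gromov_def dist_commute)

lemma gromov_nonneg: "0 \<le> gromov b x y"
  using dist_triangle[of x y b] by (simp add: gromov_def dist_commute)

lemma gromov_le_dist: "gromov b x y \<le> dist b x"
  using dist_triangle[of b y x] by (simp add: gromov_def)

lemma gromov_same [simp]: "gromov b x x = dist b x"
  by (simp add: gromov_def)

lemma gromov_base_diff: "\<bar>gromov b x y - gromov b' x y\<bar> \<le> dist b b'"
  unfolding gromov_def
  using dist_triangle[of b x b'] dist_triangle[of b y b'] dist_triangle[of b' x b] dist_triangle[of b' y b]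
  by (simp add: dist_commute abs_le_iff field_simps)

lemma gromov_arg_diff: "\<bar>gromov b x y - gromov b x' y\<bar> \<le> dist x x'"
  unfolding gromov_def
  using dist_triangle[of b x x'] dist_triangle[of x y x'] dist_triangle[of b x' x] dist_triangle[of x' y x]
  by (simp add: dist_commute abs_le_iff field_simps)

lemma gromov_swap_base: "gromov x y z + gromov y x z = dist x y"
  by (simp add: gromov_def dist_commute field_simps)

lemma gromov_change_base:
  "gromov p u v = gromov b u v + dist b p - gromov b p u - gromov b p v"
  by (simp add: gromov_def dist_commute field_simps)

text \<open>\<open>HOL-Algebra\<close> occupies the notation \<open>inv\<close>.\<close>

abbreviation invf :: "('a \<Rightarrow> 'b) \<Rightarrow> 'b \<Rightarrow> 'a" where
  "invf \<equiv> inv_into UNIV"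

definition isom :: "('a::metric_space \<Rightarrow> 'a) \<Rightarrow> bool" where
  "isom g \<longleftrightarrow> surj g \<and> (\<forall>x y. dist (g x) (g y) = dist x y)"

lemma isom_dist: "isom g \<Longrightarrow> dist (g x) (g y) = dist x y"
  by (simp add: isom_def)

lemma isom_gromov: "isom g \<Longrightarrow> gromov (g b) (g x) (g y) = gromov b x y"
  by (simp add: gromov_def isom_dist)

lemma isom_inj: "isom g \<Longrightarrow> inj g"
  by (metis dist_eq_0_iff injI isom_dist)

lemma isom_bij: "isom g \<Longrightarrow> bij g"
  using isom_inj by (auto simp: bij_def isom_def)

lemma isom_comp: "isom g \<Longrightarrow> isom h \<Longrightarrow> isom (g \<circ> h)"
  unfolding isom_def using comp_surj[of h g] by simp

lemma isom_id: "isom id"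
  by (auto simp: isom_def)

lemma isom_inv: "isom g \<Longrightarrow> isom (invf g)"
  unfolding isom_def by (metis bij_imp_bij_inv bij_is_surj isom_bij isom_def surj_f_inv_f)

lemma isom_inv_left [simp]: "isom g \<Longrightarrow> invf g (g x) = x"
  by (simp add: inv_f_f isom_inj)

lemma isom_inv_right [simp]: "isom g \<Longrightarrow> g (invf g x) = x"
  by (simp add: isom_def surj_f_inv_f)

lemma isom_dist_inv: "isom g \<Longrightarrow> dist (invf g x) y = dist x (g y)"
  by (metis isom_dist isom_inv_right)

lemma isom_gromov_inv: "isom g \<Longrightarrow> gromov (g b) x y = gromov b (invf g x) (invf g y)"
  by (metis isom_gromov isom_inv_right)

text \<open>Sequences \<open>x\<close> and \<open>y\<close> that converge at infinity to the same end; \<open>gsim b x x\<close> says that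
  \<open>x\<close> converges at infinity.\<close>

definition gsim :: "'a::metric_space \<Rightarrow> (nat \<Rightarrow> 'a) \<Rightarrow> (nat \<Rightarrow> 'a) \<Rightarrow> bool" where
  "gsim b x y \<longleftrightarrow> (\<forall>R. \<exists>N. \<forall>n\<ge>N. \<forall>m\<ge>N. R \<le> gromov b (x n) (y m))"

lemma gsimD: "gsim b x y \<Longrightarrow> \<exists>N. \<forall>n\<ge>N. \<forall>m\<ge>N. R \<le> gromov b (x n) (y m)"
  by (simp add: gsim_def)

lemma gsim_sym: "gsim b x y \<Longrightarrow> gsim b y x"
  unfolding gsim_def by (metis gromov_commute)

lemma gsim_shift: "gsim b x y \<Longrightarrow> gsim b (\<lambda>n. x (n + k)) y"
  unfolding gsim_def by (meson trans_le_add1)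

lemma gsim_bounded_change:
  assumes "gsim b x y" and "\<And>n m. \<bar>gromov b (x n) (y m) - gromov b' (x' n) (y' m)\<bar> \<le> C"
  shows "gsim b' x' y'"
  unfolding gsim_def
proof
  fix R
  obtain N where "\<And>n m. n \<ge> N \<Longrightarrow> m \<ge> N \<Longrightarrow> R + C \<le> gromov b (x n) (y m)"
    using gsimD[OF assms(1)] by blast
  then have "R \<le> gromov b' (x' n) (y' m)" if "n \<ge> N" "m \<ge> N" for n m
    using assms(2)[of n m] that by (smt (verit))
  then show "\<exists>N. \<forall>n\<ge>N. \<forall>m\<ge>N. R \<le> gromov b' (x' n) (y' m)" by blast
qed

lemma gsim_base: "gsim b x y \<Longrightarrow> gsim b' x y"
  by (rule gsim_bounded_change[OF _ gromov_base_diff])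

lemma gsim_isom:
  assumes "isom g" "gsim b x y"
  shows "gsim b (\<lambda>n. g (x n)) (\<lambda>n. g (y n))"
proof (rule gsim_bounded_change[OF assms(2)])
  fix n m
  show "\<bar>gromov b (x n) (y m) - gromov b (g (x n)) (g (y m))\<bar> \<le> dist (g b) b"
    using gromov_base_diff[of "g b" "g (x n)" "g (y m)" b] by (simp add: isom_gromov[OF assms(1)])
qed

lemma gsim_dist_at_top:
  assumes "gsim b x y"
  shows "filterlim (\<lambda>n. dist b (x n)) at_top sequentially"
  unfolding filterlim_at_top eventually_sequentially
proof
  fix R
  obtain N where N: "\<And>n m. n \<ge> N \<Longrightarrow> m \<ge> N \<Longrightarrow> R \<le> gromov b (x n) (y m)"
    using gsimD[OF assms] by blast
  have "R \<le> dist b (x n)" if "n \<ge> N" for n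
    using N[OF that that] gromov_le_dist[of b "x n" "y n"] by linarith
  then show "\<exists>N. \<forall>n\<ge>N. R \<le> dist b (x n)" by blast
qed

lemma not_gsimD:
  assumes "\<not> gsim b x y"
  obtains R where "\<And>N. \<exists>n\<ge>N. \<exists>m\<ge>N. gromov b (x n) (y m) \<le> R"
  using assms unfolding gsim_def by (meson linear)

section \<open>Ends\<close>

definition end_of :: "(real \<Rightarrow> 'a::metric_space) \<Rightarrow> 'a hpoint" where
  "end_of c = End (ray_equiv `` {c})"

lemma hboundary_eq: "hboundary = end_of ` geodesic_rays"
  by (auto simp: hboundary_def end_of_def quotient_def)

lemma ray_equiv_refl: "c \<in> geodesic_rays \<Longrightarrow> (c, c) \<in> ray_equiv"
  by (auto simp: ray_equiv_def intro!: exI[of _ 0])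

definition ray_of :: "'a::metric_space hpoint \<Rightarrow> real \<Rightarrow> 'a" where
  "ray_of \<xi> = (SOME c. c \<in> geodesic_rays \<and> \<xi> = end_of c)"

definition rseq :: "'a::metric_space hpoint \<Rightarrow> nat \<Rightarrow> 'a" where
  "rseq \<xi> n = ray_of \<xi> (real n)"

lemma ray_of:
  assumes "\<xi> \<in> hboundary"
  shows "ray_of \<xi> \<in> geodesic_rays" "end_of (ray_of \<xi>) = \<xi>"
proof -
  have "\<exists>c. c \<in> geodesic_rays \<and> \<xi> = end_of c"
    using assms by (auto simp: hboundary_eq)
  from someI_ex[OF this] show "ray_of \<xi> \<in> geodesic_rays" "end_of (ray_of \<xi>) = \<xi>"
    by (auto simp: ray_of_def)
qed

lemma ray_dist: "c \<in> geodesic_rays \<Longrightarrow> s \<ge> 0 \<Longrightarrow> t \<ge> 0 \<Longrightarrow> dist (c s) (c t) = \<bar>s - t\<bar>"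
  by (auto simp: geodesic_rays_def)

lemma gsim_ray:
  assumes c: "c \<in> geodesic_rays"
  shows "gsim b (\<lambda>n. c (real n)) (\<lambda>n. c (real n))"
proof -
  have *: "gromov (c 0) (c (real n)) (c (real m)) = real (min n m)" for n m
    unfolding gromov_def using c by (auto simp: ray_dist min_def)
  have "gsim (c 0) (\<lambda>n. c (real n)) (\<lambda>n. c (real n))"
    unfolding gsim_def *
  proof
    fix R :: real
    obtain N :: nat where "R \<le> real N" using real_arch_simple by blast
    then show "\<exists>N. \<forall>n\<ge>N. \<forall>m\<ge>N. R \<le> real (min n m)"
      by (intro exI[of _ N]) (auto simp: min_def)
  qed
  then show ?thesis by (rule gsim_base)
qed

text \<open>Reduces all rays of the class and all real times to one ray at integer times. Another
  ray of the class stays within some \<open>C\<close>, and rounding the time moves a point by at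
  most 1, so products change by at most \<open>C + 1\<close>.\<close>

lemma seq_tends_end_of:
  assumes c: "c \<in> geodesic_rays"
  shows "seq_tends b x (end_of c) \<longleftrightarrow> gsim b x (\<lambda>n. c (real n))"
proof
  assume "seq_tends b x (end_of c)"
  then have lim: "filterlim (\<lambda>(n, t). gromov b (x n) (c t)) at_top (sequentially \<times>\<^sub>F at_top)"
    using ray_equiv_refl[OF c] by (simp add: end_of_def)
  show "gsim b x (\<lambda>n. c (real n))"
    unfolding gsim_def
  proof
    fix R
    have "\<forall>\<^sub>F (n, t) in sequentially \<times>\<^sub>F at_top. R \<le> gromov b (x n) (c t)"
      using lim unfolding filterlim_at_top by (auto simp: case_prod_unfold)
    then obtain P Q where PQ: "eventually P sequentially" "eventually Q at_top"
        "\<And>n t. P n \<Longrightarrow> Q t \<Longrightarrow> R \<le> gromov b (x n) (c t)"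
      unfolding eventually_prod_filter by auto
    obtain N where N: "\<And>n. n \<ge> N \<Longrightarrow> P n" using PQ(1) by (auto simp: eventually_sequentially)
    obtain T where T: "\<And>t::real. t \<ge> T \<Longrightarrow> Q t" using PQ(2) by (auto simp: eventually_at_top_linorder)
    obtain M :: nat where M: "T \<le> real M" using real_arch_simple by blast
    have "R \<le> gromov b (x n) (c (real m))" if "n \<ge> max N M" "m \<ge> max N M" for n m
    proof -
      have "T \<le> real m" using M that by (meson max.bounded_iff of_nat_le_iff order_trans)
      then show ?thesis using PQ(3) N T that by auto
    qed
    then show "\<exists>N. \<forall>n\<ge>N. \<forall>m\<ge>N. R \<le> gromov b (x n) (c (real m))" by blast
  qed
next
  assume sim: "gsim b x (\<lambda>n. c (real n))"
  have "filterlim (\<lambda>(n, t). gromov b (x n) (c' t)) at_top (sequentially \<times>\<^sub>F at_top)"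
    if c': "(c, c') \<in> ray_equiv" for c'
    unfolding filterlim_at_top
  proof
    fix R
    obtain C where C: "\<And>t. t \<ge> 0 \<Longrightarrow> dist (c t) (c' t) \<le> C"
      using c' by (auto simp: ray_equiv_def)
    obtain N where N: "\<And>n m. n \<ge> N \<Longrightarrow> m \<ge> N \<Longrightarrow> R + C + 1 \<le> gromov b (x n) (c (real m))"
      using gsimD[OF sim] by blast
    have "R \<le> gromov b (x n) (c' t)" if "n \<ge> N" "t \<ge> real N" for n and t :: real
    proof -
      define m where "m = nat \<lfloor>t\<rfloor>"
      have t: "t \<ge> 0" using that by linarith
      have m: "m \<ge> N" "\<bar>t - real m\<bar> \<le> 1" using that unfolding m_def by linarith+
      have "dist (c (real m)) (c' t) \<le> dist (c (real m)) (c t) + dist (c t) (c' t)"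
        by (rule dist_triangle)
      also have "\<dots> \<le> 1 + C"
        using C[OF t] m ray_dist[OF c, of t "real m"] t by (simp add: dist_commute)
      finally have "dist (c (real m)) (c' t) \<le> 1 + C" .
      then show ?thesis
        using N[OF that(1) m(1)] gromov_arg_diff[of b "c (real m)" "x n" "c' t"]
        by (simp add: gromov_commute[of b "x n"])
    qed
    then have "\<forall>\<^sub>F p in sequentially \<times>\<^sub>F at_top. R \<le> gromov b (x (fst p)) (c' (snd p))"
      unfolding eventually_prod_filter
      by (intro exI[of _ "\<lambda>n. n \<ge> N"] exI[of _ "\<lambda>t. t \<ge> real N"])
        (auto simp: eventually_ge_at_top)
    then show "\<forall>\<^sub>F p in sequentially \<times>\<^sub>F at_top. R \<le> (case p of (n, t) \<Rightarrow> gromov b (x n) (c' t))"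
      by (simp add: case_prod_unfold)
  qed
  then show "seq_tends b x (end_of c)"
    by (simp add: end_of_def)
qed

lemma seq_tends_iff: "\<xi> \<in> hboundary \<Longrightarrow> seq_tends b x \<xi> \<longleftrightarrow> gsim b x (rseq \<xi>)"
  using seq_tends_end_of[of "ray_of \<xi>" b x] ray_of[of \<xi>] by (simp add: rseq_def[abs_def])

lemma gsim_rseq: "\<xi> \<in> hboundary \<Longrightarrow> gsim b (rseq \<xi>) (rseq \<xi>)"
  using gsim_ray[of "ray_of \<xi>" b] ray_of[of \<xi>] by (simp add: rseq_def[abs_def])

lemma end_cases:
  assumes "z \<in> hclosure"
  obtains x where "z = Inner x" | "z \<in> hboundary"
  using assms by (auto simp: hclosure_def)

lemma Inner_notin_hboundary [simp]: "Inner x \<notin> hboundary"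
  by (auto simp: hboundary_def)

lemma Inner_in_hclosure [simp]: "Inner x \<in> hclosure"
  by (auto simp: hclosure_def)

lemma hboundary_subset: "hboundary \<subseteq> hclosure"
  by (auto simp: hclosure_def)

lemma eventually_gromov_ext:
  assumes "seq_tends b x z" "seq_tends b y w" "ereal R < gromov_ext b z w"
  shows "\<forall>\<^sub>F n in sequentially. R < gromov b (x n) (y n)"
proof -
  have "gromov_ext b z w \<le> liminf (\<lambda>n. ereal (gromov b (x n) (y n)))"
    unfolding gromov_ext_def using assms by (intro Inf_lower) auto
  then have "ereal R < liminf (\<lambda>n. ereal (gromov b (x n) (y n)))"
    using assms(3) by order
  then show ?thesis
    by (auto dest: less_LiminfD)
qed

locale gromov_hyperbolic =
  fixes b :: "'a::metric_space" and \<delta> :: real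
  assumes hyp: "\<And>p x y z :: 'a. min (gromov p x y) (gromov p y z) - \<delta> \<le> gromov p x z"
begin

lemma delta_nonneg: "0 \<le> \<delta>"
  using hyp[of b b b b] by simp

lemma hyp_ge:
  fixes p :: 'a
  assumes "R \<le> gromov p x y" "R \<le> gromov p y z"
  shows "R - \<delta> \<le> gromov p x z"
  using assms hyp[of p x y z] by linarith

lemma hyp4_ge:
  fixes p :: 'a
  assumes "R \<le> gromov p x x'" "R \<le> gromov p x' y'" "R \<le> gromov p y' y"
  shows "R - 2 * \<delta> \<le> gromov p x y"
  using assms hyp[of p x x' y'] hyp[of p x y' y] delta_nonneg by linarith

lemma gsim_trans:
  fixes p :: 'a
  assumes "gsim p x y" "gsim p y z"
  shows "gsim p x z"
  unfolding gsim_def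
proof
  fix R
  obtain N where N: "\<And>n m. n \<ge> N \<Longrightarrow> m \<ge> N \<Longrightarrow> R + \<delta> \<le> gromov p (x n) (y m)"
    using gsimD[OF assms(1)] by blast
  obtain M where M: "\<And>n m. n \<ge> M \<Longrightarrow> m \<ge> M \<Longrightarrow> R + \<delta> \<le> gromov p (y n) (z m)"
    using gsimD[OF assms(2)] by blast
  have "R \<le> gromov p (x n) (z m)" if "n \<ge> max N M" "m \<ge> max N M" for n m
    using hyp_ge[OF N[of n "max N M"] M[of "max N M" m]] that by simp
  then show "\<exists>N. \<forall>n\<ge>N. \<forall>m\<ge>N. R \<le> gromov p (x n) (z m)" by blast
qed

text \<open>Upgrades a bound at some late indices to one at all late indices, for any sequences with
  the same ends: a product above \<open>K + 2 * \<delta>\<close> would, after two hyperbolic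
  inequalities, push the product of \<open>x\<close> and \<open>y\<close> at the known late pair
  above \<open>K\<close>.\<close>

lemma gsim_transfer_le:
  fixes p :: 'a
  assumes "gsim p x x'" "gsim p y y'" and le: "\<And>N. \<exists>n\<ge>N. \<exists>m\<ge>N. gromov p (x n) (y m) \<le> K"
  shows "\<exists>N. \<forall>n\<ge>N. \<forall>m\<ge>N. gromov p (x' n) (y' m) \<le> K + 2 * \<delta>"
proof -
  obtain N where N: "\<And>n m. n \<ge> N \<Longrightarrow> m \<ge> N \<Longrightarrow> K + 2 * \<delta> + 1 \<le> gromov p (x n) (x' m)"
    using gsimD[OF assms(1)] by blast
  obtain M where M: "\<And>n m. n \<ge> M \<Longrightarrow> m \<ge> M \<Longrightarrow> K + 2 * \<delta> + 1 \<le> gromov p (y n) (y' m)"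
    using gsimD[OF assms(2)] by blast
  obtain n0 m0 where nm: "n0 \<ge> max N M" "m0 \<ge> max N M" "gromov p (x n0) (y m0) \<le> K"
    using le by blast
  have "gromov p (x' n) (y' m) \<le> K + 2 * \<delta>" if "n \<ge> max N M" "m \<ge> max N M" for n m
  proof (rule ccontr)
    assume less: "\<not> ?thesis"
    define R where "R = min (gromov p (x' n) (y' m)) (K + 2 * \<delta> + 1)"
    have "R - 2 * \<delta> \<le> gromov p (x n0) (y m0)"
      using N[of n0 n] M[of m0 m] nm that
      by (intro hyp4_ge[of R p _ "x' n" "y' m"]) (auto simp: R_def gromov_commute[of p "y' m"])
    then show False using nm(3) less by (simp add: R_def)
  qed
  then show ?thesis by blast
qed

text \<open>Every pair of sequences competing in the infimum is joined to \<open>x\<close> and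
  \<open>y\<close> by two hyperbolic inequalities, hence the loss
  \<open>2 * \<delta>\<close>.\<close>

lemma gromov_ext_ge:
  assumes "\<xi> \<in> hboundary" "\<eta> \<in> hboundary" "gsim b x (rseq \<xi>)" "gsim b y (rseq \<eta>)"
    and le: "\<And>N. \<exists>n\<ge>N. \<exists>m\<ge>N. R \<le> gromov b (x n) (y m)"
  shows "ereal (R - 2 * \<delta>) \<le> gromov_ext b \<xi> \<eta>"
  unfolding gromov_ext_def
proof (rule Inf_greatest, clarify)
  fix x' y' assume "seq_tends b x' \<xi>" "seq_tends b y' \<eta>"
  then have x': "gsim b x' x" and y': "gsim b y y'"
    using assms seq_tends_iff gsim_trans gsim_sym by metis+
  obtain N where N: "\<And>n m. n \<ge> N \<Longrightarrow> m \<ge> N \<Longrightarrow> R \<le> gromov b (x' n) (x m)"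
    using gsimD[OF x'] by blast
  obtain M where M: "\<And>n m. n \<ge> M \<Longrightarrow> m \<ge> M \<Longrightarrow> R \<le> gromov b (y n) (y' m)"
    using gsimD[OF y'] by blast
  obtain n0 m0 where nm: "n0 \<ge> max N M" "m0 \<ge> max N M" "R \<le> gromov b (x n0) (y m0)"
    using le by blast
  have "ereal (R - 2 * \<delta>) \<le> ereal (gromov b (x' n) (y' n))" if "n \<ge> max N M" for n
    using hyp4_ge[OF N[of n n0] nm(3) M[of m0 n]] nm that by simp
  then show "ereal (R - 2 * \<delta>) \<le> liminf (\<lambda>n. ereal (gromov b (x' n) (y' n)))"
    by (intro Liminf_bounded) (unfold eventually_sequentially, blast)
qed

text \<open>The set where (\<xi>|z) > R need not be open, so \<open>V\<close> is built as a kind of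
  interior: besides the inner points near \<xi> it contains those ends that have a whole
  neighbourhood of near inner points.\<close>

lemma end_neighbourhood:
  assumes \<xi>: "\<xi> \<in> hboundary"
  shows "\<exists>V. openin (htopology b) V \<and> \<xi> \<in> V \<and>
    (\<forall>x. Inner x \<in> V \<longrightarrow> (\<forall>\<^sub>F n in sequentially. R \<le> gromov b x (rseq \<xi> n)))"
proof -
  \<comment> \<open>The strict \<open>R' > R\<close> leaves room for small displacements, which
    makes the set of near points open.\<close>
  define near where "near z \<longleftrightarrow> (\<exists>R'>R. \<forall>\<^sub>F n in sequentially. R' \<le> gromov b z (rseq \<xi> n))" for z
  define V where "V = Inner ` {z. near z} \<union>
    {\<eta> \<in> hboundary. \<exists>S. \<forall>z. (\<forall>\<^sub>F n in sequentially. S \<le> gromov b z (rseq \<eta> n)) \<longrightarrow> near z}"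
  have "open {z. near z}"
    unfolding open_dist
  proof
    fix x assume "x \<in> {z. near z}"
    then obtain R' where R': "R' > R" "\<forall>\<^sub>F n in sequentially. R' \<le> gromov b x (rseq \<xi> n)"
      by (auto simp: near_def)
    have "near y" if "dist y x < (R' - R) / 2" for y
      unfolding near_def
    proof (intro exI conjI)
      show "(R' + R) / 2 > R" using R' by simp
      show "\<forall>\<^sub>F n in sequentially. (R' + R) / 2 \<le> gromov b y (rseq \<xi> n)"
        using R'(2)
      proof eventually_elim
        case (elim n)
        then show ?case
          using gromov_arg_diff[of b y "rseq \<xi> n" x] that by (simp add: abs_le_iff field_simps)
      qed
    qed
    then show "\<exists>e>0. \<forall>y. dist y x < e \<longrightarrow> y \<in> {z. near z}"
      using R' by (intro exI[of _ "(R' - R) / 2"]) auto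
  qed
  moreover have "{x. Inner x \<in> V} = {z. near z}"
    by (auto simp: V_def)
  moreover have "V \<subseteq> hclosure"
    using hboundary_subset by (auto simp: V_def)
  moreover have "\<exists>R. {z \<in> hclosure. gromov_ext b \<eta> z > ereal R} \<subseteq> V" if \<eta>: "\<eta> \<in> V \<inter> hboundary" for \<eta>
  proof -
    obtain S where S: "\<And>z. (\<forall>\<^sub>F n in sequentially. S \<le> gromov b z (rseq \<eta> n)) \<Longrightarrow> near z"
      using \<eta> by (auto simp: V_def)
    have st: "seq_tends b (rseq \<eta>) \<eta>"
      using \<eta> gsim_rseq[of \<eta> b] seq_tends_iff[of \<eta> b] by simp
    have "z \<in> V" if z: "z \<in> hclosure" "gromov_ext b \<eta> z > ereal (S + \<delta>)" for z
      using z(1)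
    proof (cases rule: end_cases)
      case (1 x)
      have "seq_tends b (\<lambda>_. x) z" by (simp add: 1)
      from eventually_gromov_ext[OF st this z(2)]
      have "\<forall>\<^sub>F n in sequentially. S \<le> gromov b x (rseq \<eta> n)"
        by eventually_elim (use delta_nonneg in \<open>simp add: gromov_commute[of b x]\<close>)
      then show ?thesis using S 1 by (auto simp: V_def)
    next
      case 2
      then have "seq_tends b (rseq z) z"
        using gsim_rseq[of z b] seq_tends_iff[of z b] by simp
      note ev = eventually_gromov_ext[OF st this z(2)]
      \<comment> \<open>If (y|z) and (z|\<eta>) are both at least \<open>S + \<delta>\<close>, then
        (y|\<eta>) is at least \<open>S\<close>. So \<open>S + \<delta>\<close> is the witness that
        the end \<open>z\<close> belongs to \<open>V\<close>.\<close>
      have "near y" if "\<forall>\<^sub>F n in sequentially. S + \<delta> \<le> gromov b y (rseq z n)" for y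
      proof (rule S)
        show "\<forall>\<^sub>F n in sequentially. S \<le> gromov b y (rseq \<eta> n)"
          using ev that
        proof eventually_elim
          case (elim n)
          then show ?case
            using hyp_ge[of "S + \<delta>" b y "rseq z n" "rseq \<eta> n"]
            by (simp add: gromov_commute[of b "rseq z n"])
        qed
      qed
      then show ?thesis using 2 by (auto simp: V_def)
    qed
    then show ?thesis by blast
  qed
  ultimately have "openin (htopology b) V"
    unfolding openin_htopology hopen_def by auto
  moreover have "\<xi> \<in> V"
  proof -
    have "near z" if "\<forall>\<^sub>F n in sequentially. R + 1 \<le> gromov b z (rseq \<xi> n)" for z
      using that unfolding near_def by (intro exI[of _ "R + 1"]) auto
    then show ?thesis using \<xi> by (auto simp: V_def)
  qed
  moreover have "\<forall>\<^sub>F n in sequentially. R \<le> gromov b x (rseq \<xi> n)" if "Inner x \<in> V" for x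
  proof -
    have "near x" using that by (auto simp: V_def)
    then obtain R' where R': "R' > R" "\<forall>\<^sub>F n in sequentially. R' \<le> gromov b x (rseq \<xi> n)"
      by (auto simp: near_def)
    from R'(2) show ?thesis by eventually_elim (use R' in auto)
  qed
  ultimately show ?thesis by blast
qed

text \<open>An iterated limit becomes a joint one: an index \<open>k\<close> late for both the given
  \<open>n\<close> and the ray links \<open>x n\<close> to \<open>rseq \<xi> m\<close> at the cost
  of \<delta>.\<close>

lemma gsim_rseqI:
  assumes \<xi>: "\<xi> \<in> hboundary"
    and *: "\<And>R. \<forall>\<^sub>F n in sequentially. \<forall>\<^sub>F k in sequentially. R \<le> gromov b (x n) (rseq \<xi> k)"
  shows "gsim b x (rseq \<xi>)"
  unfolding gsim_def
proof
  fix R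
  obtain N where N: "\<And>n. n \<ge> N \<Longrightarrow> \<forall>\<^sub>F k in sequentially. R + \<delta> \<le> gromov b (x n) (rseq \<xi> k)"
    using *[of "R + \<delta>"] by (auto simp: eventually_sequentially)
  obtain M where M: "\<And>n m. n \<ge> M \<Longrightarrow> m \<ge> M \<Longrightarrow> R + \<delta> \<le> gromov b (rseq \<xi> n) (rseq \<xi> m)"
    using gsimD[OF gsim_rseq[OF \<xi>]] by blast
  have "R \<le> gromov b (x n) (rseq \<xi> m)" if "n \<ge> max N M" "m \<ge> max N M" for n m
  proof -
    have "\<forall>\<^sub>F k in sequentially. k \<ge> M \<and> R + \<delta> \<le> gromov b (x n) (rseq \<xi> k)"
      using N[of n] that by (intro eventually_conj eventually_ge_at_top) auto
    then obtain k where "k \<ge> M" "R + \<delta> \<le> gromov b (x n) (rseq \<xi> k)"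
      by (auto dest: eventually_happens)
    then show ?thesis using hyp_ge[OF _ M[of k m]] that by fastforce
  qed
  then show "\<exists>N. \<forall>n\<ge>N. \<forall>m\<ge>N. R \<le> gromov b (x n) (rseq \<xi> m)" by blast
qed

lemma gsim_if_limitin:
  assumes \<xi>: "\<xi> \<in> hboundary" and lim: "limitin (htopology b) (\<lambda>n. Inner (x n)) \<xi> sequentially"
  shows "gsim b x (rseq \<xi>)"
proof (rule gsim_rseqI[OF \<xi>])
  fix R
  obtain V where V: "openin (htopology b) V" "\<xi> \<in> V"
    "\<And>x. Inner x \<in> V \<Longrightarrow> \<forall>\<^sub>F n in sequentially. R \<le> gromov b x (rseq \<xi> n)"
    using end_neighbourhood[OF \<xi>] by metis
  have "\<forall>\<^sub>F n in sequentially. Inner (x n) \<in> V"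
    using lim V by (auto simp: limitin_def)
  then show "\<forall>\<^sub>F n in sequentially. \<forall>\<^sub>F k in sequentially. R \<le> gromov b (x n) (rseq \<xi> k)"
    by eventually_elim (rule V)
qed

text \<open>Accumulation is a statement about neighbourhoods; choosing an orbit point in the
  neighbourhood of level \<open>j\<close> for each \<open>j\<close> yields an actual
  sequence.\<close>

lemma limit_setE:
  assumes "\<xi> \<in> limit_set b G"
  obtains g where "\<And>n. g n \<in> G" "gsim b (\<lambda>n. g n b) (rseq \<xi>)" "\<xi> \<in> hboundary"
proof -
  have \<xi>: "\<xi> \<in> hboundary" and der: "\<xi> \<in> htopology b derived_set_of ((\<lambda>g. Inner (g b)) ` G)"
    using assms by (auto simp: limit_set_def)
  have "\<exists>g\<in>G. \<forall>\<^sub>F n in sequentially. real j \<le> gromov b (g b) (rseq \<xi> n)" for j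
  proof -
    obtain V where V: "openin (htopology b) V" "\<xi> \<in> V"
      "\<And>x. Inner x \<in> V \<Longrightarrow> \<forall>\<^sub>F n in sequentially. real j \<le> gromov b x (rseq \<xi> n)"
      using end_neighbourhood[OF \<xi>] by metis
    then obtain y where "y \<in> (\<lambda>g. Inner (g b)) ` G" "y \<in> V"
      using der unfolding derived_set_of_def by blast
    then show ?thesis using V(3) by blast
  qed
  then obtain g where g: "\<And>j. g j \<in> G" "\<And>j. \<forall>\<^sub>F n in sequentially. real j \<le> gromov b (g j b) (rseq \<xi> n)"
    by metis
  have "gsim b (\<lambda>j. g j b) (rseq \<xi>)"
  proof (rule gsim_rseqI[OF \<xi>])
    fix R
    have "\<forall>\<^sub>F n in sequentially. R \<le> real n"
      using filterlim_real_sequentially unfolding filterlim_at_top by blast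
    then show "\<forall>\<^sub>F n in sequentially. \<forall>\<^sub>F k in sequentially. R \<le> gromov b (g n b) (rseq \<xi> k)"
    proof eventually_elim
      case (elim n)
      show ?case using g(2)[of n] by eventually_elim (use elim in linarith)
    qed
  qed
  with g(1) \<xi> that show ?thesis by blast
qed

end

section \<open>The action on the boundary\<close>

text \<open>Uses the chosen ray; \<open>bact_eqI\<close> shows that any sequence converging to \<xi>
  may be used instead.\<close>

definition bact :: "('a::metric_space \<Rightarrow> 'a) \<Rightarrow> 'a hpoint \<Rightarrow> 'a hpoint" where
  "bact g \<xi> = end_of (\<lambda>t. g (ray_of \<xi> t))"

lemma bact_ray: "isom g \<Longrightarrow> \<xi> \<in> hboundary \<Longrightarrow> (\<lambda>t. g (ray_of \<xi> t)) \<in> geodesic_rays"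
  using ray_of(1)[of \<xi>] by (auto simp: geodesic_rays_def isom_dist)

lemma bact_in [simp]: "isom g \<Longrightarrow> \<xi> \<in> hboundary \<Longrightarrow> bact g \<xi> \<in> hboundary"
  using bact_ray by (auto simp: hboundary_eq bact_def)

locale visual_hyperbolic = gromov_hyperbolic b \<delta> for b :: "'a::metric_space" and \<delta> +
  fixes a :: real and D :: "'a hpoint \<Rightarrow> 'a hpoint \<Rightarrow> real" and \<Lambda> :: real
  assumes a: "a > 1" and \<Lambda>: "\<Lambda> > 0"
    and metric: "Metric_space hclosure D"
    and topology: "Metric_space.mtopology hclosure D = htopology b"
    and D_le: "\<And>x y. x \<in> hclosure \<Longrightarrow> y \<in> hclosure \<Longrightarrow> D x y \<le> \<Lambda> * neg_powr a (gromov_ext b x y)"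
begin

lemma neg_powr_le:
  assumes "ereal R \<le> t"
  shows "neg_powr a t \<le> a powr (- R)"
  using assms a by (cases t) (auto simp: neg_powr_def)

lemma D_le_powr:
  assumes "\<xi> \<in> hboundary" "\<eta> \<in> hboundary" "gsim b x (rseq \<xi>)" "gsim b y (rseq \<eta>)"
    and "\<And>N. \<exists>n\<ge>N. \<exists>m\<ge>N. R \<le> gromov b (x n) (y m)"
  shows "D \<xi> \<eta> \<le> \<Lambda> * a powr (2 * \<delta> - R)"
proof -
  have "D \<xi> \<eta> \<le> \<Lambda> * neg_powr a (gromov_ext b \<xi> \<eta>)"
    using D_le assms hboundary_subset by blast
  also have "\<dots> \<le> \<Lambda> * a powr (- (R - 2 * \<delta>))"
    using neg_powr_le[OF gromov_ext_ge[OF assms]] \<Lambda> by (intro mult_left_mono) auto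
  finally show ?thesis by simp
qed

text \<open>Unbounded products of the two rays make \<open>D\<close> smaller than \<Lambda> a^(2
  \<delta> - R) for every R, hence zero. The metric replaces the argument that such rays stay at
  bounded distance.\<close>

lemma end_eqI:
  assumes "\<xi> \<in> hboundary" "\<eta> \<in> hboundary" "gsim b (rseq \<xi>) (rseq \<eta>)"
  shows "\<xi> = \<eta>"
proof -
  interpret Metric_space hclosure D by (rule metric)
  have le: "D \<xi> \<eta> \<le> \<Lambda> * a powr (2 * \<delta> - R)" for R
  proof (rule D_le_powr[OF assms(1,2) gsim_rseq[OF assms(1)] gsim_rseq[OF assms(2)]])
    fix N
    obtain N' where "\<forall>n\<ge>N'. \<forall>m\<ge>N'. R \<le> gromov b (rseq \<xi> n) (rseq \<eta> m)"
      using gsimD[OF assms(3)] by blast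
    then show "\<exists>n\<ge>N. \<exists>m\<ge>N. R \<le> gromov b (rseq \<xi> n) (rseq \<eta> m)"
      by (meson max.cobounded1 max.cobounded2)
  qed
  have "D \<xi> \<eta> \<le> 0"
  proof (rule ccontr)
    assume pos: "\<not> D \<xi> \<eta> \<le> 0"
    \<comment> \<open>For this value the upper bound is exactly \<open>D \<xi> \<eta> / a\<close>,
      which is too small.\<close>
    define R where "R = 2 * \<delta> + 1 - log a (D \<xi> \<eta> / \<Lambda>)"
    have "\<Lambda> * a powr (2 * \<delta> - R) = \<Lambda> * (a powr log a (D \<xi> \<eta> / \<Lambda>) * a powr - 1)"
      unfolding R_def powr_add[symmetric] by simp
    also have "\<dots> = D \<xi> \<eta> / a"
      using pos \<Lambda> a by (simp add: powr_minus divide_simps)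
    also have "\<dots> < D \<xi> \<eta>"
      using pos a by (simp add: divide_simps)
    finally show False using le[of R] by simp
  qed
  then show ?thesis
    using assms hboundary_subset nonneg[of \<xi> \<eta>] zero[of \<xi> \<eta>] by auto
qed

text \<open>By \<open>end_eqI\<close> the products do not tend to infinity, which bounds them only
  at some late indices; \<open>gsim_transfer_le\<close> extends this to all late ones.\<close>

lemma distinct_ends_gromov_bounded:
  assumes "\<xi> \<in> hboundary" "\<eta> \<in> hboundary" "\<xi> \<noteq> \<eta>" "gsim b x (rseq \<xi>)" "gsim b y (rseq \<eta>)"
  shows "\<exists>K N. \<forall>n\<ge>N. \<forall>m\<ge>N. gromov b (x n) (y m) \<le> K"
proof -
  have "\<not> gsim b x y"
    using assms end_eqI gsim_trans gsim_sym by metis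
  then obtain R where R: "\<And>N. \<exists>n\<ge>N. \<exists>m\<ge>N. gromov b (x n) (y m) \<le> R"
    using not_gsimD by metis
  have "gsim b x x" "gsim b y y"
    using assms gsim_trans gsim_sym by metis+
  from gsim_transfer_le[OF this R] show ?thesis by blast
qed

lemma rseq_bact:
  assumes "isom g" "\<xi> \<in> hboundary"
  shows "gsim b (rseq (bact g \<xi>)) (\<lambda>n. g (rseq \<xi> n))"
proof -
  have "seq_tends b (rseq (bact g \<xi>)) (bact g \<xi>)"
    using assms by (simp add: seq_tends_iff gsim_rseq)
  then show ?thesis
    using seq_tends_end_of[OF bact_ray[OF assms]] by (simp add: bact_def rseq_def)
qed

lemma bact_eqI:
  assumes "isom g" "\<xi> \<in> hboundary" "\<eta> \<in> hboundary" "gsim b x (rseq \<xi>)" "gsim b (\<lambda>n. g (x n)) (rseq \<eta>)"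
  shows "bact g \<xi> = \<eta>"
proof (rule end_eqI)
  show "gsim b (rseq (bact g \<xi>)) (rseq \<eta>)"
    using rseq_bact[OF assms(1,2)] gsim_isom[OF assms(1,4)] assms(5) gsim_trans gsim_sym by metis
qed (use assms in auto)

lemma bact_comp:
  fixes \<xi> :: "'a hpoint"
  assumes "isom g" "isom h" "\<xi> \<in> hboundary"
  shows "bact (g \<circ> h) \<xi> = bact g (bact h \<xi>)"
proof (rule bact_eqI)
  show "gsim b (rseq \<xi>) (rseq \<xi>)" using assms by (simp add: gsim_rseq)
  have "gsim b (\<lambda>n. g (h (rseq \<xi> n))) (\<lambda>n. g (rseq (bact h \<xi>) n))"
    by (rule gsim_isom[OF assms(1) gsim_sym[OF rseq_bact[OF assms(2,3)]]])
  moreover have "gsim b (rseq (bact g (bact h \<xi>))) (\<lambda>n. g (rseq (bact h \<xi>) n))"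
    using rseq_bact[OF assms(1)] assms by simp
  ultimately show "gsim b (\<lambda>n. (g \<circ> h) (rseq \<xi> n)) (rseq (bact g (bact h \<xi>)))"
    using gsim_trans gsim_sym unfolding o_def by blast
qed (use assms isom_comp in auto)

lemma bact_id: fixes \<xi> :: "'a hpoint" shows "\<xi> \<in> hboundary \<Longrightarrow> bact id \<xi> = \<xi>"
  using bact_eqI[OF isom_id, of \<xi> \<xi> "rseq \<xi>"] gsim_rseq[of \<xi> b] by simp

lemma bact_inv:
  fixes \<xi> :: "'a hpoint"
  assumes "isom g" "\<xi> \<in> hboundary"
  shows "bact g (bact (invf g) \<xi>) = \<xi>" "bact (invf g) (bact g \<xi>) = \<xi>"
proof -
  have "g \<circ> invf g = id" "invf g \<circ> g = id"
    using assms by (auto simp: fun_eq_iff)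
  then show "bact g (bact (invf g) \<xi>) = \<xi>" "bact (invf g) (bact g \<xi>) = \<xi>"
    using assms bact_comp[of g "invf g" \<xi>] bact_comp[of "invf g" g \<xi>] isom_inv[OF assms(1)] bact_id[OF assms(2)]
    by simp_all
qed

section \<open>Orbits that preserve two ends\<close>

text \<open>The bound \<open>K\<close> says that \<open>p n\<close> stays near the geodesics from
  \<xi>1 to \<xi>2. If \<eta> were a third end, (p n|\<xi>1) and (p n|\<xi>2) would be bounded at
  \<open>b\<close>, and changing the base point would bound the distance from \<open>b\<close> to
  \<open>p n\<close>.\<close>

lemma orbit_near_two_ends:
  assumes \<xi>: "\<xi>1 \<in> hboundary" "\<xi>2 \<in> hboundary" "\<xi>1 \<noteq> \<xi>2"
    and K: "\<And>n. \<forall>\<^sub>F k in sequentially. gromov (p n) (rseq \<xi>1 k) (rseq \<xi>2 k) \<le> K"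
    and \<eta>: "\<eta> \<in> hboundary" "gsim b p (rseq \<eta>)"
  shows "\<eta> = \<xi>1 \<or> \<eta> = \<xi>2"
proof (rule ccontr)
  assume "\<not> ?thesis"
  then obtain K1 N1 K2 N2 where K1: "\<And>n m. n \<ge> N1 \<Longrightarrow> m \<ge> N1 \<Longrightarrow> gromov b (p n) (rseq \<xi>1 m) \<le> K1"
      and K2: "\<And>n m. n \<ge> N2 \<Longrightarrow> m \<ge> N2 \<Longrightarrow> gromov b (p n) (rseq \<xi>2 m) \<le> K2"
    using distinct_ends_gromov_bounded[OF \<eta>(1) \<xi>(1) _ \<eta>(2) gsim_rseq[OF \<xi>(1)]]
      distinct_ends_gromov_bounded[OF \<eta>(1) \<xi>(2) _ \<eta>(2) gsim_rseq[OF \<xi>(2)]] by metis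
  have "dist b (p n) \<le> K + K1 + K2" if "n \<ge> max N1 N2" for n
  proof -
    have "\<forall>\<^sub>F k in sequentially. k \<ge> max N1 N2 \<and> gromov (p n) (rseq \<xi>1 k) (rseq \<xi>2 k) \<le> K"
      by (intro eventually_conj eventually_ge_at_top K)
    then obtain k where k: "k \<ge> max N1 N2" "gromov (p n) (rseq \<xi>1 k) (rseq \<xi>2 k) \<le> K"
      by (auto dest: eventually_happens)
    then show ?thesis
      using K1[of n k] K2[of n k] that gromov_change_base[of "p n" "rseq \<xi>1 k" "rseq \<xi>2 k" b]
        gromov_nonneg[of b "rseq \<xi>1 k" "rseq \<xi>2 k"] by simp
  qed
  then have "\<forall>\<^sub>F n in sequentially. dist b (p n) \<le> K + K1 + K2"
    unfolding eventually_sequentially by blast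
  moreover have "\<forall>\<^sub>F n in sequentially. dist b (p n) \<ge> K + K1 + K2 + 1"
    using gsim_dist_at_top[OF \<eta>(2)] unfolding filterlim_at_top by blast
  ultimately have "\<forall>\<^sub>F n in sequentially. False"
    by eventually_elim linarith
  then show False by simp
qed

text \<open>Seen from \<open>h b\<close>, the ends \<xi>1 and \<xi>2 look like their images under
  the inverse of \<open>h\<close> seen from \<open>b\<close>. These are again two distinct points of
  \<open>F\<close>, so finitely many pairs give one bound for the whole orbit.\<close>

lemma finite_invariant_ends:
  assumes F: "finite F" "F \<subseteq> hboundary"
    and isom: "\<And>g. g \<in> G \<Longrightarrow> isom g" and inv: "\<And>g. g \<in> G \<Longrightarrow> invf g \<in> G"
    and act: "\<And>g \<xi>. g \<in> G \<Longrightarrow> \<xi> \<in> F \<Longrightarrow> bact g \<xi> \<in> F"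
    and \<xi>: "\<xi>1 \<in> F" "\<xi>2 \<in> F" "\<xi>1 \<noteq> \<xi>2"
  shows "limit_set b G \<subseteq> {\<xi>1, \<xi>2}"
proof
  fix \<eta> assume "\<eta> \<in> limit_set b G"
  then obtain g where g: "\<And>n. g n \<in> G" "gsim b (\<lambda>n. g n b) (rseq \<eta>)" "\<eta> \<in> hboundary"
    using limit_setE by metis
  have "\<exists>K N. \<forall>n\<ge>N. \<forall>m\<ge>N. gromov b (rseq x n) (rseq y m) \<le> K"
    if "x \<in> F" "y \<in> F" "x \<noteq> y" for x y
    using distinct_ends_gromov_bounded[of x y "rseq x" "rseq y"] that F gsim_rseq by blast
  then obtain K where K: "\<And>x y. x \<in> F \<Longrightarrow> y \<in> F \<Longrightarrow> x \<noteq> y \<Longrightarrow>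
      \<exists>N. \<forall>n\<ge>N. \<forall>m\<ge>N. gromov b (rseq x n) (rseq y m) \<le> K x y"
    by metis
  \<comment> \<open>On the diagonal the values of \<open>K\<close> are arbitrary; including them
    only weakens the bound.\<close>
  define K' where "K' = Max ((\<lambda>(x, y). K x y) ` (F \<times> F))"
  have K': "K x y \<le> K'" if "x \<in> F" "y \<in> F" for x y
    unfolding K'_def using F that by (intro Max_ge) auto
  have "\<forall>\<^sub>F k in sequentially. gromov (h b) (rseq \<xi>1 k) (rseq \<xi>2 k) \<le> K' + 2 * \<delta>" if h: "h \<in> G" for h
  proof -
    define h' where "h' = invf h"
    have h': "h' \<in> G" "isom h'" "isom h" using h inv isom isom_inv by (auto simp: h'_def)
    have xi: "\<xi>1 \<in> hboundary" "\<xi>2 \<in> hboundary" using \<xi> F by auto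
    have "bact h' \<xi>1 \<noteq> bact h' \<xi>2"
      using bact_inv(1)[OF h'(3)] \<xi> xi unfolding h'_def by metis
    from K[OF act[OF h'(1) \<xi>(1)] act[OF h'(1) \<xi>(2)] this]
    obtain N where N: "\<And>n m. n \<ge> N \<Longrightarrow> m \<ge> N \<Longrightarrow>
        gromov b (rseq (bact h' \<xi>1) n) (rseq (bact h' \<xi>2) m) \<le> K'"
      using K'[OF act[OF h'(1) \<xi>(1)] act[OF h'(1) \<xi>(2)]] by fastforce
    have "\<exists>n\<ge>M. \<exists>m\<ge>M. gromov b (rseq (bact h' \<xi>1) n) (rseq (bact h' \<xi>2) m) \<le> K'" for M
      using N[of "max N M" "max N M"] by (meson max.cobounded1 max.cobounded2)
    from gsim_transfer_le[OF rseq_bact[OF h'(2) xi(1)] rseq_bact[OF h'(2) xi(2)] this]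
    obtain N where "\<And>n m. n \<ge> N \<Longrightarrow> m \<ge> N \<Longrightarrow> gromov b (h' (rseq \<xi>1 n)) (h' (rseq \<xi>2 m)) \<le> K' + 2 * \<delta>"
      by blast
    then have "gromov (h b) (rseq \<xi>1 n) (rseq \<xi>2 n) \<le> K' + 2 * \<delta>" if "n \<ge> N" for n
      using that by (simp add: isom_gromov_inv[OF h'(3)] h'_def)
    then show ?thesis unfolding eventually_sequentially by blast
  qed
  from orbit_near_two_ends[OF _ _ \<xi>(3) this[OF g(1)] g(3,2)] show "\<eta> \<in> {\<xi>1, \<xi>2}"
    using \<xi> F by blast
qed

end

section \<open>Groups that fix an end\<close>

definition busemann :: "'a::metric_space hpoint \<Rightarrow> 'a \<Rightarrow> real" where
  "busemann \<xi> x = lim (\<lambda>n. dist x (rseq \<xi> n) - real n)"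

text \<open>The Gromov product with \<open>\<xi>\<close>, computed along the chosen ray.\<close>

definition end_gromov :: "'a::metric_space hpoint \<Rightarrow> 'a \<Rightarrow> 'a \<Rightarrow> real" where
  "end_gromov \<xi> p x = (dist p x + busemann \<xi> p - busemann \<xi> x) / 2"

text \<open>The triangle inequality makes the sequence decreasing and keeps it within
  \<open>dist x (rseq \<xi> 0)\<close> of zero. Along a fixed ray the Busemann function is thus a
  genuine limit, which makes the identities for \<open>end_gromov\<close> exact.\<close>

lemma busemann_lim:
  assumes "\<xi> \<in> hboundary"
  shows "(\<lambda>n. dist x (rseq \<xi> n) - real n) \<longlonglongrightarrow> busemann \<xi> x"
proof -
  have d: "dist (rseq \<xi> n) (rseq \<xi> m) = \<bar>real n - real m\<bar>" for n m
    using ray_dist[OF ray_of(1)[OF assms]] by (simp add: rseq_def)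
  have "convergent (\<lambda>n. dist x (rseq \<xi> n) - real n)"
  proof (rule Bseq_monoseq_convergent)
    show "monoseq (\<lambda>n. dist x (rseq \<xi> n) - real n)"
    proof (rule decseq_imp_monoseq, rule decseq_SucI)
      fix n
      show "dist x (rseq \<xi> (Suc n)) - real (Suc n) \<le> dist x (rseq \<xi> n) - real n"
        using dist_triangle[of x "rseq \<xi> (Suc n)" "rseq \<xi> n"] d[of n "Suc n"] by simp
    qed
    have "\<bar>dist x (rseq \<xi> n) - real n\<bar> \<le> dist x (rseq \<xi> 0)" for n
      using dist_triangle[of x "rseq \<xi> n" "rseq \<xi> 0"] dist_triangle[of "rseq \<xi> 0" "rseq \<xi> n" x] d[of 0 n]
      by (simp add: dist_commute abs_le_iff)
    then show "Bseq (\<lambda>n. dist x (rseq \<xi> n) - real n)"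
      by (intro BseqI') auto
  qed
  then show ?thesis
    unfolding busemann_def by (simp add: convergent_LIMSEQ_iff)
qed

lemma end_gromov_lim:
  assumes "\<xi> \<in> hboundary"
  shows "(\<lambda>n. gromov p x (rseq \<xi> n)) \<longlonglongrightarrow> end_gromov \<xi> p x"
proof -
  have "(\<lambda>n. (dist p x + (dist p (rseq \<xi> n) - real n) - (dist x (rseq \<xi> n) - real n)) / 2)
      \<longlonglongrightarrow> end_gromov \<xi> p x"
    unfolding end_gromov_def by (intro tendsto_intros busemann_lim assms) simp
  then show ?thesis by (simp add: gromov_def algebra_simps)
qed

lemma end_gromov_nonneg: "\<xi> \<in> hboundary \<Longrightarrow> 0 \<le> end_gromov \<xi> p x"
  by (rule LIMSEQ_le_const[OF end_gromov_lim]) (auto simp: gromov_nonneg)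

lemma end_gromov_le_dist: "\<xi> \<in> hboundary \<Longrightarrow> end_gromov \<xi> p x \<le> dist p x"
  by (rule LIMSEQ_le_const2[OF end_gromov_lim]) (auto simp: gromov_le_dist)

lemma end_gromov_arg_diff:
  assumes "\<xi> \<in> hboundary"
  shows "end_gromov \<xi> p x \<le> end_gromov \<xi> p y + dist x y"
proof (rule LIMSEQ_le[OF end_gromov_lim[OF assms]])
  show "(\<lambda>n. gromov p y (rseq \<xi> n) + dist x y) \<longlonglongrightarrow> end_gromov \<xi> p y + dist x y"
    by (intro tendsto_intros end_gromov_lim assms)
  show "\<exists>N. \<forall>n\<ge>N. gromov p x (rseq \<xi> n) \<le> gromov p y (rseq \<xi> n) + dist x y"
    using gromov_arg_diff[of p x "rseq \<xi> _" y] by (intro exI[of _ 0]) (smt (verit))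
qed

lemma end_gromov_swap_base: "end_gromov \<xi> p x + end_gromov \<xi> x p = dist p x"
  by (simp add: end_gromov_def dist_commute field_simps)

text \<open>The limit form of \<open>gromov_change_base\<close> with one point sent to \<xi>, solved
  for the product that does not involve \<xi>.\<close>

lemma end_gromov_change_base:
  "gromov b p w = end_gromov \<xi> b w + dist b p - end_gromov \<xi> b p - end_gromov \<xi> p w"
  by (simp add: end_gromov_def gromov_def dist_commute field_simps)

context visual_hyperbolic
begin

lemma end_gromov_hyp:
  fixes p :: 'a
  assumes "\<xi> \<in> hboundary"
  shows "min (end_gromov \<xi> p x) (end_gromov \<xi> p y) - \<delta> \<le> gromov p x y"
proof (rule LIMSEQ_le_const2)
  show "(\<lambda>n. min (gromov p x (rseq \<xi> n)) (gromov p y (rseq \<xi> n)) - \<delta>)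
      \<longlonglongrightarrow> min (end_gromov \<xi> p x) (end_gromov \<xi> p y) - \<delta>"
    by (intro tendsto_intros end_gromov_lim assms)
  show "\<exists>N. \<forall>n\<ge>N. min (gromov p x (rseq \<xi> n)) (gromov p y (rseq \<xi> n)) - \<delta> \<le> gromov p x y"
    using hyp[of p x "rseq \<xi> _" y] by (simp add: gromov_commute)
qed

lemma end_gromov_hyp':
  fixes p :: 'a
  assumes "\<xi> \<in> hboundary"
  shows "min (end_gromov \<xi> p x) (gromov p x y) - \<delta> \<le> end_gromov \<xi> p y"
proof (rule LIMSEQ_le[OF _ end_gromov_lim[OF assms]])
  show "(\<lambda>n. min (gromov p x (rseq \<xi> n)) (gromov p x y) - \<delta>)
      \<longlonglongrightarrow> min (end_gromov \<xi> p x) (gromov p x y) - \<delta>"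
    by (intro tendsto_intros end_gromov_lim assms)
  show "\<exists>N. \<forall>n\<ge>N. min (gromov p x (rseq \<xi> n)) (gromov p x y) - \<delta> \<le> gromov p y (rseq \<xi> n)"
    using hyp[of p y x "rseq \<xi> _"] by (simp add: gromov_commute min.commute)
qed

text \<open>An isometry fixing \<xi> sends the chosen ray to another ray towards \<xi>, so
  invariance holds only up to the one hyperbolic inequality that compares the two rays.\<close>

lemma end_gromov_isom:
  fixes p :: 'a
  assumes g: "isom g" and \<xi>: "\<xi> \<in> hboundary" and fix_xi: "bact g \<xi> = \<xi>"
  shows "\<bar>end_gromov \<xi> (g p) (g x) - end_gromov \<xi> p x\<bar> \<le> \<delta>"
proof -
  let ?u = "rseq \<xi>"
  have "gsim b ?u (\<lambda>n. g (?u n))"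
    using rseq_bact[OF g \<xi>] fix_xi by simp
  then have "gsim (g p) ?u (\<lambda>n. g (?u n))" by (rule gsim_base)
  \<comment> \<open>This threshold bounds every product with \<open>g x\<close>, so the minimum in
    the hyperbolic inequality is always attained by the other term.\<close>
  then obtain N where N: "\<And>n m. n \<ge> N \<Longrightarrow> m \<ge> N \<Longrightarrow> dist (g p) (g x) \<le> gromov (g p) (?u n) (g (?u m))"
    using gsimD by blast
  have le: "gromov (g p) (g x) y \<le> dist (g p) (g x)" for y
    by (rule gromov_le_dist)
  have eq: "gromov (g p) (g x) (g y) = gromov p x y" for y
    by (rule isom_gromov[OF g])
  have 1: "gromov p x (?u n) - \<delta> \<le> gromov (g p) (g x) (?u n)" if "n \<ge> N" for n
    using hyp[of "g p" "g x" "g (?u n)" "?u n"] N[OF that that] le[of "g (?u n)"]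
    by (simp add: eq gromov_commute[of _ "g (?u n)"])
  have 2: "gromov (g p) (g x) (?u n) - \<delta> \<le> gromov p x (?u n)" if "n \<ge> N" for n
    using hyp[of "g p" "g x" "?u n" "g (?u n)"] N[OF that that] le[of "?u n"]
    by (simp add: eq)
  have "end_gromov \<xi> p x - \<delta> \<le> end_gromov \<xi> (g p) (g x)"
    by (rule LIMSEQ_le[OF tendsto_diff[OF end_gromov_lim[OF \<xi>] tendsto_const] end_gromov_lim[OF \<xi>]])
      (use 1 in blast)
  moreover have "end_gromov \<xi> (g p) (g x) - \<delta> \<le> end_gromov \<xi> p x"
    by (rule LIMSEQ_le[OF tendsto_diff[OF end_gromov_lim[OF \<xi>] tendsto_const] end_gromov_lim[OF \<xi>]])
      (use 2 in blast)
  ultimately show ?thesis by linarith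
qed

lemma limit_point_end_gromov_le:
  assumes "\<xi> \<in> hboundary" "\<eta> \<in> hboundary" "\<eta> \<noteq> \<xi>" "gsim b p (rseq \<eta>)"
  shows "\<exists>K N. \<forall>n\<ge>N. end_gromov \<xi> b (p n) \<le> K"
proof -
  obtain K N where KN: "\<And>n m. n \<ge> N \<Longrightarrow> m \<ge> N \<Longrightarrow> gromov b (p n) (rseq \<xi> m) \<le> K"
    using distinct_ends_gromov_bounded[OF assms(2,1,3,4) gsim_rseq[OF assms(1)]] by blast
  have "end_gromov \<xi> b (p n) \<le> K" if "n \<ge> N" for n
    by (rule LIMSEQ_le_const2[OF end_gromov_lim[OF assms(1)]]) (use KN[OF that] in blast)
  then show ?thesis by blast
qed

text \<open>The map \<open>\<phi>\<close> is a quasimorphism.  If it is bounded above, then every orbit stays close to a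
  horosphere at \<open>\<xi>\<close>, so \<open>\<xi>\<close> is its only limit point.  Otherwise some \<open>g\<close> is loxodromic.  Moving
  along its axis towards \<open>\<xi>\<close>, every \<open>h\<close> is displaced by a bounded amount, so by discreteness \<open>h\<close>
  commutes with a power of \<open>g\<close> and preserves the axis of \<open>g\<close>.\<close>

lemma limit_set_fixed_end:
  assumes isom: "\<And>g. g \<in> G \<Longrightarrow> isom g" and inv: "\<And>g. g \<in> G \<Longrightarrow> invf g \<in> G"
    and comp: "\<And>g h. g \<in> G \<Longrightarrow> h \<in> G \<Longrightarrow> g \<circ> h \<in> G" and id: "id \<in> G"
    and discrete: "\<And>K. finite {g \<in> G. dist b (g b) \<le> K}"
    and \<xi>: "\<xi> \<in> hboundary" and fix_xi: "\<And>g. g \<in> G \<Longrightarrow> bact g \<xi> = \<xi>"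
  shows "\<exists>\<eta>. limit_set b G \<subseteq> {\<xi>, \<eta>}"
proof -
  \<comment> \<open>Positive when \<open>g\<close> moves \<open>b\<close> towards \<xi>. The defect
    \<open>2 * \<delta>\<close> below is the error of \<open>end_gromov_isom\<close>, doubled
    because \<open>end_gromov\<close> is half a Busemann difference.\<close>
  define \<phi> where "\<phi> g = busemann \<xi> b - busemann \<xi> (g b)" for g
  have eg: "end_gromov \<xi> b (g b) = (dist b (g b) + \<phi> g) / 2" for g
    by (simp add: end_gromov_def \<phi>_def)
  note eg_isom = end_gromov_isom[OF isom \<xi> fix_xi]
  have \<phi>_comp: "\<bar>\<phi> (g \<circ> h) - \<phi> g - \<phi> h\<bar> \<le> 2 * \<delta>" if "g \<in> G" "h \<in> G" for g h
  proof -
    have "2 * end_gromov \<xi> (g b) (g (h b)) = dist b (h b) + busemann \<xi> (g b) - busemann \<xi> (g (h b))"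
      by (simp add: end_gromov_def isom_dist[OF isom[OF that(1)]])
    then show ?thesis
      using eg_isom[OF that(1,1), of b "h b"] eg[of h] by (simp add: \<phi>_def abs_le_iff field_simps)
  qed
  have \<phi>_id: "\<phi> id = 0" by (simp add: \<phi>_def)
  have \<phi>_inv: "\<bar>\<phi> g + \<phi> (invf g)\<bar> \<le> 2 * \<delta>" if "g \<in> G" for g
  proof -
    have "g \<circ> invf g = id" using isom[OF that] by (auto simp: fun_eq_iff)
    then show ?thesis using \<phi>_comp[OF that inv[OF that]] \<phi>_id by simp
  qed
  have \<phi>_le: "\<phi> g \<le> dist b (g b)" for g
    using end_gromov_le_dist[OF \<xi>, of b "g b"] eg[of g] by simp
  show ?thesis
  \<comment> \<open>This exceeds the defect \<open>2 * \<delta>\<close> by at least 1, so \<phi>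
    grows at least linearly on the powers of \<open>g\<close>; twice it also pays for the
    \<open>6 * \<delta>\<close> in the bound of \<open>w_bounded\<close>.\<close>
  proof (cases "\<exists>g\<in>G. \<phi> g \<ge> 3 * \<delta> + 1")
    case False
    have "\<eta> = \<xi>" if "\<eta> \<in> limit_set b G" for \<eta>
    proof (rule ccontr)
      assume ne: "\<eta> \<noteq> \<xi>"
      obtain g where g: "\<And>n. g n \<in> G" "gsim b (\<lambda>n. g n b) (rseq \<eta>)" "\<eta> \<in> hboundary"
        using limit_setE \<open>\<eta> \<in> limit_set b G\<close> by metis
      obtain K N where K: "\<And>n. n \<ge> N \<Longrightarrow> end_gromov \<xi> b (g n b) \<le> K"
        using limit_point_end_gromov_le[OF \<xi> g(3) ne g(2)] by blast
      have "\<forall>\<^sub>F n in sequentially. n \<ge> N \<and> dist b (g n b) \<ge> 2 * K + 5 * \<delta> + 1"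
        using gsim_dist_at_top[OF g(2)] unfolding filterlim_at_top
        by (intro eventually_conj eventually_ge_at_top) blast
      then obtain n where n: "n \<ge> N" "dist b (g n b) \<ge> 2 * K + 5 * \<delta> + 1"
        by (auto dest: eventually_happens)
      \<comment> \<open>A bounded product with \<xi> at a distant point means that \<phi> is at most
        \<open>- 5 * \<delta> - 1\<close>; inverting loses \<open>2 * \<delta>\<close>.\<close>
      have "\<phi> (invf (g n)) \<ge> 3 * \<delta> + 1"
        using K[OF n(1)] n(2) \<phi>_inv[OF g(1)[of n]] eg[of "g n"] by (simp add: abs_le_iff)
      with False inv[OF g(1)] show False by auto
    qed
    then show ?thesis by blast
  next
    case True
    then obtain g where g: "g \<in> G" "\<phi> g \<ge> 3 * \<delta> + 1" by blast
    define f where "f = invf g"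
    have f: "f \<in> G" "isom f" "isom g" using g inv isom by (auto simp: f_def)
    have gf: "g (f x) = x" "f (g x) = x" for x
      using f by (simp_all add: f_def)
    have pow: "g ^^ n \<in> G" "f ^^ n \<in> G" for n
      by (induction n) (use g f comp id in \<open>auto simp flip: id_def\<close>)
    have gfn: "(g ^^ n) ((f ^^ n) x) = x" "(f ^^ n) ((g ^^ n) x) = x" for n x
      by (induction n arbitrary: x) (simp_all add: gf funpow_swap1)
    have \<phi>_pow: "\<phi> (g ^^ n) \<ge> real n" for n
    proof (induction n)
      case (Suc n)
      have "\<phi> (g ^^ Suc n) \<ge> \<phi> g + \<phi> (g ^^ n) - 2 * \<delta>"
        using \<phi>_comp[OF g(1) pow(1)[of n]] unfolding funpow.simps(2) by linarith
      then show ?case using Suc g(2) delta_nonneg by linarith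
    qed (simp add: \<phi>_def)
    \<comment> \<open>The orbit of \<open>b\<close> under the powers of the inverse of
      \<open>g\<close>, running along the axis away from \<xi>.\<close>
    define w where "w n = (f ^^ n) b" for n
    have w_far: "dist b (w n) \<ge> real n" for n
    proof -
      have "dist b (w n) = dist ((g ^^ n) b) ((g ^^ n) (w n))"
        by (simp add: isom_dist isom pow)
      also have "\<dots> = dist b ((g ^^ n) b)"
        by (simp add: w_def gfn dist_commute)
      finally show ?thesis using \<phi>_pow[of n] \<phi>_le[of "g ^^ n"] by linarith
    qed
    \<comment> \<open>The fixed bound of the recursion for (\<xi>|w n): if (\<xi>|w n) is the
      smaller product, the recursion yields this value; if (\<xi>|g b) is, the recursion decreases.
      Of \<open>6 * \<delta>\<close>, four come from composing and inverting under \<phi>, two from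
      hyperbolicity. The 0 covers \<open>n = 0\<close>.\<close>
    define Q where "Q = max 0 ((dist b (g b) - \<phi> g + 6 * \<delta>) / 2)"
    have w_bounded: "end_gromov \<xi> b (w n) \<le> Q" for n
    proof (induction n)
      case (Suc n)
      have d: "dist b (w (Suc n)) = dist (g b) (w n)"
        using isom_dist[OF f(3), of b "w (Suc n)"] by (simp add: w_def gf)
      have 1: "\<phi> (f ^^ Suc n) \<le> \<phi> (f ^^ n) - \<phi> g + 4 * \<delta>"
        using \<phi>_comp[OF f(1) pow(2)[of n]] \<phi>_inv[OF g(1)] by (simp add: f_def abs_le_iff)
      have 2: "dist (g b) (w n) = dist b (g b) + dist b (w n) - 2 * gromov b (g b) (w n)"
        by (simp add: gromov_def field_simps)
      have 3: "min (end_gromov \<xi> b (g b)) (end_gromov \<xi> b (w n)) - \<delta> \<le> gromov b (g b) (w n)"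
        by (rule end_gromov_hyp[OF \<xi>])
      have 4: "2 * end_gromov \<xi> b (w (Suc n)) = dist (g b) (w n) + \<phi> (f ^^ Suc n)"
        using eg[of "f ^^ Suc n"] d by (simp add: w_def)
      have 5: "2 * end_gromov \<xi> b (w n) = dist b (w n) + \<phi> (f ^^ n)"
        using eg[of "f ^^ n"] by (simp add: w_def)
      have 6: "dist b (g b) - \<phi> g + 6 * \<delta> \<le> 2 * Q"
        by (simp add: Q_def max_def)
      have 7: "2 * end_gromov \<xi> b (g b) = dist b (g b) + \<phi> g"
        using eg[of g] by simp
      have "2 * end_gromov \<xi> b (w (Suc n)) \<le> dist b (g b) + 2 * end_gromov \<xi> b (w n)
          - 2 * gromov b (g b) (w n) - \<phi> g + 4 * \<delta>"
        using 1 2 4 5 by linarith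
      then show ?case
        using 3 6 7 Suc g(2) delta_nonneg unfolding min_def by (simp split: if_splits)
    qed (simp add: w_def end_gromov_def Q_def)
    have commute: "\<exists>k>0. \<forall>x. (f ^^ k) (h x) = h ((f ^^ k) x)" if h: "h \<in> G" for h
    proof -
      \<comment> \<open>The displacement of \<open>b\<close> under \<open>c n\<close> is that of
        \<open>g ^^ n\<close> applied to \<open>b\<close> under \<open>h\<close>. This point lies
        far along the axis towards \<xi>, which \<open>h\<close> fixes, so the displacement is
        bounded in \<open>n\<close>; discreteness makes two of the conjugates equal.\<close>
      define c where "c n = (f ^^ n) \<circ> h \<circ> (g ^^ n)" for n
      have dh: "dist (invf h b) b = dist b (h b)"
        by (simp add: isom_dist_inv isom h)
      have "dist b (c n b) \<le> 3 * dist b (h b) + 2 * Q + 6 * \<delta>" for n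
      proof -
        define p where "p = (g ^^ n) b"
        have 0: "dist b (c n b) = dist p (h p)"
          using isom_dist[OF isom[OF pow(1)[of n]], of b "c n b"] by (simp add: p_def c_def gfn)
        have 1: "end_gromov \<xi> p b \<le> Q + \<delta>"
          using eg_isom[OF pow(1) pow(1), of n b "w n"] w_bounded[of n]
          by (simp add: p_def w_def gfn abs_le_iff)
        have 2: "end_gromov \<xi> (h p) b \<le> Q + 2 * \<delta> + dist b (h b)"
          using eg_isom[OF h h, of p "invf h b"] 1 end_gromov_arg_diff[OF \<xi>, of p "invf h b" b] isom[OF h]
          by (simp add: dh abs_le_iff)
        have 3: "dist b (h p) = dist (invf h b) p"
          by (simp add: isom_dist_inv isom h)
        have "min (end_gromov \<xi> b p) (end_gromov \<xi> b (h p)) - \<delta> \<le> gromov b p (h p)"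
          by (rule end_gromov_hyp[OF \<xi>])
        moreover have "2 * gromov b p (h p) = dist b p + dist b (h p) - dist p (h p)"
          by (simp add: gromov_def field_simps)
        moreover have "\<bar>dist b p - dist b (h p)\<bar> \<le> dist b (h b)"
          using dist_triangle[of b p "invf h b"] dist_triangle[of "invf h b" p b] dh
          unfolding 3 by (simp add: dist_commute abs_le_iff)
        ultimately show ?thesis
          using 1 2 end_gromov_swap_base[of \<xi> b p] end_gromov_swap_base[of \<xi> b "h p"] delta_nonneg
            zero_le_dist[of b "h b"]
          unfolding 0 by linarith
      qed
      then have "range c \<subseteq> {g \<in> G. dist b (g b) \<le> 3 * dist b (h b) + 2 * Q + 6 * \<delta>}"
        using comp pow h by (auto simp: c_def)
      then have "finite (range c)"
        using discrete finite_subset by blast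
      then have "\<not> inj c"
        using finite_imageD by blast
      then obtain n m where nm: "n < m" "c n = c m"
        unfolding inj_def by (metis nat_neq_iff)
      define k where "k = m - n"
      have m: "m = n + k" using nm by (simp add: k_def)
      have gk: "(g ^^ k) (h y) = h ((g ^^ k) y)" for y
      proof -
        have "c n ((f ^^ n) y) = c m ((f ^^ n) y)" using nm by simp
        then have "(f ^^ n) (h y) = (f ^^ m) (h ((g ^^ k) y))"
          by (simp add: c_def gfn m funpow_add add.commute[of n k])
        then have "(g ^^ m) ((f ^^ n) (h y)) = (g ^^ m) ((f ^^ m) (h ((g ^^ k) y)))" by simp
        then show ?thesis
          by (simp add: gfn) (simp add: m add.commute[of n k] funpow_add gfn)
      qed
      have "(f ^^ k) (h x) = h ((f ^^ k) x)" for x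
        using gk[of "(f ^^ k) x"] by (metis gfn)
      then show ?thesis using nm by (intro exI[of _ k]) (auto simp: k_def)
    qed
    \<comment> \<open>From \<open>b\<close>, the point \<open>h b\<close> is seen in the direction
      of \<open>w n\<close> except for its product with \<xi>: since \<open>h\<close> commutes with
      the power, \<open>w n\<close> is the image under \<open>h\<close> of a point \<open>v\<close>
      near \<open>w n\<close>, so (\<xi>|w n) is bounded at \<open>h b\<close> as well.\<close>
    have near: "\<exists>k>0. \<forall>n. k dvd n \<and> real n > Q + \<delta> + dist b (h b) \<longrightarrow>
        gromov b (h b) (w n) \<ge> dist b (h b) - end_gromov \<xi> b (h b) - Q - 2 * \<delta>" if h: "h \<in> G" for h
    proof -
      obtain k where k: "k > 0" "\<And>x. (f ^^ k) (h x) = h ((f ^^ k) x)"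
        using commute[OF h] by blast
      have ki: "(f ^^ (k * i)) (h x) = h ((f ^^ (k * i)) x)" for i x
        by (induction i) (simp_all add: funpow_add k)
      have "gromov b (h b) (w n) \<ge> dist b (h b) - end_gromov \<xi> b (h b) - Q - 2 * \<delta>"
        if n: "k dvd n" "real n > Q + \<delta> + dist b (h b)" for n
      proof -
        have comm: "(f ^^ n) (invf h x) = invf h ((f ^^ n) x)" for x
        proof -
          obtain i where i: "n = k * i" using n by blast
          have "h ((f ^^ n) (invf h x)) = (f ^^ n) x"
            using ki[of i "invf h x"] isom[OF h] by (simp add: i)
          then show ?thesis using isom[OF h] by (metis isom_inv_left)
        qed
        define v where "v = (f ^^ n) (invf h b)"
        have "dist (w n) v = dist b (h b)"
          using isom_dist[OF isom[OF pow(2)], of n b "invf h b"] isom_dist_inv[OF isom[OF h], of b b]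
          by (simp add: v_def w_def dist_commute)
        then have "gromov b v (w n) \<ge> real n - dist b (h b)"
          using gromov_arg_diff[of b "w n" "w n" v] w_far[of n] by (simp add: abs_le_iff)
        then have v: "end_gromov \<xi> b v \<le> Q + \<delta>"
          using end_gromov_hyp'[OF \<xi>, of b v "w n"] w_bounded[of n] n(2) by (auto simp: min_def split: if_splits)
        have "h v = w n"
          using isom[OF h] by (simp add: v_def comm w_def)
        then have "end_gromov \<xi> (h b) (w n) \<le> Q + 2 * \<delta>"
          using eg_isom[OF h h, of b v] v by (simp add: abs_le_iff)
        then show ?thesis
          using end_gromov_change_base[of b "h b" "w n" \<xi>] end_gromov_nonneg[OF \<xi>, of b "w n"] by simp
      qed
      then show ?thesis using k(1) by blast
    qed
    have "\<eta>1 = \<eta>2" if \<eta>: "\<eta>1 \<in> limit_set b G" "\<eta>2 \<in> limit_set b G" "\<eta>1 \<noteq> \<xi>" "\<eta>2 \<noteq> \<xi>" for \<eta>1 \<eta>2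
    proof (rule ccontr)
      assume ne: "\<eta>1 \<noteq> \<eta>2"
      obtain g1 where g1: "\<And>n. g1 n \<in> G" "gsim b (\<lambda>n. g1 n b) (rseq \<eta>1)" "\<eta>1 \<in> hboundary"
        using limit_setE \<eta>(1) by metis
      obtain g2 where g2: "\<And>n. g2 n \<in> G" "gsim b (\<lambda>n. g2 n b) (rseq \<eta>2)" "\<eta>2 \<in> hboundary"
        using limit_setE \<eta>(2) by metis
      obtain K1 N1 where K1: "\<And>n. n \<ge> N1 \<Longrightarrow> end_gromov \<xi> b (g1 n b) \<le> K1"
        using limit_point_end_gromov_le[OF \<xi> g1(3) \<eta>(3) g1(2)] by blast
      obtain K2 N2 where K2: "\<And>n. n \<ge> N2 \<Longrightarrow> end_gromov \<xi> b (g2 n b) \<le> K2"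
        using limit_point_end_gromov_le[OF \<xi> g2(3) \<eta>(4) g2(2)] by blast
      obtain K3 N3 where K3: "\<And>n m. n \<ge> N3 \<Longrightarrow> m \<ge> N3 \<Longrightarrow> gromov b (g1 n b) (g2 m b) \<le> K3"
        using distinct_ends_gromov_bounded[OF g1(3) g2(3) ne g1(2) g2(2)] by blast
      \<comment> \<open>Large enough that both orbit points have product at least
        \<open>K3 + \<delta> + 1\<close> with \<open>w n\<close>; one more hyperbolic inequality
        then contradicts \<open>K3\<close>.\<close>
      define C where "C = \<bar>K1\<bar> + \<bar>K2\<bar> + Q + 3 * \<delta> + K3 + 1"
      have "\<forall>\<^sub>F j in sequentially. C \<le> dist b (g1 j b)" "\<forall>\<^sub>F j in sequentially. C \<le> dist b (g2 j b)"
        using gsim_dist_at_top[OF g1(2)] gsim_dist_at_top[OF g2(2)] unfolding filterlim_at_top by blast+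
      then have "\<forall>\<^sub>F j in sequentially. j \<ge> max N1 (max N2 N3) \<and> C \<le> dist b (g1 j b) \<and> C \<le> dist b (g2 j b)"
        by (intro eventually_conj eventually_ge_at_top)
      then obtain j where j: "j \<ge> max N1 (max N2 N3)" "C \<le> dist b (g1 j b)" "C \<le> dist b (g2 j b)"
        by (auto dest: eventually_happens)
      obtain k1 where k1: "k1 > 0" "\<And>n. k1 dvd n \<Longrightarrow> real n > Q + \<delta> + dist b (g1 j b) \<Longrightarrow>
          gromov b (g1 j b) (w n) \<ge> dist b (g1 j b) - end_gromov \<xi> b (g1 j b) - Q - 2 * \<delta>"
        using near[OF g1(1)[of j]] by blast
      obtain k2 where k2: "k2 > 0" "\<And>n. k2 dvd n \<Longrightarrow> real n > Q + \<delta> + dist b (g2 j b) \<Longrightarrow>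
          gromov b (g2 j b) (w n) \<ge> dist b (g2 j b) - end_gromov \<xi> b (g2 j b) - Q - 2 * \<delta>"
        using near[OF g2(1)[of j]] by blast
      obtain i :: nat where i: "real i > Q + \<delta> + dist b (g1 j b) + dist b (g2 j b)"
        using reals_Archimedean2 by blast
      \<comment> \<open>A common multiple, so that both orbit points are compared with the same
        \<open>w n\<close>.\<close>
      define n where "n = k1 * k2 * i"
      have "i \<le> n" using k1(1) k2(1) unfolding n_def by simp
      then have n3: "real n > Q + \<delta> + dist b (g1 j b) + dist b (g2 j b)"
        using i of_nat_mono[of i n, where 'a = real] by linarith
      have n: "k1 dvd n" "k2 dvd n" by (simp_all add: n_def)
      have "gromov b (g1 j b) (w n) \<ge> K3 + \<delta> + 1"
        using k1(2)[OF n(1)] n3 K1[of j] j zero_le_dist[of b "g2 j b"] by (simp add: C_def)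
      moreover have "gromov b (w n) (g2 j b) \<ge> K3 + \<delta> + 1"
        using k2(2)[OF n(2)] n3 K2[of j] j zero_le_dist[of b "g1 j b"] by (simp add: C_def gromov_commute[of b "w n"])
      ultimately have "K3 + 1 \<le> gromov b (g1 j b) (g2 j b)"
        using hyp_ge[of "K3 + \<delta> + 1" b "g1 j b" "w n" "g2 j b"] by simp
      with K3[of j j] j show False by simp
    qed
    then show ?thesis
      by (cases "\<exists>\<eta>\<in>limit_set b G. \<eta> \<noteq> \<xi>") blast+
  qed
qed

end

section \<open>Lower limits of bounded real sequences\<close>

text \<open>Meaningful for bounded sequences only. A lower limit is measurable in its parameters and
  superadditive, and no convergence has to be known in advance.\<close>

definition rliminf :: "(nat \<Rightarrow> real) \<Rightarrow> real" where
  "rliminf u = real_of_ereal (liminf (\<lambda>n. ereal (u n)))"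

lemma ereal_rliminf:
  assumes "\<And>n. \<bar>u n\<bar> \<le> K"
  shows "ereal (rliminf u) = liminf (\<lambda>n. ereal (u n))"
proof -
  have "ereal (- K) \<le> liminf (\<lambda>n. ereal (u n))"
    using assms by (intro Liminf_bounded always_eventually) (simp add: abs_le_iff minus_le_iff)
  moreover have "liminf (\<lambda>n. ereal (u n)) \<le> ereal K"
    using assms by (intro order_trans[OF Liminf_le_Limsup Limsup_bounded] always_eventually)
      (auto simp: abs_le_iff)
  ultimately show ?thesis
    unfolding rliminf_def by (cases "liminf (\<lambda>n. ereal (u n))") auto
qed

lemma rliminf_ge:
  assumes "\<And>n. \<bar>u n\<bar> \<le> K" "\<forall>\<^sub>F n in sequentially. y \<le> u n"
  shows "y \<le> rliminf u"
proof -
  have "ereal y \<le> liminf (\<lambda>n. ereal (u n))"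
    using assms(2) by (intro Liminf_bounded) simp
  then show ?thesis by (simp flip: ereal_rliminf[of u K, OF assms(1)])
qed

lemma eventually_gt_if_rliminf:
  assumes "\<And>n. \<bar>u n\<bar> \<le> K" "y < rliminf u"
  shows "\<forall>\<^sub>F n in sequentially. y < u n"
proof -
  have "ereal y < liminf (\<lambda>n. ereal (u n))"
    using assms(2) by (simp flip: ereal_rliminf[of u K, OF assms(1)])
  then show ?thesis by (auto dest: less_LiminfD)
qed

lemma rliminf_le:
  assumes "\<And>n. \<bar>u n\<bar> \<le> K" "\<forall>\<^sub>F n in sequentially. u n \<le> y"
  shows "rliminf u \<le> y"
proof (rule ccontr)
  assume "\<not> ?thesis"
  then have "\<forall>\<^sub>F n in sequentially. y < u n"
    by (intro eventually_gt_if_rliminf[OF assms(1)]) auto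
  then have "\<forall>\<^sub>F n in sequentially. False"
    using assms(2) by eventually_elim simp
  then show False by simp
qed

lemma rliminf_shift: "rliminf (\<lambda>n. u (n + k)) = rliminf u"
  unfolding rliminf_def using liminf_shift_k[of "\<lambda>n. ereal (u n)" k] by simp

lemma rliminf_add:
  assumes u: "\<And>n. \<bar>u n\<bar> \<le> K" and v: "\<And>n. \<bar>v n\<bar> \<le> K'"
  shows "rliminf u + rliminf v \<le> rliminf (\<lambda>n. u n + v n)"
proof (rule field_le_epsilon)
  fix e :: real assume "e > 0"
  have "\<forall>\<^sub>F n in sequentially. rliminf u - e / 2 < u n" "\<forall>\<^sub>F n in sequentially. rliminf v - e / 2 < v n"
    using \<open>e > 0\<close> by (auto intro!: eventually_gt_if_rliminf[OF u] eventually_gt_if_rliminf[OF v])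
  then have "\<forall>\<^sub>F n in sequentially. rliminf u + rliminf v - e \<le> u n + v n"
    by eventually_elim linarith
  then have "rliminf u + rliminf v - e \<le> rliminf (\<lambda>n. u n + v n)"
  proof (rule rliminf_ge[rotated])
    show "\<bar>u n + v n\<bar> \<le> K + K'" for n using u[of n] v[of n] by linarith
  qed
  then show "rliminf u + rliminf v \<le> rliminf (\<lambda>n. u n + v n) + e" by simp
qed

lemma rliminf_affine:
  assumes u: "\<And>n. \<bar>u n\<bar> \<le> K" and "a > 0"
  shows "rliminf (\<lambda>n. c + a * u n) = c + a * rliminf u"
proof -
  have "\<bar>c + a * u n\<bar> \<le> \<bar>c\<bar> + a * K" for n
    using u[of n] \<open>a > 0\<close> by (simp add: abs_mult order_trans[OF abs_triangle_ineq])
  note b = this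
  have eq: "liminf (\<lambda>n. ereal (c + a * u n)) = ereal c + ereal a * liminf (\<lambda>n. ereal (u n))"
  proof -
    have "liminf (\<lambda>n. ereal c + ereal a * ereal (u n)) = ereal c + liminf (\<lambda>n. ereal a * ereal (u n))"
      by (rule Liminf_add_ereal_left) auto
    also have "liminf (\<lambda>n. ereal a * ereal (u n)) = ereal a * liminf (\<lambda>n. ereal (u n))"
      using \<open>a > 0\<close> by (intro Liminf_ereal_mult_left) auto
    finally show ?thesis by simp
  qed
  have "ereal (rliminf (\<lambda>n. c + a * u n)) = ereal (c + a * rliminf u)"
    unfolding ereal_rliminf[of "\<lambda>n. c + a * u n", OF b] eq ereal_rliminf[of u, OF u, symmetric] by simp
  then show ?thesis by simp
qed

lemma measurable_rliminf:
  assumes "\<And>n. u n \<in> borel_measurable M"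
  shows "(\<lambda>\<omega>. rliminf (\<lambda>n. u n \<omega>)) \<in> borel_measurable M"
  unfolding rliminf_def using assms by measurable

section \<open>The random walk\<close>

locale group_walk =
  fixes b :: "'a::metric_space" and G :: "('a \<Rightarrow> 'a) set" and \<mu> :: "('a \<Rightarrow> 'a) pmf"
  assumes isomG: "\<And>g. g \<in> G \<Longrightarrow> isom g" and invG: "\<And>g. g \<in> G \<Longrightarrow> invf g \<in> G"
    and compG: "\<And>g h. g \<in> G \<Longrightarrow> h \<in> G \<Longrightarrow> g \<circ> h \<in> G" and idG: "id \<in> G"
    and discrete: "\<And>K. finite {g \<in> G. dist b (g b) \<le> K}"
    and supp: "set_pmf \<mu> \<subseteq> G"
begin

sublocale sequence_space "measure_pmf \<mu>" ..

lemma space_S [simp]: "space S = UNIV"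
  by (simp add: space_PiM)

lemma countable_G: "countable G"
proof -
  have "countable (\<Union>n. {g \<in> G. dist b (g b) \<le> real n})"
    by (rule countable_UN[OF countableI_type countable_finite[OF discrete]])
  also have "(\<Union>n. {g \<in> G. dist b (g b) \<le> real n}) = G"
    using real_arch_simple by auto
  finally show ?thesis .
qed

text \<open>Increments outside \<open>G\<close> have probability zero.  They are replaced by the identity because
  composition is not measurable on the product of the full \<open>\<sigma>\<close>-algebras of an arbitrary type.\<close>

definition clamp :: "('a \<Rightarrow> 'a) \<Rightarrow> 'a \<Rightarrow> 'a" where
  "clamp h = (if h \<in> G then h else id)"

primrec wk :: "(nat \<Rightarrow> 'a \<Rightarrow> 'a) \<Rightarrow> nat \<Rightarrow> 'a \<Rightarrow> 'a" where
  "wk \<omega> 0 = id"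
| "wk \<omega> (Suc n) = wk \<omega> n \<circ> clamp (\<omega> n)"

lemma clamp_in: "clamp h \<in> G"
  by (simp add: clamp_def idG)

lemma wk_in [simp]: "wk \<omega> n \<in> G"
  by (induction n) (simp_all only: wk.simps idG compG clamp_in)

lemma wk_isom [simp]: "isom (wk \<omega> n)"
  by (simp add: isomG)

lemma wk_add: "wk \<omega> (n + m) = wk \<omega> n \<circ> wk (shift n \<omega>) m"
  by (induction m) (simp_all add: shift_def o_assoc add.commute)

lemma measurable_increment: "(\<lambda>\<omega>. g \<circ> clamp (\<omega> n)) \<in> measurable S (count_space G)" if "g \<in> G"
proof -
  have "(\<lambda>h. g \<circ> clamp h) \<in> measurable (measure_pmf \<mu>) (count_space G)"
    using that by (auto simp: compG clamp_in)
  moreover have "(\<lambda>\<omega>. \<omega> n) \<in> measurable S (measure_pmf \<mu>)"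
    by (rule measurable_component_singleton) simp
  ultimately show ?thesis
    by (rule measurable_compose[rotated])
qed

lemma measurable_wk: "(\<lambda>\<omega>. wk \<omega> n) \<in> measurable S (count_space G)"
proof (induction n)
  case (Suc n)
  show ?case
    unfolding wk.simps
    by (rule measurable_compose_countable'[OF measurable_increment Suc countable_G])
qed (simp only: wk.simps measurable_const space_count_space idG)

text \<open>Splits over the countably many values of the walk, so measurability of each single
  \<open>F g\<close> suffices.\<close>

lemma measurable_wk_apply:
  assumes "\<And>g. g \<in> G \<Longrightarrow> F g \<in> measurable S N"
  shows "(\<lambda>\<omega>. F (wk \<omega> n) (shift n \<omega>)) \<in> measurable S N"
  using measurable_compose[OF measurable_shift assms]
  by (rule measurable_compose_countable'[OF _ measurable_wk countable_G])

lemma measurable_wk_UNIV [measurable]: "(\<lambda>\<omega>. wk \<omega> n) \<in> measurable S (count_space UNIV)"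
  using measurable_wk_apply[of "\<lambda>g _. g"] by simp

lemma measurable_wk_fun [measurable]: "(\<lambda>\<omega>. f (wk \<omega> n)) \<in> borel_measurable S"
  using measurable_wk_apply[of "\<lambda>g _. f g"] by simp

lemma set_conv_power: "set_pmf (conv_power \<mu> n) \<subseteq> G"
proof (induction n)
  case (Suc n)
  then show ?case using supp by (auto intro!: compG)
qed (simp add: idG)

lemma nn_integral_first_step:
  assumes "\<Phi> \<in> borel_measurable S"
  shows "(\<integral>\<^sup>+\<omega>. \<Phi> \<omega> \<partial>S) = (\<integral>\<^sup>+h. \<integral>\<^sup>+\<omega>. \<Phi> (case_nat h \<omega>) \<partial>S \<partial>\<mu>)"
proof -
  have [measurable]: "(\<lambda>(s, \<omega>). case_nat s \<omega>) \<in> measurable (measure_pmf \<mu> \<Otimes>\<^sub>M S) S"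
    by measurable
  note assms[measurable]
  have "(\<integral>\<^sup>+\<omega>. \<Phi> \<omega> \<partial>S) = (\<integral>\<^sup>+\<omega>. \<Phi> \<omega> \<partial>distr (measure_pmf \<mu> \<Otimes>\<^sub>M S) S (\<lambda>(s, \<omega>). case_nat s \<omega>))"
    by (simp only: PiM_iter)
  also have "\<dots> = (\<integral>\<^sup>+p. \<Phi> (case p of (s, \<omega>) \<Rightarrow> case_nat s \<omega>) \<partial>(measure_pmf \<mu> \<Otimes>\<^sub>M S))"
    by (rule nn_integral_distr) auto
  also have "\<dots> = (\<integral>\<^sup>+h. \<integral>\<^sup>+\<omega>. \<Phi> (case_nat h \<omega>) \<partial>S \<partial>\<mu>)"
    by (subst P.nn_integral_fst[symmetric]) auto
  finally show ?thesis .
qed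

text \<open>The Markov property: the position at time \<open>n\<close> uses the first
  \<open>n\<close> increments only and is independent of the shifted path, which has the law of a
  fresh walk.\<close>

lemma nn_integral_walk:
  assumes "\<And>g. g \<in> G \<Longrightarrow> F g \<in> borel_measurable S"
  shows "(\<integral>\<^sup>+\<omega>. F (wk \<omega> n) (shift n \<omega>) \<partial>S) = (\<integral>\<^sup>+g. \<integral>\<^sup>+\<omega>. F g \<omega> \<partial>S \<partial>conv_power \<mu> n)"
  using assms
proof (induction n arbitrary: F)
  case 0
  then show ?case by (simp only: wk.simps shift_0 conv_power.simps nn_integral_return_pmf zero_le)
next
  case (Suc n)
  \<comment> \<open>Absorbs the first increment of the future into the position, so that the
    induction hypothesis applies at time \<open>n\<close>.\<close>
  define F' where "F' g \<omega> = F (g \<circ> clamp (\<omega> 0)) (shift 1 \<omega>)" for g \<omega>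
  have meas: "F' g \<in> borel_measurable S" if "g \<in> G" for g
    unfolding F'_def using measurable_compose[OF measurable_shift Suc.prems]
    by (rule measurable_compose_countable'[OF _ measurable_increment[OF that] countable_G])
  have step: "(\<integral>\<^sup>+\<omega>. F' g \<omega> \<partial>S) = (\<integral>\<^sup>+h. \<integral>\<^sup>+\<omega>. F (g \<circ> h) \<omega> \<partial>S \<partial>\<mu>)" if "g \<in> G" for g
  proof -
    have "shift 1 (case_nat h \<omega>) = \<omega>" for h and \<omega> :: "nat \<Rightarrow> 'a \<Rightarrow> 'a"
      by (simp add: shift_def)
    then have "(\<integral>\<^sup>+\<omega>. F' g \<omega> \<partial>S) = (\<integral>\<^sup>+h. \<integral>\<^sup>+\<omega>. F (g \<circ> clamp h) \<omega> \<partial>S \<partial>\<mu>)"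
      using nn_integral_first_step[OF meas[OF that]] by (simp add: F'_def)
    also have "\<dots> = (\<integral>\<^sup>+h. \<integral>\<^sup>+\<omega>. F (g \<circ> h) \<omega> \<partial>S \<partial>\<mu>)"
      using supp by (intro nn_integral_cong_AE) (auto simp: AE_measure_pmf_iff clamp_def)
    finally show ?thesis .
  qed
  have "(\<integral>\<^sup>+\<omega>. F (wk \<omega> (Suc n)) (shift (Suc n) \<omega>) \<partial>S) = (\<integral>\<^sup>+\<omega>. F' (wk \<omega> n) (shift n \<omega>) \<partial>S)"
    by (simp add: F'_def) (simp add: shift_def)
  also have "\<dots> = (\<integral>\<^sup>+g. \<integral>\<^sup>+\<omega>. F' g \<omega> \<partial>S \<partial>conv_power \<mu> n)"
    by (rule Suc.IH[OF meas])
  also have "\<dots> = (\<integral>\<^sup>+g. \<integral>\<^sup>+h. \<integral>\<^sup>+\<omega>. F (g \<circ> h) \<omega> \<partial>S \<partial>\<mu> \<partial>conv_power \<mu> n)"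
    using set_conv_power step by (intro nn_integral_cong_AE) (auto simp: AE_measure_pmf_iff)
  also have "\<dots> = (\<integral>\<^sup>+g. \<integral>\<^sup>+\<omega>. F g \<omega> \<partial>S \<partial>conv_power \<mu> (Suc n))"
    by (simp add: nn_integral_pair_pmf' case_prod_unfold)
  finally show ?case .
qed

lemma distr_wk: "distr S (count_space UNIV) (\<lambda>\<omega>. wk \<omega> n) = measure_pmf (conv_power \<mu> n)"
proof (rule measure_eqI)
  have [measurable]: "(\<lambda>\<omega>. wk \<omega> n) \<in> measurable S (count_space UNIV)"
    using measurable_wk_apply[of "\<lambda>g _. g"] by simp
  fix A
  have "emeasure (distr S (count_space UNIV) (\<lambda>\<omega>. wk \<omega> n)) A = (\<integral>\<^sup>+\<omega>. indicator A (wk \<omega> n) \<partial>S)"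
    using nn_integral_distr[of "\<lambda>\<omega>. wk \<omega> n" S "count_space UNIV" "indicator A"] by simp
  also have "\<dots> = (\<integral>\<^sup>+g. indicator A g \<partial>conv_power \<mu> n)"
    by (subst nn_integral_walk[of "\<lambda>g _. indicator A g"]) (use P.emeasure_space_1 in auto)
  finally show "emeasure (distr S (count_space UNIV) (\<lambda>\<omega>. wk \<omega> n)) A = emeasure (measure_pmf (conv_power \<mu> n)) A"
    by simp
qed simp

lemma integral_wk: "integral\<^sup>L S (\<lambda>\<omega>. f (wk \<omega> n)) = measure_pmf.expectation (conv_power \<mu> n) (f :: _ \<Rightarrow> real)"
  using integral_distr[of "\<lambda>\<omega>. wk \<omega> n" S "count_space UNIV" f] by (simp add: distr_wk)

lemma integrable_wk: "integrable S (\<lambda>\<omega>. f (wk \<omega> n)) \<longleftrightarrow> integrable (conv_power \<mu> n) (f :: _ \<Rightarrow> real)"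
  using integrable_distr_eq[of "\<lambda>\<omega>. wk \<omega> n" S "count_space UNIV" f] by (simp add: distr_wk)

lemma AE_wk:
  assumes "\<And>g. g \<in> set_pmf (conv_power \<mu> n) \<Longrightarrow> P g"
  shows "AE \<omega> in S. P (wk \<omega> n)"
  by (rule AE_distrD[of "\<lambda>\<omega>. wk \<omega> n" S "count_space UNIV"])
    (use assms in \<open>simp_all only: distr_wk AE_measure_pmf_iff measurable_wk_UNIV\<close>, blast)

lemma emeasure_walk_future:
  assumes "\<And>g. g \<in> G \<Longrightarrow> A g \<in> sets S"
  shows "emeasure S {\<omega>. shift n \<omega> \<in> A (wk \<omega> n)} = (\<integral>\<^sup>+g. emeasure S (A g) \<partial>conv_power \<mu> n)"
proof -
  have meas: "{\<omega>. shift n \<omega> \<in> A (wk \<omega> n)} \<in> sets S"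
    using measurable_sets[OF measurable_wk_apply[of "\<lambda>g \<omega>. \<omega> \<in> A g" "count_space UNIV"], of "{True}" n] assms
    by (simp add: vimage_def)
  have "emeasure S {\<omega>. shift n \<omega> \<in> A (wk \<omega> n)} = (\<integral>\<^sup>+\<omega>. indicator (A (wk \<omega> n)) (shift n \<omega>) \<partial>S)"
    by (subst nn_integral_indicator[OF meas, symmetric]) (auto intro!: nn_integral_cong split: split_indicator)
  also have "\<dots> = (\<integral>\<^sup>+g. emeasure S (A g) \<partial>conv_power \<mu> n)"
    using assms set_conv_power[of n]
    by (subst nn_integral_walk[of "\<lambda>g. indicator (A g)"])
      (auto 0 3 intro!: nn_integral_cong_AE nn_integral_indicator simp: AE_measure_pmf_iff)
  finally show ?thesis .
qed

lemma emeasure_walk_eq_future: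
  assumes "A \<in> sets S"
  shows "emeasure S {\<omega>. wk \<omega> n = g \<and> shift n \<omega> \<in> A} = ennreal (pmf (conv_power \<mu> n) g) * emeasure S A"
proof -
  have "emeasure S {\<omega>. shift n \<omega> \<in> (if wk \<omega> n = g then A else {})} =
      (\<integral>\<^sup>+h. emeasure S (if h = g then A else {}) \<partial>conv_power \<mu> n)"
    using assms by (intro emeasure_walk_future) auto
  also have "\<dots> = (\<integral>\<^sup>+h. emeasure S A * indicator {g} h \<partial>conv_power \<mu> n)"
    by (intro nn_integral_cong) (auto split: split_indicator)
  also have "\<dots> = emeasure S A * ennreal (pmf (conv_power \<mu> n) g)"
    by (simp add: nn_integral_cmult emeasure_pmf_single)
  also have "{\<omega>. shift n \<omega> \<in> (if wk \<omega> n = g then A else {})} = {\<omega>. wk \<omega> n = g \<and> shift n \<omega> \<in> A}"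
    by auto
  finally show ?thesis by (simp add: mult.commute)
qed

lemma AE_walk_eq_wk: "AE \<omega> in S. \<forall>n. walk \<omega> n = wk \<omega> n"
proof -
  have "AE \<omega> in S. \<omega> n \<in> set_pmf \<mu>" for n
    by (rule AE_component) (simp_all add: AE_measure_pmf)
  then have "AE \<omega> in S. \<forall>n. \<omega> n \<in> set_pmf \<mu>"
    by (simp add: AE_all_countable)
  then show ?thesis
  proof eventually_elim
    case (elim \<omega>)
    have "walk \<omega> n = wk \<omega> n" for n
      by (induction n) (use elim supp in \<open>auto simp: clamp_def\<close>)
    then show ?case by blast
  qed
qed

end

section \<open>Entropy and rate of escape\<close>

text \<open>Fekete's lemma, the limit being the infimum: write n = q m + r for a nearly optimal m,
  and bound the contribution of every remainder by \<open>C\<close>.\<close>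

lemma subadditive_convergent:
  fixes a :: "nat \<Rightarrow> real"
  assumes sub: "\<And>n m. a (n + m) \<le> a n + a m" and nonneg: "\<And>n. 0 \<le> a n"
  shows "convergent (\<lambda>n. a n / real n)"
proof -
  define l where "l = Inf ((\<lambda>n. a n / real n) ` {1..})"
  have bdd: "bdd_below ((\<lambda>n. a n / real n) ` {1..})"
    using nonneg by (intro bdd_belowI[of _ 0]) auto
  have l_le: "l \<le> a n / real n" if "n \<ge> 1" for n
    unfolding l_def using bdd that by (intro cInf_lower) auto
  have "(\<lambda>n. a n / real n) \<longlonglongrightarrow> l"
  proof (rule LIMSEQ_I)
    fix e :: real assume "e > 0"
    have "\<exists>x\<in>(\<lambda>n. a n / real n) ` {1..}. x < l + e / 2"
      using cInf_lessD[of "(\<lambda>n. a n / real n) ` {1..}" "l + e / 2"] \<open>e > 0\<close> by (auto simp: l_def)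
    then obtain m where m: "m \<ge> 1" "a m / real m < l + e / 2" by auto
    define C where "C = (\<Sum>r<m. a r)"
    have mult: "a (q * m + r) \<le> real q * a m + a r" for q r
    proof (induction q)
      case (Suc q)
      show ?case using Suc sub[of m "q * m + r"] by (simp add: algebra_simps)
    qed simp
    obtain N :: nat where N: "real N > 2 * C / e" using reals_Archimedean2 by blast
    have "norm (a n / real n - l) < e" if n: "n \<ge> max N 1" for n
    proof -
      define q r where "q = n div m" and "r = n mod m"
      have n_eq: "n = q * m + r" and "r < m" using m by (auto simp: q_def r_def)
      have "a r \<le> C"
        unfolding C_def using \<open>r < m\<close> nonneg by (intro member_le_sum) auto
      then have "a n \<le> real q * a m + C" using mult[of q r] n_eq by simp
      also have "\<dots> \<le> real n * (a m / real m) + C"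
      proof -
        have "real q * real m \<le> real n" unfolding of_nat_mult[symmetric] of_nat_le_iff by (simp add: n_eq)
        then have "real q * real m * (a m / real m) \<le> real n * (a m / real m)"
          using nonneg by (intro mult_right_mono) auto
        then show ?thesis using m by simp
      qed
      finally have le: "a n / real n \<le> a m / real m + C / real n"
        using n by (simp add: field_simps)
      have "2 * C < real N * e" using N \<open>e > 0\<close> by (simp add: field_simps)
      also have "\<dots> \<le> real n * e" using n \<open>e > 0\<close> by (intro mult_right_mono) auto
      finally have "C / real n < e / 2" using n by (simp add: field_simps)
      then have "a n / real n < l + e" using le m(2) by linarith
      moreover have "l \<le> a n / real n" using n by (intro l_le) simp
      ultimately show ?thesis using \<open>e > 0\<close> by (simp add: abs_less_iff)
    qed
    then show "\<exists>N. \<forall>n\<ge>N. norm (a n / real n - l) < e" by blast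
  qed
  then show ?thesis by (rule convergentI)
qed

lemma entropy_eq: "entropy p = enn2ereal (\<integral>\<^sup>+ g. ennreal (- ln (pmf p g)) \<partial>p)"
proof -
  have "(\<integral>\<^sup>+ g. ennreal (- ln (pmf p g)) \<partial>p) =
      (\<integral>\<^sup>+ g. ennreal (pmf p g) * ennreal (- ln (pmf p g)) \<partial>count_space UNIV)"
    by (rule nn_integral_measure_pmf)
  also have "\<dots> = (\<integral>\<^sup>+ g. ennreal (- pmf p g * ln (pmf p g)) \<partial>count_space UNIV)"
    by (intro nn_integral_cong) (simp flip: ennreal_mult')
  finally show ?thesis by (simp add: entropy_def)
qed

text \<open>The difference is (s - t)(- ln s) - t (ln s - ln t). The first term is at least s - t
  because - ln s \<ge> 1, the second product at most s - t because ln x \<le> x - 1.\<close>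

lemma neg_t_ln_t_mono:
  fixes s t :: real
  assumes "0 \<le> t" "t \<le> s" "s \<le> exp (- 1)"
  shows "- t * ln t \<le> - s * ln s"
proof (cases "t = 0")
  case True
  have "s < 1" using assms(3) by (rule order_le_less_trans) simp
  then show ?thesis using True assms by (cases "s = 0") (auto intro!: mult_nonneg_nonpos simp: ln_le_zero_iff)
next
  case False
  then have pos: "t > 0" "s > 0" using assms by auto
  have "ln s \<le> ln (exp (- 1))" using assms pos by (subst ln_le_cancel_iff) auto
  then have "(s - t) * (- ln s) \<ge> (s - t) * 1"
    using assms by (intro mult_left_mono) auto
  moreover have "t * (ln s - ln t) \<le> t * (s / t - 1)"
    using pos ln_le_minus_one[of "s / t"] by (intro mult_left_mono) (auto simp: ln_div)
  moreover have "t * (s / t - 1) = s - t" using pos by (simp add: field_simps)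
  ultimately show ?thesis by (simp add: algebra_simps)
qed

text \<open>\<open>-t ln t\<close> is increasing only for \<open>t \<le> 1/e\<close>, but there are at most finitely many atoms
  of mass above \<open>1/e\<close>.\<close>

lemma entropy_infinite_transfer:
  fixes p :: "'b pmf" and q :: "'c pmf"
  assumes inf: "entropy p = \<infinity>" and "inj f" and c: "0 < c" "c \<le> 1"
    and le: "\<And>g. c * pmf p g \<le> pmf q (f g)"
  shows "entropy q = \<infinity>"
proof -
  define \<eta> where "\<eta> t = ennreal (- t * ln t)" for t :: real
  define F where "F = {g. pmf q (f g) > exp (- 1)}"
  have "finite {y. pmf q y > exp (- 1)}"
  proof (rule ccontr)
    assume "infinite {y. pmf q y > exp (- 1)}"
    \<comment> \<open>Three atoms above 1/e are already too many, since e < 3.\<close>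
    then obtain Y where Y: "Y \<subseteq> {y. pmf q y > exp (- 1)}" "finite Y" "card Y = 3"
      using infinite_arbitrarily_large by blast
    have "3 * exp (- 1) \<le> (\<Sum>y\<in>Y. pmf q y)"
      using sum_mono[of Y "\<lambda>_. exp (- 1)" "pmf q"] Y by force
    also have "\<dots> = measure q Y"
      using Y by (simp add: measure_measure_pmf_finite)
    also have "\<dots> \<le> 1" by simp
    finally have "3 \<le> exp (1::real)" by (simp add: exp_minus field_simps)
    then show False using e_less_272 by simp
  qed
  then have F: "finite F"
    using finite_vimageI[OF _ \<open>inj f\<close>, of "{y. pmf q y > exp (- 1)}"] by (simp add: F_def vimage_def)
  have tot: "(\<integral>\<^sup>+ g. \<eta> (pmf p g) \<partial>count_space UNIV) = \<infinity>"
    using inf unfolding entropy_def \<eta>_def by (metis enn2ereal_eq_top_iff infinity_ennreal_def top_ereal_def)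
  have "(\<integral>\<^sup>+ g. \<eta> (pmf p g) \<partial>count_space UNIV) \<le>
      (\<integral>\<^sup>+ g. \<eta> (pmf p g) * indicator F g + \<eta> (pmf p g) * indicator (- F) g \<partial>count_space UNIV)"
    by (intro nn_integral_mono) (auto split: split_indicator)
  also have "\<dots> = (\<integral>\<^sup>+ g. \<eta> (pmf p g) * indicator F g \<partial>count_space UNIV) +
      (\<integral>\<^sup>+ g. \<eta> (pmf p g) * indicator (- F) g \<partial>count_space UNIV)"
    by (rule nn_integral_add) auto
  also have "(\<integral>\<^sup>+ g. \<eta> (pmf p g) * indicator F g \<partial>count_space UNIV) = (\<Sum>g\<in>F. \<eta> (pmf p g))"
    using F by (simp add: nn_integral_count_space_indicator[symmetric] nn_integral_count_space_finite)
  finally have le_sum: "\<infinity> \<le> (\<Sum>g\<in>F. \<eta> (pmf p g)) +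
      (\<integral>\<^sup>+ g. \<eta> (pmf p g) * indicator (- F) g \<partial>count_space UNIV)"
    unfolding tot .
  have "(\<Sum>g\<in>F. \<eta> (pmf p g)) < \<infinity>"
    using F by (induction F rule: finite_induct) (auto simp: \<eta>_def ennreal_add_less_top)
  with le_sum have "(\<integral>\<^sup>+ g. \<eta> (pmf p g) * indicator (- F) g \<partial>count_space UNIV) = \<infinity>"
    by (auto simp: top_unique)
  then have "\<infinity> = ennreal c * (\<integral>\<^sup>+ g. \<eta> (pmf p g) * indicator (- F) g \<partial>count_space UNIV)"
    using c by (simp add: ennreal_mult_top)
  also have "\<dots> = (\<integral>\<^sup>+ g. ennreal c * (\<eta> (pmf p g) * indicator (- F) g) \<partial>count_space UNIV)"
    by (simp add: nn_integral_cmult)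
  also have "\<dots> \<le> (\<integral>\<^sup>+ g. \<eta> (pmf q (f g)) \<partial>count_space UNIV)"
  proof (rule nn_integral_mono)
    fix g
    show "ennreal c * (\<eta> (pmf p g) * indicator (- F) g) \<le> \<eta> (pmf q (f g))"
    proof (cases "g \<in> F \<or> pmf p g = 0")
      case False
      then have pos: "pmf p g > 0" and small: "pmf q (f g) \<le> exp (- 1)"
        by (auto simp: F_def pmf_pos)
      \<comment> \<open>The additional term \<open>- c * pmf p g * ln c\<close> is nonnegative
        because \<open>c\<close> is at most 1.\<close>
      have "c * (- pmf p g * ln (pmf p g)) \<le> - (c * pmf p g) * ln (c * pmf p g)"
        using c pos by (simp add: ln_mult algebra_simps mult_nonneg_nonpos ln_le_zero_iff mult_le_0_iff)
      also have "\<dots> \<le> - pmf q (f g) * ln (pmf q (f g))"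
        using c le[of g] small by (intro neg_t_ln_t_mono) auto
      finally have "ennreal (c * (- pmf p g * ln (pmf p g))) \<le> \<eta> (pmf q (f g))"
        unfolding \<eta>_def by (rule ennreal_leI)
      moreover have "ennreal (c * (- pmf p g * ln (pmf p g))) = ennreal c * \<eta> (pmf p g)"
        unfolding \<eta>_def using c by (intro ennreal_mult') simp
      ultimately show ?thesis using False by simp
    qed (auto simp: \<eta>_def)
  qed
  also have "\<dots> = (\<integral>\<^sup>+ y. \<eta> (pmf q y) \<partial>count_space (range f))"
    using \<open>inj f\<close> by (intro nn_integral_bij_count_space) (auto simp: bij_betw_def)
  also have "\<dots> \<le> (\<integral>\<^sup>+ y. \<eta> (pmf q y) \<partial>count_space UNIV)"
    by (subst nn_integral_count_space_indicator) (auto intro!: nn_integral_mono split: split_indicator)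
  finally show ?thesis
    by (simp add: entropy_def \<eta>_def top_unique)
qed

context group_walk
begin

lemma pmf_conv_power_eq: "ennreal (pmf (conv_power \<mu> n) g) = emeasure S {\<omega>. wk \<omega> n = g}"
  using emeasure_walk_eq_future[of UNIV n g] P.emeasure_space_1 sets.top[of S] by simp

lemma pmf_conv_power_add:
  "pmf (conv_power \<mu> n) g * pmf (conv_power \<mu> m) h \<le> pmf (conv_power \<mu> (n + m)) (g \<circ> h)"
proof -
  have meas: "{\<omega>. wk \<omega> n = g} \<in> sets S" for n g
    using measurable_sets[OF measurable_wk_UNIV, of "{g}" n] by (simp add: vimage_def)
  have "ennreal (pmf (conv_power \<mu> n) g * pmf (conv_power \<mu> m) h) =
      ennreal (pmf (conv_power \<mu> n) g) * emeasure S {\<omega>. wk \<omega> m = h}"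
    by (simp add: ennreal_mult pmf_conv_power_eq)
  also have "\<dots> = emeasure S {\<omega>. wk \<omega> n = g \<and> shift n \<omega> \<in> {\<omega>. wk \<omega> m = h}}"
    by (rule emeasure_walk_eq_future[OF meas, symmetric])
  also have "\<dots> \<le> emeasure S {\<omega>. wk \<omega> (n + m) = g \<circ> h}"
    by (intro emeasure_mono meas) (auto simp: wk_add)
  also have "\<dots> = ennreal (pmf (conv_power \<mu> (n + m)) (g \<circ> h))"
    by (simp add: pmf_conv_power_eq)
  finally show ?thesis by simp
qed

text \<open>The information content of the position, with mean H(\<mu>^n); along the walk it is a
  subadditive cocycle.\<close>

definition info :: "nat \<Rightarrow> (nat \<Rightarrow> 'a \<Rightarrow> 'a) \<Rightarrow> real" where
  "info n \<omega> = - ln (pmf (conv_power \<mu> n) (wk \<omega> n))"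

lemma measurable_info [measurable]: "info n \<in> borel_measurable S"
  unfolding info_def by (rule measurable_wk_fun)

lemma AE_pmf_wk_pos: "AE \<omega> in S. pmf (conv_power \<mu> n) (wk \<omega> n) > 0"
  by (rule AE_wk) (simp add: pmf_positive)

lemma info_nonneg: "AE \<omega> in S. info n \<omega> \<ge> 0"
  using AE_pmf_wk_pos[of n] by eventually_elim (simp add: info_def pmf_le_1)

lemma info_add: "AE \<omega> in S. info (n + m) \<omega> \<le> info n \<omega> + info m (shift n \<omega>)"
  using AE_pmf_wk_pos[of n] AE_shift[OF AE_pmf_wk_pos[of m], of n]
proof eventually_elim
  case (elim \<omega>)
  let ?x = "pmf (conv_power \<mu> n) (wk \<omega> n)" and ?y = "pmf (conv_power \<mu> m) (wk (shift n \<omega>) m)"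
  have pos: "0 < ?x * ?y" using elim by simp
  have le: "?x * ?y \<le> pmf (conv_power \<mu> (n + m)) (wk \<omega> (n + m))"
    unfolding wk_add by (rule pmf_conv_power_add)
  have "ln (?x * ?y) \<le> ln (pmf (conv_power \<mu> (n + m)) (wk \<omega> (n + m)))"
    using ln_le_cancel_iff[OF pos order_less_le_trans[OF pos le]] le by simp
  then show ?case using elim by (simp add: info_def ln_mult)
qed

lemma info_sum: "AE \<omega> in S. \<forall>k. info (k * m) \<omega> \<le> (\<Sum>i<k. info m (shift (i * m) \<omega>))"
proof -
  have "AE \<omega> in S. \<forall>k. info (k * m + m) \<omega> \<le> info (k * m) \<omega> + info m (shift (k * m) \<omega>)"
    unfolding AE_all_countable by (intro allI info_add)
  then show ?thesis
  proof eventually_elim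
    case (elim \<omega>)
    have "info (k * m) \<omega> \<le> (\<Sum>i<k. info m (shift (i * m) \<omega>))" for k
    proof (induction k)
      case (Suc k)
      then show ?case using elim[rule_format, of k] by (simp add: add.commute)
    qed (simp add: info_def)
    then show ?case by blast
  qed
qed

lemma entropy_conv_power: "Defs.entropy (conv_power \<mu> n) = enn2ereal (\<integral>\<^sup>+\<omega>. ennreal (info n \<omega>) \<partial>S)"
  unfolding entropy_eq info_def
  using nn_integral_distr[of "\<lambda>\<omega>. wk \<omega> n" S "count_space UNIV" "\<lambda>g. ennreal (- ln (pmf (conv_power \<mu> n) g))"]
  by (simp add: distr_wk)

lemma nn_integral_info_add:
  "(\<integral>\<^sup>+\<omega>. ennreal (info (n + m) \<omega>) \<partial>S) \<le>
    (\<integral>\<^sup>+\<omega>. ennreal (info n \<omega>) \<partial>S) + (\<integral>\<^sup>+\<omega>. ennreal (info m \<omega>) \<partial>S)"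
proof -
  have "(\<integral>\<^sup>+\<omega>. ennreal (info (n + m) \<omega>) \<partial>S) \<le>
      (\<integral>\<^sup>+\<omega>. ennreal (info n \<omega>) + ennreal (info m (shift n \<omega>)) \<partial>S)"
  proof (rule nn_integral_mono_AE)
    show "AE \<omega> in S. ennreal (info (n + m) \<omega>) \<le> ennreal (info n \<omega>) + ennreal (info m (shift n \<omega>))"
      using info_add[of n m] info_nonneg[of n] AE_shift[OF info_nonneg[of m], of n]
      by eventually_elim (simp add: ennreal_leI flip: ennreal_plus)
  qed
  also have "\<dots> = (\<integral>\<^sup>+\<omega>. ennreal (info n \<omega>) \<partial>S) + (\<integral>\<^sup>+\<omega>. ennreal (info m (shift n \<omega>)) \<partial>S)"
    by (rule nn_integral_add) auto
  also have "(\<integral>\<^sup>+\<omega>. ennreal (info m (shift n \<omega>)) \<partial>S) = (\<integral>\<^sup>+\<omega>. ennreal (info m \<omega>) \<partial>S)"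
    using nn_integral_distr[of "shift n" S S "\<lambda>\<omega>. ennreal (info m \<omega>)"] by (simp add: distr_shift)
  finally show ?thesis .
qed

text \<open>For a single atom \<open>h\<close> of \<mu>, the right translate by \<open>h\<close> of
  the previous power, weighted by the mass of \<open>h\<close>, is dominated by the next
  power.\<close>

lemma entropy_conv_power_infinite:
  assumes "Defs.entropy (conv_power \<mu> 1) = \<infinity>"
  shows "Defs.entropy (conv_power \<mu> (Suc n)) = \<infinity>"
proof (induction n)
  case (Suc n)
  obtain h where h: "h \<in> set_pmf (conv_power \<mu> 1)"
    by (meson ex_in_conv set_pmf_not_empty)
  have "isom h" using h set_conv_power isomG by blast
  show ?case
  proof (rule entropy_infinite_transfer[OF Suc, where f = "\<lambda>g. g \<circ> h" and c = "pmf (conv_power \<mu> 1) h"])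
    show "inj (\<lambda>g::'a \<Rightarrow> 'a. g \<circ> h)"
    proof (rule injI)
      fix g g' :: "'a \<Rightarrow> 'a" assume "g \<circ> h = g' \<circ> h"
      then have "g (h (invf h x)) = g' (h (invf h x))" for x by (metis comp_apply)
      then show "g = g'" using \<open>isom h\<close> by (simp add: fun_eq_iff)
    qed
    show "0 < pmf (conv_power \<mu> 1) h" using h by (rule pmf_positive)
    show "pmf (conv_power \<mu> 1) h * pmf (conv_power \<mu> (Suc n)) g \<le> pmf (conv_power \<mu> (Suc (Suc n))) (g \<circ> h)" for g
      using pmf_conv_power_add[of "Suc n" g 1 h] by (simp add: mult.commute)
  qed (simp add: pmf_le_1)
qed (use assms in simp)

lemma asymptotic_entropy_cases:
  obtains "asymptotic_entropy \<mu> = \<infinity>"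
  | h where "asymptotic_entropy \<mu> = ereal h" "\<And>n. integrable S (info n)"
      "(\<lambda>n. integral\<^sup>L S (info n) / real n) \<longlonglongrightarrow> h"
proof (cases "Defs.entropy (conv_power \<mu> 1) = \<infinity>")
  case True
  have "Defs.entropy (conv_power \<mu> n) / ereal (real n) = \<infinity>" if "n \<ge> 1" for n
    using entropy_conv_power_infinite[OF True, of "n - 1"] that by simp
  then have "(\<lambda>n. Defs.entropy (conv_power \<mu> n) / ereal (real n)) \<longlonglongrightarrow> \<infinity>"
    by (intro tendsto_eventually) (auto simp: eventually_sequentially)
  then show ?thesis using that(1) by (simp add: asymptotic_entropy_def limI)
next
  case False
  let ?H = "\<lambda>n. \<integral>\<^sup>+\<omega>. ennreal (info n \<omega>) \<partial>S"
  have fin1: "?H 1 < \<infinity>"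
    using False unfolding entropy_conv_power by (metis enn2ereal_eq_top_iff infinity_ennreal_def less_top top_ereal_def)
  have fin: "?H n < \<infinity>" for n
  proof (induction n)
    case 0
    have "info 0 \<omega> = 0" for \<omega> by (simp add: info_def)
    then show ?case by simp
  next
    case (Suc n)
    then show ?case using nn_integral_info_add[of n 1] fin1
      by (simp add: order_le_less_trans ennreal_add_less_top)
  qed
  have int: "integrable S (info n)" for n
    using fin[of n] info_nonneg[of n] by (intro integrableI_nonneg) auto
  have H_eq: "Defs.entropy (conv_power \<mu> n) = ereal (integral\<^sup>L S (info n))" for n
    unfolding entropy_conv_power
    using nn_integral_eq_integral[OF int info_nonneg] integral_nonneg_AE[OF info_nonneg[of n]] by simp
  have "integral\<^sup>L S (info (n + m)) \<le> integral\<^sup>L S (info n) + integral\<^sup>L S (info m)" for n m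
  proof -
    have "integral\<^sup>L S (info (n + m)) \<le> integral\<^sup>L S (\<lambda>\<omega>. info n \<omega> + info m (shift n \<omega>))"
      by (intro integral_mono_AE Bochner_Integration.integrable_add int integrable_shift info_add)
    also have "\<dots> = integral\<^sup>L S (info n) + integral\<^sup>L S (info m)"
      by (simp add: int integrable_shift integral_shift)
    finally show ?thesis .
  qed
  then have "convergent (\<lambda>n. integral\<^sup>L S (info n) / real n)"
    by (rule subadditive_convergent) (rule integral_nonneg_AE[OF info_nonneg])
  then obtain h where h: "(\<lambda>n. integral\<^sup>L S (info n) / real n) \<longlonglongrightarrow> h"
    by (auto simp: convergent_def)
  have "(\<lambda>n. ereal (integral\<^sup>L S (info n) / real n)) \<longlonglongrightarrow> ereal h"
    using h by simp
  moreover have "\<forall>\<^sub>F n in sequentially. ereal (integral\<^sup>L S (info n) / real n) = Defs.entropy (conv_power \<mu> n) / ereal (real n)"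
    using eventually_gt_at_top[of 0] by eventually_elim (simp add: H_eq)
  ultimately have "(\<lambda>n. Defs.entropy (conv_power \<mu> n) / ereal (real n)) \<longlonglongrightarrow> ereal h"
    by (rule Lim_transform_eventually)
  then have "asymptotic_entropy \<mu> = ereal h"
    by (simp add: asymptotic_entropy_def limI)
  then show ?thesis using that(2) int h by blast
qed

definition len :: "nat \<Rightarrow> (nat \<Rightarrow> 'a \<Rightarrow> 'a) \<Rightarrow> real" where
  "len n \<omega> = dist b (wk \<omega> n b)"

lemma measurable_len [measurable]: "len n \<in> borel_measurable S"
  unfolding len_def by (rule measurable_wk_fun)

lemma len_nonneg [simp]: "0 \<le> len n \<omega>"
  by (simp add: len_def)

lemma len_add: "len (n + m) \<omega> \<le> len n \<omega> + len m (shift n \<omega>)"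
  using dist_triangle[of b "wk \<omega> (n + m) b" "wk \<omega> n b"]
  by (simp add: len_def wk_add isom_dist[OF wk_isom])

lemma integrable_len:
  assumes "finite_first_moment b \<mu>"
  shows "integrable S (len n)"
proof (induction n)
  case (Suc n)
  have "conv_power \<mu> 1 = \<mu>"
    by (simp add: pair_return_pmf1 pmf.map_comp o_def)
  then have 1: "integrable S (len 1)"
    using assms integrable_wk[of "\<lambda>g. dist b (g b)" 1] by (simp add: len_def[abs_def] finite_first_moment_def)
  show ?case
  proof (rule Bochner_Integration.integrable_bound)
    show "integrable S (\<lambda>\<omega>. len n \<omega> + len 1 (shift n \<omega>))"
      by (intro Bochner_Integration.integrable_add Suc integrable_shift 1)
    show "AE \<omega> in S. norm (len (Suc n) \<omega>) \<le> norm (len n \<omega> + len 1 (shift n \<omega>))"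
      using len_add[of n 1] by simp
  qed measurable
qed (simp add: len_def)

lemma rate_of_escape_lim:
  assumes "finite_first_moment b \<mu>"
  shows "(\<lambda>n. integral\<^sup>L S (len n) / real n) \<longlonglongrightarrow> rate_of_escape b \<mu>"
proof -
  have "integral\<^sup>L S (len (n + m)) \<le> integral\<^sup>L S (len n) + integral\<^sup>L S (len m)" for n m
  proof -
    have "integral\<^sup>L S (len (n + m)) \<le> integral\<^sup>L S (\<lambda>\<omega>. len n \<omega> + len m (shift n \<omega>))"
      by (intro integral_mono Bochner_Integration.integrable_add integrable_len[OF assms] integrable_shift len_add)
    also have "\<dots> = integral\<^sup>L S (len n) + integral\<^sup>L S (len m)"
      by (simp add: integrable_len[OF assms] integrable_shift integral_shift)
    finally show ?thesis .
  qed
  then have "convergent (\<lambda>n. integral\<^sup>L S (len n) / real n)"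
    by (rule subadditive_convergent) simp
  then show ?thesis
    using integral_wk[of "\<lambda>g. dist b (g b)"]
    by (simp add: rate_of_escape_def convergent_LIMSEQ_iff len_def[abs_def])
qed

end

section \<open>Gromov products with the limit of the walk\<close>

context group_walk
begin

text \<open>An upper limit along the path, standing for the Gromov product of \<open>z\<close> with
  the limit of the walk. In this form it is a measurable function of the path.\<close>

definition limprod :: "'a \<Rightarrow> (nat \<Rightarrow> 'a \<Rightarrow> 'a) \<Rightarrow> real" where
  "limprod z \<omega> = - rliminf (\<lambda>k. - gromov b z (wk \<omega> k b))"

lemma abs_gromov_le: "\<bar>gromov b z y\<bar> \<le> dist b z"
  using gromov_nonneg[of b z y] gromov_le_dist[of b z y] by simp

lemma measurable_limprod [measurable]: "limprod z \<in> borel_measurable S"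
proof -
  have "(\<lambda>\<omega>. rliminf (\<lambda>k. - gromov b z (wk \<omega> k b))) \<in> borel_measurable S"
    by (intro measurable_rliminf measurable_wk_fun)
  then show ?thesis
    unfolding limprod_def by (rule borel_measurable_uminus)
qed

lemma limprod_le_dist: "limprod z \<omega> \<le> dist b z"
  unfolding limprod_def
  using rliminf_ge[of "\<lambda>k. - gromov b z (wk \<omega> k b)" "dist b z" "- dist b z"] abs_gromov_le[of z]
  by (simp add: gromov_le_dist)

lemma limprod_nonneg: "0 \<le> limprod z \<omega>"
  unfolding limprod_def
  using rliminf_le[of "\<lambda>k. - gromov b z (wk \<omega> k b)" "dist b z" 0] abs_gromov_le[of z]
  by (simp add: gromov_nonneg)

lemma eventually_gromov_less_if_limprod:
  assumes "limprod z \<omega> < y"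
  shows "\<forall>\<^sub>F k in sequentially. gromov b z (wk \<omega> k b) < y"
proof -
  have "\<forall>\<^sub>F k in sequentially. - y < - gromov b z (wk \<omega> k b)"
    using assms abs_gromov_le[of z] unfolding limprod_def
    by (intro eventually_gt_if_rliminf[where K = "dist b z"]) auto
  then show ?thesis by simp
qed

lemma frequently_gromov_gt_if_limprod:
  assumes "y < limprod z \<omega>"
  shows "\<exists>k\<ge>N. y < gromov b z (wk \<omega> k b)"
proof (rule ccontr)
  assume "\<not> ?thesis"
  then have "\<forall>\<^sub>F k in sequentially. - y \<le> - gromov b z (wk \<omega> k b)"
    by (auto simp: eventually_sequentially not_less)
  then have "- y \<le> rliminf (\<lambda>k. - gromov b z (wk \<omega> k b))"
    using abs_gromov_le[of z] by (intro rliminf_ge[where K = "dist b z"]) auto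
  with assms show False by (simp add: limprod_def)
qed

text \<open>The Busemann function of the limit of the walk, normalised at \<open>b\<close>; defined as a lower limit
  it is exactly superadditive along the walk.\<close>

definition horo :: "nat \<Rightarrow> (nat \<Rightarrow> 'a \<Rightarrow> 'a) \<Rightarrow> real" where
  "horo m \<omega> = rliminf (\<lambda>k. dist b (wk \<omega> k b) - dist (wk \<omega> m b) (wk \<omega> k b))"

lemma abs_dist_diff_le: "\<bar>dist b y - dist x y\<bar> \<le> dist b x"
  using dist_triangle[of b y x] dist_triangle[of x y b] by (simp add: dist_commute abs_le_iff)

text \<open>For any \<open>y\<close>, d(b,y) - d(x,y) = |x| - 2 (b|y)_x. Applying the inverse of the
  walk at time \<open>m\<close> moves the base point to \<open>b\<close> and leaves only the shifted
  path, which is independent of the position at time \<open>m\<close>.\<close>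

lemma horo_eq: "horo m \<omega> = len m \<omega> - 2 * limprod (invf (wk \<omega> m) b) (shift m \<omega>)"
proof -
  have "dist b (wk \<omega> (k + m) b) - dist (wk \<omega> m b) (wk \<omega> (k + m) b) =
      len m \<omega> + 2 * - gromov b (invf (wk \<omega> m) b) (wk (shift m \<omega>) k b)" for k
  proof -
    have "gromov b (invf (wk \<omega> m) b) (wk (shift m \<omega>) k b) = gromov (wk \<omega> m b) b (wk \<omega> (k + m) b)"
      using isom_gromov_inv[OF wk_isom, of \<omega> m b b "wk \<omega> (m + k) b"]
      by (simp add: wk_add[of \<omega> m k] add.commute[of k m])
    then show ?thesis
      by (simp add: gromov_def len_def dist_commute field_simps)
  qed
  then have "horo m \<omega> = rliminf (\<lambda>k. len m \<omega> + 2 * - gromov b (invf (wk \<omega> m) b) (wk (shift m \<omega>) k b))"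
    unfolding horo_def by (subst rliminf_shift[symmetric, of _ m]) simp
  also have "\<dots> = len m \<omega> + 2 * rliminf (\<lambda>k. - gromov b (invf (wk \<omega> m) b) (wk (shift m \<omega>) k b))"
    using abs_gromov_le[of "invf (wk \<omega> m) b"]
    by (intro rliminf_affine[where K = "dist b (invf (wk \<omega> m) b)"]) auto
  finally show ?thesis by (simp add: limprod_def)
qed

lemma dist_inv_wk: "dist b (invf (wk \<omega> m) b) = len m \<omega>"
  using isom_dist_inv[OF wk_isom, of \<omega> m b b] by (simp add: len_def dist_commute)

lemma horo_le_len: "horo m \<omega> \<le> len m \<omega>"
  using limprod_nonneg[of "invf (wk \<omega> m) b" "shift m \<omega>"] by (simp add: horo_eq)

lemma horo_ge_len: "- len m \<omega> \<le> horo m \<omega>"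
  using limprod_le_dist[of "invf (wk \<omega> m) b" "shift m \<omega>"] by (simp add: horo_eq dist_inv_wk)

lemma measurable_horo_term [measurable]:
  "(\<lambda>\<omega>. limprod (invf (wk \<omega> m) b) (shift m \<omega>)) \<in> borel_measurable S"
  by (rule measurable_wk_apply[of "\<lambda>g. limprod (invf g b)"]) simp

lemma measurable_horo [measurable]: "horo m \<in> borel_measurable S"
  unfolding horo_eq[abs_def] by measurable

text \<open>For each fixed \<open>k\<close> the difference of distances splits exactly at the
  position at time \<open>n\<close>; only the passage to lower limits loses equality, in the
  favourable direction.\<close>

lemma horo_add: "horo n \<omega> + horo m (shift n \<omega>) \<le> horo (n + m) \<omega>"
proof -
  let ?x = "\<lambda>k. wk \<omega> k b"
  have "dist (?x n) (?x (k + n)) - dist (?x (n + m)) (?x (k + n)) =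
      dist b (wk (shift n \<omega>) k b) - dist (wk (shift n \<omega>) m b) (wk (shift n \<omega>) k b)" for k
    by (simp add: wk_add[of \<omega> n] add.commute[of k n] isom_dist[OF wk_isom])
  then have "horo m (shift n \<omega>) = rliminf (\<lambda>k. dist (?x n) (?x (k + n)) - dist (?x (n + m)) (?x (k + n)))"
    by (simp add: horo_def)
  also have "\<dots> = rliminf (\<lambda>k. dist (?x n) (?x k) - dist (?x (n + m)) (?x k))"
    by (rule rliminf_shift)
  finally have "horo n \<omega> + horo m (shift n \<omega>) =
      rliminf (\<lambda>k. dist b (?x k) - dist (?x n) (?x k)) +
      rliminf (\<lambda>k. dist (?x n) (?x k) - dist (?x (n + m)) (?x k))"
    by (simp add: horo_def)
  also have "\<dots> \<le> rliminf (\<lambda>k. (dist b (?x k) - dist (?x n) (?x k)) + (dist (?x n) (?x k) - dist (?x (n + m)) (?x k)))"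
  proof (rule rliminf_add)
    show "\<bar>dist b (?x k) - dist (?x n) (?x k)\<bar> \<le> dist b (?x n)" for k
      by (rule abs_dist_diff_le)
    show "\<bar>dist (?x n) (?x k) - dist (?x (n + m)) (?x k)\<bar> \<le> dist (?x n) (?x (n + m))" for k
      using dist_triangle[of "?x n" "?x k" "?x (n + m)"] dist_triangle[of "?x (n + m)" "?x k" "?x n"]
      by (simp add: dist_commute abs_le_iff)
  qed
  finally show ?thesis by (simp add: horo_def)
qed

lemma horo_sum: "(\<Sum>i<k. horo m (shift (i * m) \<omega>)) \<le> horo (k * m) \<omega>"
proof (induction k)
  case 0
  have "horo 0 \<omega> = 0"
    using horo_le_len[of 0 \<omega>] horo_ge_len[of 0 \<omega>] by (simp add: len_def)
  then show ?case by simp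
next
  case (Suc k)
  then show ?case using horo_add[of "k * m" \<omega> m] by (simp add: add.commute)
qed

lemma eventually_gt_horo:
  assumes "y < horo m \<omega>"
  shows "\<forall>\<^sub>F k in sequentially. y < dist b (wk \<omega> k b) - dist (wk \<omega> m b) (wk \<omega> k b)"
  using assms abs_dist_diff_le unfolding horo_def
  by (intro eventually_gt_if_rliminf[where K = "dist b (wk \<omega> m b)"]) auto

end

section \<open>Convergence to the boundary and absence of atoms\<close>

locale harmonic_walk = visual_hyperbolic b \<delta> a D \<Lambda> + group_walk b G \<mu>
  for b :: "'a::metric_space" and \<delta> a :: real and D :: "'a hpoint \<Rightarrow> 'a hpoint \<Rightarrow> real" and \<Lambda> G \<mu> +
  fixes X :: "(nat \<Rightarrow> 'a \<Rightarrow> 'a) \<Rightarrow> 'a hpoint"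
  assumes gen: "generated_semigroup (set_pmf \<mu>) = G"
    and moment: "finite_first_moment b \<mu>"
    and nonelem: "non_elementary b G"
    and X_meas: "X \<in> measurable S (hboundary_borel b)"
    and X_lim: "AE \<omega> in S. limitin (htopology b) (\<lambda>n. Inner (walk \<omega> n b)) (X \<omega>) sequentially"
begin

lemma space_hboundary_borel [simp]: "space (hboundary_borel b) = hboundary"
  unfolding hboundary_borel_def by (rule space_measure_of) (force dest: openin_subset)

lemma X_in [simp]: "X \<omega> \<in> hboundary"
  using measurable_space[OF X_meas, of \<omega>] by simp

lemma sets_hboundary_borelI:
  assumes U: "U \<subseteq> hboundary"
    and ball: "\<And>\<eta>. \<eta> \<in> U \<Longrightarrow> \<exists>r>0. \<forall>\<zeta>\<in>hboundary. D \<eta> \<zeta> < r \<longrightarrow> \<zeta> \<in> U"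
  shows "U \<in> sets (hboundary_borel b)"
proof -
  interpret M: Metric_space hclosure D by (rule metric)
  obtain r where r: "\<And>\<eta>. \<eta> \<in> U \<Longrightarrow> r \<eta> > 0"
      "\<And>\<eta> \<zeta>. \<eta> \<in> U \<Longrightarrow> \<zeta> \<in> hboundary \<Longrightarrow> D \<eta> \<zeta> < r \<eta> \<Longrightarrow> \<zeta> \<in> U"
    using ball by metis
  define W where "W = (\<Union>\<eta>\<in>U. M.mball \<eta> (r \<eta>))"
  have "openin (htopology b) W"
    unfolding W_def topology[symmetric] by (intro openin_Union) auto
  moreover have "U = W \<inter> hboundary"
    using U r hboundary_subset by (fastforce simp: W_def M.in_mball)
  ultimately have "openin (subtopology (htopology b) hboundary) U"
    by (auto simp: openin_subtopology)
  then show ?thesis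
    unfolding hboundary_borel_def by (simp add: sets_measure_of_conv Pow_def openin_subset sigma_sets.Basic subset_eq)
      (use openin_subset in force)
qed

lemma D_facts:
  assumes "\<xi> \<in> hboundary" "\<eta> \<in> hboundary"
  shows "0 \<le> D \<xi> \<eta>" "D \<xi> \<eta> = D \<eta> \<xi>" "D \<xi> \<eta> = 0 \<longleftrightarrow> \<xi> = \<eta>"
    "\<zeta> \<in> hboundary \<Longrightarrow> D \<xi> \<zeta> \<le> D \<xi> \<eta> + D \<eta> \<zeta>"
proof -
  interpret M: Metric_space hclosure D by (rule metric)
  show "0 \<le> D \<xi> \<eta>" "D \<xi> \<eta> = D \<eta> \<xi>" by (auto simp: M.commute)
  show "D \<xi> \<eta> = 0 \<longleftrightarrow> \<xi> = \<eta>" using assms hboundary_subset by (intro M.zero) auto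
  show "\<zeta> \<in> hboundary \<Longrightarrow> D \<xi> \<zeta> \<le> D \<xi> \<eta> + D \<eta> \<zeta>"
    using assms hboundary_subset by (intro M.triangle) auto
qed

lemma measurable_D [measurable]:
  assumes "\<xi> \<in> hboundary"
  shows "D \<xi> \<in> borel_measurable (hboundary_borel b)"
  unfolding borel_measurable_iff_less
proof
  fix r
  show "{\<eta> \<in> space (hboundary_borel b). D \<xi> \<eta> < r} \<in> sets (hboundary_borel b)"
  proof (rule sets_hboundary_borelI)
    fix \<eta> assume \<eta>: "\<eta> \<in> {\<eta> \<in> space (hboundary_borel b). D \<xi> \<eta> < r}"
    then show "\<exists>s>0. \<forall>\<zeta>\<in>hboundary. D \<eta> \<zeta> < s \<longrightarrow> \<zeta> \<in> {\<eta> \<in> space (hboundary_borel b). D \<xi> \<eta> < r}"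
      using D_facts(4)[OF assms, of \<eta>] by (intro exI[of _ "r - D \<xi> \<eta>"]) fastforce
  qed simp
qed

lemma measurable_DX [measurable]: "\<xi> \<in> hboundary \<Longrightarrow> (\<lambda>\<omega>. D \<xi> (X \<omega>)) \<in> borel_measurable S"
  using measurable_compose[OF X_meas measurable_D] .

lemma sets_X_eq: "\<xi> \<in> hboundary \<Longrightarrow> {\<omega>. X \<omega> = \<xi>} \<in> sets S"
proof -
  assume \<xi>: "\<xi> \<in> hboundary"
  have "{\<omega> \<in> space S. D \<xi> (X \<omega>) = 0} \<in> sets S" using \<xi> by measurable
  also have "{\<omega> \<in> space S. D \<xi> (X \<omega>) = 0} = {\<omega>. X \<omega> = \<xi>}"
    using D_facts(3)[OF \<xi> X_in] by auto
  finally show ?thesis .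
qed

abbreviation orbit :: "(nat \<Rightarrow> 'a \<Rightarrow> 'a) \<Rightarrow> nat \<Rightarrow> 'a" where
  "orbit \<omega> n \<equiv> wk \<omega> n b"

lemma AE_orbit_converges: "AE \<omega> in S. gsim b (orbit \<omega>) (rseq (X \<omega>))"
  using X_lim AE_walk_eq_wk
proof eventually_elim
  case (elim \<omega>)
  then show ?case by (intro gsim_if_limitin) auto
qed

lemma D_X_le:
  assumes "gsim b (orbit \<omega>) (rseq (X \<omega>))" "gsim b (orbit \<omega>') (rseq (X \<omega>'))"
    and "\<forall>\<^sub>F k in sequentially. R \<le> gromov b y (orbit \<omega> k)"
    and "\<forall>\<^sub>F k in sequentially. R \<le> gromov b y (orbit \<omega>' k)"
  shows "D (X \<omega>) (X \<omega>') \<le> \<Lambda> * a powr (3 * \<delta> - R)"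
proof -
  have ev: "\<forall>\<^sub>F k in sequentially. R - \<delta> \<le> gromov b (orbit \<omega> k) (orbit \<omega>' k)"
    using assms(3,4) by eventually_elim (rule hyp_ge, simp_all add: gromov_commute)
  have "\<exists>n\<ge>N. \<exists>m\<ge>N. R - \<delta> \<le> gromov b (orbit \<omega> n) (orbit \<omega>' m)" for N
    using eventually_happens[OF eventually_conj[OF ev eventually_ge_at_top[of N]]] by auto
  from D_le_powr[OF X_in X_in assms(1,2) this] show ?thesis
    by (simp add: algebra_simps)
qed

text \<open>An upper limit provides a single late index; convergence of the orbit spreads the bound
  to all late indices at the cost of \<delta>.\<close>

lemma eventually_gromov_ge_if_limprod:
  assumes "gsim b (orbit \<omega>) (rseq (X \<omega>))" "R < limprod z \<omega>"
  shows "\<forall>\<^sub>F k in sequentially. R - \<delta> \<le> gromov b z (orbit \<omega> k)"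
proof -
  have "gsim b (orbit \<omega>) (orbit \<omega>)"
    using assms(1) gsim_trans gsim_sym by blast
  then obtain N where N: "\<And>n m. n \<ge> N \<Longrightarrow> m \<ge> N \<Longrightarrow> R \<le> gromov b (orbit \<omega> n) (orbit \<omega> m)"
    using gsimD by blast
  obtain n where n: "n \<ge> N" "R < gromov b z (orbit \<omega> n)"
    using frequently_gromov_gt_if_limprod[OF assms(2)] by blast
  have "R - \<delta> \<le> gromov b z (orbit \<omega> k)" if "k \<ge> N" for k
    using hyp_ge[OF _ N[OF n(1) that]] n(2) by fastforce
  then show ?thesis by (auto simp: eventually_sequentially)
qed

text \<open>The event of lying in infinitely many \<open>A j\<close> has probability at least
  \<open>e\<close>, so it contains a convergent path. The limits of paths in a common
  \<open>A j\<close> are exponentially close in \<open>j\<close>, so every ball around the limit of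
  that path has mass at least \<open>e\<close>.\<close>

lemma atom_if_concentrated:
  assumes "e > 0" and conc: "\<And>R. \<exists>z. e \<le> P.prob {\<omega>. R < limprod z \<omega>}"
  shows "\<exists>\<xi>\<in>hboundary. e \<le> P.prob {\<omega>. X \<omega> = \<xi>}"
proof -
  have "\<forall>j::nat. \<exists>z. e \<le> P.prob {\<omega>. real j < limprod z \<omega>}"
    using conc by blast
  from choice[OF this] obtain z where z: "\<And>j::nat. e \<le> P.prob {\<omega>. real j < limprod (z j) \<omega>}"
    by blast
  define A where "A j = {\<omega>. real j < limprod (z j) \<omega>}" for j
  have meas: "A j \<in> sets S" for j
  proof -
    have "{\<omega> \<in> space S. real j < limprod (z j) \<omega>} \<in> sets S" by measurable
    then show ?thesis by (simp add: A_def)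
  qed
  define C where "C n = (\<Union>j\<in>{n..}. A j)" for n
  have C_meas: "C n \<in> sets S" for n
    unfolding C_def using meas by blast
  have "decseq C"
    unfolding C_def decseq_def by fastforce
  then have "(\<lambda>n. P.prob (C n)) \<longlonglongrightarrow> P.prob (\<Inter>n. C n)"
    using C_meas by (intro P.finite_Lim_measure_decseq) auto
  moreover have "e \<le> P.prob (C n)" for n
  proof -
    have "A n \<subseteq> C n" by (auto simp: C_def)
    then show ?thesis
      using z[of n] P.finite_measure_mono[OF _ C_meas, of "A n" n] by (simp add: A_def)
  qed
  ultimately have "e \<le> P.prob (\<Inter>n. C n)"
    by (intro LIMSEQ_le_const) auto
  then have pos: "P.prob (\<Inter>n. C n) > 0" using \<open>e > 0\<close> by simp
  have "\<exists>\<omega>. \<omega> \<in> (\<Inter>n. C n) \<and> gsim b (orbit \<omega>) (rseq (X \<omega>))"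
  proof (rule ccontr)
    assume neg: "\<not> ?thesis"
    have "AE \<omega> in S. \<omega> \<notin> (\<Inter>n. C n)"
      using AE_orbit_converges by eventually_elim (use neg in blast)
    then have "P.prob (\<Inter>n. C n) = 0"
      using C_meas by (intro P.prob_eq_0[THEN iffD2]) auto
    with pos show False by simp
  qed
  then obtain \<omega>0 where \<omega>0: "\<And>n. \<omega>0 \<in> C n" "gsim b (orbit \<omega>0) (rseq (X \<omega>0))" by blast
  define \<xi> where "\<xi> = X \<omega>0"
  have \<xi>: "\<xi> \<in> hboundary" by (simp add: \<xi>_def)
  have ball: "e \<le> P.prob {\<omega>. D \<xi> (X \<omega>) < r}" if "r > 0" for r
  proof -
    \<comment> \<open>Makes \<Lambda> a^(4 \<delta> - n) smaller than \<open>r\<close>: three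
      \<delta> come from \<open>D_X_le\<close>, the fourth from
      \<open>eventually_gromov_ge_if_limprod\<close>.\<close>
    obtain n :: nat where n: "real n > 4 * \<delta> - log a (r / \<Lambda>)" using reals_Archimedean2 by blast
    obtain j where j: "j \<ge> n" "\<omega>0 \<in> A j" using \<omega>0(1)[of n] by (auto simp: C_def)
    have "\<Lambda> * a powr (3 * \<delta> - (real j - \<delta>)) < \<Lambda> * a powr (log a (r / \<Lambda>))"
      using n j a \<Lambda> by (intro mult_strict_left_mono powr_less_mono) auto
    also have "\<dots> = r" using a \<Lambda> that by simp
    finally have small: "\<Lambda> * a powr (3 * \<delta> - (real j - \<delta>)) < r" .
    have "{\<omega> \<in> space S. D \<xi> (X \<omega>) < r} \<in> sets S" using \<xi> by measurable
    then have "P.prob (A j) \<le> P.prob {\<omega>. D \<xi> (X \<omega>) < r}"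
    proof (intro P.finite_measure_mono_AE)
      show "AE \<omega> in S. \<omega> \<in> A j \<longrightarrow> \<omega> \<in> {\<omega>. D \<xi> (X \<omega>) < r}"
        using AE_orbit_converges
      proof eventually_elim
        case (elim \<omega>)
        show ?case
        proof
          assume "\<omega> \<in> A j"
          then have "D (X \<omega>0) (X \<omega>) \<le> \<Lambda> * a powr (3 * \<delta> - (real j - \<delta>))"
            using j(2) elim \<omega>0(2) by (intro D_X_le[where y = "z j"] eventually_gromov_ge_if_limprod) (auto simp: A_def)
          then show "\<omega> \<in> {\<omega>. D \<xi> (X \<omega>) < r}" using small by (simp add: \<xi>_def)
        qed
      qed
    qed simp
    then show ?thesis using z[of j] by (simp add: A_def)
  qed
  have "(\<lambda>n. P.prob {\<omega>. D \<xi> (X \<omega>) < 1 / real (Suc n)}) \<longlonglongrightarrow> P.prob (\<Inter>n. {\<omega>. D \<xi> (X \<omega>) < 1 / real (Suc n)})"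
  proof (rule P.finite_Lim_measure_decseq)
    have "{\<omega> \<in> space S. D \<xi> (X \<omega>) < 1 / real (Suc n)} \<in> sets S" for n using \<xi> by measurable
    then show "range (\<lambda>n. {\<omega>. D \<xi> (X \<omega>) < 1 / real (Suc n)}) \<subseteq> sets S" by auto
    show "decseq (\<lambda>n. {\<omega>. D \<xi> (X \<omega>) < 1 / real (Suc n)})"
      unfolding decseq_def by (auto elim!: less_le_trans intro!: divide_left_mono)
  qed
  moreover have "(\<Inter>n. {\<omega>. D \<xi> (X \<omega>) < 1 / real (Suc n)}) = {\<omega>. X \<omega> = \<xi>}"
  proof (intro equalityI subsetI)
    fix \<omega> assume *: "\<omega> \<in> (\<Inter>n. {\<omega>. D \<xi> (X \<omega>) < 1 / real (Suc n)})"
    have "D \<xi> (X \<omega>) = 0"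
    proof (rule ccontr)
      assume "D \<xi> (X \<omega>) \<noteq> 0"
      then have "D \<xi> (X \<omega>) > 0" using D_facts(1)[OF \<xi> X_in[of \<omega>]] by simp
      then obtain n where "1 / real (Suc n) < D \<xi> (X \<omega>)" using nat_approx_posE by metis
      with * show False by (auto dest: spec[of _ n])
    qed
    then show "\<omega> \<in> {\<omega>. X \<omega> = \<xi>}" using D_facts(3)[OF \<xi> X_in[of \<omega>]] by auto
  qed (use D_facts(3)[OF \<xi> \<xi>] in auto)
  ultimately have "e \<le> P.prob {\<omega>. X \<omega> = \<xi>}"
    using ball by (intro LIMSEQ_le_const) auto
  with \<xi> show ?thesis by blast
qed

lemma X_shift: "AE \<omega> in S. X \<omega> = bact (wk \<omega> 1) (X (shift 1 \<omega>))"
  using AE_orbit_converges AE_shift[OF AE_orbit_converges, of 1]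
proof eventually_elim
  case (elim \<omega>)
  have "(\<lambda>n. wk \<omega> 1 (orbit (shift 1 \<omega>) n)) = (\<lambda>n. orbit \<omega> (n + 1))"
    using wk_add[of \<omega> 1] by (simp add: fun_eq_iff)
  then have "gsim b (\<lambda>n. wk \<omega> 1 (orbit (shift 1 \<omega>) n)) (rseq (X \<omega>))"
    using gsim_shift[OF elim(1), of 1] by simp
  then show ?case
    using bact_eqI[OF wk_isom X_in X_in elim(2)] by metis
qed

definition mass :: "'a hpoint \<Rightarrow> real" where
  "mass \<xi> = P.prob {\<omega>. X \<omega> = \<xi>}"

lemma conv_power_1: "conv_power \<mu> 1 = \<mu>"
  by (simp add: pair_return_pmf1 pmf.map_comp o_def)

text \<open>Stationarity of the harmonic measure at a point: by \<open>X_shift\<close> the limit is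
  the first step applied to the limit of the shifted path, which is independent of that step and has
  the same law.\<close>

lemma mass_stationary:
  assumes \<xi>: "\<xi> \<in> hboundary"
  shows "mass \<xi> = measure_pmf.expectation \<mu> (\<lambda>h. mass (bact (invf h) \<xi>))"
proof -
  define A where "A g = {\<omega>. X \<omega> = bact (invf g) \<xi>}" for g
  have A: "A g \<in> sets S" if "g \<in> G" for g
    unfolding A_def using that \<xi> by (intro sets_X_eq bact_in) (auto simp: isomG invG)
  have "emeasure S {\<omega>. X \<omega> = \<xi>} = emeasure S {\<omega>. shift 1 \<omega> \<in> A (wk \<omega> 1)}"
  proof (rule emeasure_eq_AE)
    show "AE \<omega> in S. (\<omega> \<in> {\<omega>. X \<omega> = \<xi>}) = (\<omega> \<in> {\<omega>. shift 1 \<omega> \<in> A (wk \<omega> 1)})"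
      using X_shift
    proof eventually_elim
      case (elim \<omega>)
      have "bact (wk \<omega> 1) (X (shift 1 \<omega>)) = \<xi> \<longleftrightarrow> X (shift 1 \<omega>) = bact (invf (wk \<omega> 1)) \<xi>"
        using bact_inv[OF wk_isom \<xi>, of \<omega> 1] bact_inv[OF wk_isom X_in, of \<omega> 1 "shift 1 \<omega>"] by metis
      then show ?case using elim by (simp add: A_def)
    qed
    have "(\<lambda>\<omega>. shift 1 \<omega> \<in> A (wk \<omega> 1)) \<in> measurable S (count_space UNIV)"
      by (rule measurable_wk_apply[of "\<lambda>g \<omega>. \<omega> \<in> A g"]) (use A in measurable)
    then show "{\<omega>. shift 1 \<omega> \<in> A (wk \<omega> 1)} \<in> sets S"
      by (simp add: pred_def)
  qed (rule sets_X_eq[OF \<xi>])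
  also have "\<dots> = (\<integral>\<^sup>+g. emeasure S (A g) \<partial>\<mu>)"
    using emeasure_walk_future[of A 1, OF A] by (simp only: conv_power_1)
  also have "\<dots> = (\<integral>\<^sup>+g. ennreal (mass (bact (invf g) \<xi>)) \<partial>\<mu>)"
    by (simp add: mass_def A_def P.emeasure_eq_measure)
  finally have "ennreal (mass \<xi>) = (\<integral>\<^sup>+g. ennreal (mass (bact (invf g) \<xi>)) \<partial>\<mu>)"
    by (simp add: mass_def P.emeasure_eq_measure)
  then have "mass \<xi> = enn2real (\<integral>\<^sup>+g. ennreal (mass (bact (invf g) \<xi>)) \<partial>\<mu>)"
    by (metis enn2real_ennreal mass_def measure_nonneg)
  also have "\<dots> = measure_pmf.expectation \<mu> (\<lambda>h. mass (bact (invf h) \<xi>))"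
    by (rule integral_eq_nn_integral[symmetric]) (auto simp: mass_def)
  finally show ?thesis .
qed

lemma finite_atoms:
  assumes "e > 0"
  shows "finite {\<xi> \<in> hboundary. e \<le> mass \<xi>}"
proof (rule ccontr)
  assume "infinite {\<xi> \<in> hboundary. e \<le> mass \<xi>}"
  obtain N :: nat where N: "1 / e < real N" using reals_Archimedean2 by blast
  obtain Y where Y: "Y \<subseteq> {\<xi> \<in> hboundary. e \<le> mass \<xi>}" "finite Y" "card Y = N"
    using infinite_arbitrarily_large[OF \<open>infinite _\<close>] by blast
  have "real N * e \<le> (\<Sum>\<xi>\<in>Y. mass \<xi>)"
    using sum_mono[of Y "\<lambda>_. e" mass] Y by force
  also have "\<dots> = P.prob (\<Union>\<xi>\<in>Y. {\<omega>. X \<omega> = \<xi>})"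
    unfolding mass_def using Y sets_X_eq
    by (intro P.finite_measure_finite_Union[symmetric]) (auto simp: disjoint_family_on_def)
  also have "\<dots> \<le> 1" by simp
  finally show False using N \<open>e > 0\<close> by (simp add: field_simps)
qed

lemma no_atoms:
  assumes "\<xi>0 \<in> hboundary"
  shows "mass \<xi>0 = 0"
proof (rule ccontr)
  assume "mass \<xi>0 \<noteq> 0"
  then have pos: "mass \<xi>0 > 0" by (simp add: mass_def zero_less_measure_iff)
  define H where "H = {\<xi> \<in> hboundary. mass \<xi>0 \<le> mass \<xi>}"
  have H: "finite H" "\<xi>0 \<in> H"
    using finite_atoms[OF pos] assms by (auto simp: H_def)
  define m where "m = Max (mass ` H)"
  have m_max: "mass \<xi> \<le> m" if "\<xi> \<in> hboundary" for \<xi>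
  proof (cases "\<xi> \<in> H")
    case False
    then have "mass \<xi> \<le> mass \<xi>0" using that by (simp add: H_def)
    also have "\<dots> \<le> m" using H by (simp add: m_def)
    finally show ?thesis .
  qed (use H in \<open>simp add: m_def\<close>)
  have "m > 0" using m_max[OF assms] pos by simp
  define F where "F = {\<xi> \<in> hboundary. mass \<xi> = m}"
  have "finite F"
    using finite_atoms[OF \<open>m > 0\<close>] by (rule rev_finite_subset) (auto simp: F_def)
  have "m \<in> mass ` H" unfolding m_def using H by (intro Max_in) auto
  then obtain \<xi> where \<xi>: "\<xi> \<in> F" by (auto simp: F_def H_def)
  \<comment> \<open>The maximal mass \<open>m\<close> is an average of masses that are at most
    \<open>m\<close>, so every point with positive weight attains it.\<close>
  have supp_inv: "bact (invf h) \<eta> \<in> F" if "h \<in> set_pmf \<mu>" "\<eta> \<in> F" for h \<eta>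
  proof -
    have \<eta>: "\<eta> \<in> hboundary" "mass \<eta> = m" using that by (auto simp: F_def)
    have inb: "bact (invf g) \<eta> \<in> hboundary" if "g \<in> set_pmf \<mu>" for g
      using that supp \<eta> by (intro bact_in) (auto simp: isomG invG)
    have int: "integrable \<mu> (\<lambda>h. mass (bact (invf h) \<eta>))"
      by (rule measure_pmf.integrable_const_bound[where B = 1]) (auto simp: mass_def)
    have "measure_pmf.expectation \<mu> (\<lambda>h. m - mass (bact (invf h) \<eta>)) = 0"
      using mass_stationary[OF \<eta>(1)] \<eta>(2) int by simp
    moreover have "AE h in \<mu>. 0 \<le> m - mass (bact (invf h) \<eta>)"
      using m_max inb by (auto simp: AE_measure_pmf_iff)
    ultimately have "AE h in \<mu>. m - mass (bact (invf h) \<eta>) = 0"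
      using int by (subst (asm) integral_nonneg_eq_0_iff_AE) auto
    then show ?thesis using that(1) inb by (auto simp: AE_measure_pmf_iff F_def)
  qed
  have act: "bact g \<eta> \<in> F" if "g \<in> generated_semigroup (set_pmf \<mu>)" "\<eta> \<in> F" for g \<eta>
    using that
  proof (induction arbitrary: \<eta> rule: generated_semigroup.induct)
    case (incl h)
    then have iso: "isom h" using supp isomG by blast
    have "inj_on (bact (invf h)) F"
      using bact_inv(1)[OF iso] by (intro inj_onI) (metis (no_types, lifting) F_def mem_Collect_eq)
    \<comment> \<open>An injection of a finite set into itself is onto, which turns invariance under
      inverses of steps into invariance under steps, and these generate \<open>G\<close> as a
      semigroup.\<close>
    then have "bact (invf h) ` F = F"
      using \<open>finite F\<close> supp_inv incl by (intro endo_inj_surj) auto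
    then obtain \<zeta> where "\<zeta> \<in> F" "\<eta> = bact (invf h) \<zeta>" using incl by blast
    then show ?case using bact_inv(1)[OF iso, of \<zeta>] by (simp add: F_def)
  next
    case (mult s t)
    have "isom s" "isom t" using mult.hyps gen isomG by auto
    moreover have "\<eta> \<in> hboundary" using mult.prems by (simp add: F_def)
    ultimately show ?case unfolding bact_comp[OF \<open>isom s\<close> \<open>isom t\<close> \<open>\<eta> \<in> hboundary\<close>]
      using mult by blast
  qed
  have "\<exists>\<eta>1 \<eta>2. limit_set b G \<subseteq> {\<eta>1, \<eta>2}"
  proof (cases "F = {\<xi>}")
    case False
    then obtain \<eta> where \<eta>: "\<eta> \<in> F" "\<xi> \<noteq> \<eta>" using \<xi> by blast
    have "F \<subseteq> hboundary" by (auto simp: F_def)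
    from finite_invariant_ends[OF \<open>finite F\<close> this isomG invG act[unfolded gen] \<xi> \<eta>]
    show ?thesis by blast
  next
    case True
    have "bact g \<xi> = \<xi>" if "g \<in> G" for g
      using act[of g \<xi>] that gen \<xi> True by auto
    then show ?thesis
      using limit_set_fixed_end[OF isomG invG compG idG discrete, where \<xi> = \<xi>] \<xi> by (auto simp: F_def)
  qed
  then obtain \<eta>1 \<eta>2 where sub: "limit_set b G \<subseteq> {\<eta>1, \<eta>2}" by blast
  have "card (limit_set b G) \<le> card {\<eta>1, \<eta>2}" using sub by (intro card_mono) auto
  also have "\<dots> \<le> 2" by (simp add: card_insert_if)
  finally show False
    using nonelem finite_subset[OF sub] by (auto simp: non_elementary_def)
qed

lemma limprod_uniformly_tight:
  assumes "e > 0"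
  obtains R where "R \<ge> 0" "\<And>z. P.prob {\<omega>. R < limprod z \<omega>} < e"
proof -
  have "\<exists>R. \<forall>z. P.prob {\<omega>. R < limprod z \<omega>} < e"
  proof (rule ccontr)
    assume "\<not> ?thesis"
    then have "\<exists>\<xi>\<in>hboundary. e \<le> P.prob {\<omega>. X \<omega> = \<xi>}"
      by (intro atom_if_concentrated[OF assms]) (auto simp: not_less)
    then show False using no_atoms assms by (auto simp: mass_def)
  qed
  then obtain R where R: "\<And>z. P.prob {\<omega>. R < limprod z \<omega>} < e" by blast
  have "P.prob {\<omega>. max R 0 < limprod z \<omega>} < e" for z
  proof -
    have "{\<omega> \<in> space S. R < limprod z \<omega>} \<in> sets S" by measurable
    then have "P.prob {\<omega>. max R 0 < limprod z \<omega>} \<le> P.prob {\<omega>. R < limprod z \<omega>}"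
      by (intro P.finite_measure_mono) auto
    with R[of z] show ?thesis by simp
  qed
  then show ?thesis by (intro that[of "max R 0"]) auto
qed

end

section \<open>The drift along the limiting Busemann function\<close>

context harmonic_walk
begin

lemma integrable_limprod_term: "integrable S (\<lambda>\<omega>. limprod (invf (wk \<omega> m) b) (shift m \<omega>))"
proof (rule Bochner_Integration.integrable_bound[OF integrable_len[OF moment, of m]])
  show "AE \<omega> in S. norm (limprod (invf (wk \<omega> m) b) (shift m \<omega>)) \<le> norm (len m \<omega>)"
    using limprod_le_dist[of "invf (wk _ m) b"] by (simp add: limprod_nonneg dist_inv_wk)
qed measurable

lemma integrable_horo: "integrable S (horo m)"
  unfolding horo_eq[abs_def]
  by (intro Bochner_Integration.integrable_diff integrable_mult_right integrable_len[OF moment]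
      integrable_limprod_term)

text \<open>Condition on the position \<open>g\<close> at time \<open>m\<close>: for z the image of
  \<open>b\<close> under its inverse, the product is at most \<open>R\<close> except with
  probability below \<open>e\<close>, where it is at most |z|, the length of the position.\<close>

lemma integral_limprod_le:
  assumes "R \<ge> 0" and tight: "\<And>z. P.prob {\<omega>. R < limprod z \<omega>} < e"
  shows "(\<integral>\<omega>. limprod (invf (wk \<omega> m) b) (shift m \<omega>) \<partial>S) \<le> R + e * integral\<^sup>L S (len m)"
proof -
  have e: "e > 0" using tight[of b] measure_nonneg[of S] by (rule order_le_less_trans[rotated])
  have single: "(\<integral>\<^sup>+\<omega>. ennreal (limprod z \<omega>) \<partial>S) \<le> ennreal (R + e * dist b z)" for z
  proof -
    have m: "{\<omega>. R < limprod z \<omega>} \<in> sets S"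
    proof -
      have "{\<omega> \<in> space S. R < limprod z \<omega>} \<in> sets S" by measurable
      then show ?thesis by simp
    qed
    have "(\<integral>\<^sup>+\<omega>. ennreal (limprod z \<omega>) \<partial>S) \<le>
        (\<integral>\<^sup>+\<omega>. ennreal R + ennreal (dist b z) * indicator {\<omega>. R < limprod z \<omega>} \<omega> \<partial>S)"
    proof (rule nn_integral_mono)
      fix \<omega>
      show "ennreal (limprod z \<omega>) \<le> ennreal R + ennreal (dist b z) * indicator {\<omega>. R < limprod z \<omega>} \<omega>"
        using limprod_le_dist[of z \<omega>] \<open>R \<ge> 0\<close>
        by (cases "R < limprod z \<omega>") (auto intro!: ennreal_leI simp flip: ennreal_plus)
    qed
    also have "\<dots> = ennreal R + ennreal (dist b z) * emeasure S {\<omega>. R < limprod z \<omega>}"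
      using m P.emeasure_space_1 by (simp add: nn_integral_add nn_integral_cmult)
    also have "\<dots> = ennreal (R + dist b z * P.prob {\<omega>. R < limprod z \<omega>})"
      using \<open>R \<ge> 0\<close> by (simp add: P.emeasure_eq_measure ennreal_mult)
    also have "\<dots> \<le> ennreal (R + e * dist b z)"
      using mult_left_mono[OF less_imp_le[OF tight[of z]], of "dist b z"]
      by (intro ennreal_leI add_left_mono) (simp add: mult.commute)
    finally show ?thesis .
  qed
  have "ennreal (\<integral>\<omega>. limprod (invf (wk \<omega> m) b) (shift m \<omega>) \<partial>S) =
      (\<integral>\<^sup>+\<omega>. ennreal (limprod (invf (wk \<omega> m) b) (shift m \<omega>)) \<partial>S)"
    by (rule nn_integral_eq_integral[symmetric]) (auto simp: integrable_limprod_term limprod_nonneg)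
  also have "\<dots> = (\<integral>\<^sup>+g. \<integral>\<^sup>+\<omega>. ennreal (limprod (invf g b) \<omega>) \<partial>S \<partial>conv_power \<mu> m)"
    by (rule nn_integral_walk[of "\<lambda>g \<omega>. ennreal (limprod (invf g b) \<omega>)"]) measurable
  also have "\<dots> \<le> (\<integral>\<^sup>+g. ennreal (R + e * dist b (invf g b)) \<partial>conv_power \<mu> m)"
    by (intro nn_integral_mono single)
  also have "\<dots> = (\<integral>\<^sup>+\<omega>. ennreal (R + e * dist b (invf (wk \<omega> m) b)) \<partial>S)"
    using nn_integral_distr[of "\<lambda>\<omega>. wk \<omega> m" S "count_space UNIV" "\<lambda>g. ennreal (R + e * dist b (invf g b))"]
    by (simp add: distr_wk)
  also have "\<dots> = (\<integral>\<^sup>+\<omega>. ennreal (R + e * len m \<omega>) \<partial>S)"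
    by (simp only: dist_inv_wk)
  also have "\<dots> = ennreal (\<integral>\<omega>. R + e * len m \<omega> \<partial>S)"
    using integrable_len[OF moment, of m] \<open>R \<ge> 0\<close> e by (intro nn_integral_eq_integral) auto
  also have "(\<integral>\<omega>. R + e * len m \<omega> \<partial>S) = R + e * integral\<^sup>L S (len m)"
    using integrable_len[OF moment, of m] P.prob_space by simp
  finally have "ennreal (\<integral>\<omega>. limprod (invf (wk \<omega> m) b) (shift m \<omega>) \<partial>S) \<le> ennreal (R + e * integral\<^sup>L S (len m))" .
  moreover have "0 \<le> R + e * integral\<^sup>L S (len m)"
    using \<open>R \<ge> 0\<close> e by (simp add: integral_nonneg_AE)
  ultimately show ?thesis using ennreal_le_iff by blast
qed

text \<open>The point is that \<open>R\<close> does not depend on \<open>m\<close>: after division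
  by \<open>m\<close> only the factor \<open>1 - e\<close> remains.\<close>

lemma drift_lower_bound:
  assumes "e > 0"
  obtains R where "\<And>m. (1 - e) * integral\<^sup>L S (len m) - R \<le> integral\<^sup>L S (horo m)"
proof -
  \<comment> \<open>Half of \<open>e\<close>, because \<open>horo_eq\<close> subtracts the product
    twice.\<close>
  obtain R where R: "R \<ge> 0" "\<And>z. P.prob {\<omega>. R < limprod z \<omega>} < e / 2"
    using limprod_uniformly_tight[of "e / 2"] assms by auto
  have "(1 - e) * integral\<^sup>L S (len m) - 2 * R \<le> integral\<^sup>L S (horo m)" for m
  proof -
    have "integral\<^sup>L S (horo m) =
        integral\<^sup>L S (len m) - 2 * (\<integral>\<omega>. limprod (invf (wk \<omega> m) b) (shift m \<omega>) \<partial>S)"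
      unfolding horo_eq[abs_def] by (simp add: integrable_len[OF moment] integrable_limprod_term)
    then show ?thesis
      using integral_limprod_le[OF R, of m] by (simp add: algebra_simps)
  qed
  then show ?thesis by (rule that)
qed

lemma integral_horo_le_len: "integral\<^sup>L S (horo m) \<le> integral\<^sup>L S (len m)"
  by (rule integral_mono[OF integrable_horo integrable_len[OF moment] horo_le_len])

lemma integral_horo_mult: "real k * integral\<^sup>L S (horo m) \<le> integral\<^sup>L S (horo (k * m))"
proof -
  have "real k * integral\<^sup>L S (horo m) = (\<Sum>i<k. integral\<^sup>L S (\<lambda>\<omega>. horo m (shift (i * m) \<omega>)))"
    by (simp add: integral_shift)
  also have "\<dots> = integral\<^sup>L S (\<lambda>\<omega>. \<Sum>i<k. horo m (shift (i * m) \<omega>))"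
    by (intro Bochner_Integration.integral_sum[symmetric] integrable_shift integrable_horo)
  also have "\<dots> \<le> integral\<^sup>L S (horo (k * m))"
    by (intro integral_mono Bochner_Integration.integrable_sum integrable_shift integrable_horo horo_sum)
  finally show ?thesis .
qed

text \<open>Fatou's lemma: almost every path converges to the boundary, so its length tends to
  infinity.\<close>

lemma integral_len_unbounded: "\<exists>m. K < integral\<^sup>L S (len m)"
proof (rule ccontr)
  assume "\<not> ?thesis"
  then have le: "integral\<^sup>L S (len m) \<le> K" for m by (auto simp: not_less)
  have "(\<integral>\<^sup>+\<omega>. liminf (\<lambda>m. ennreal (len m \<omega>)) \<partial>S) \<le> liminf (\<lambda>m. \<integral>\<^sup>+\<omega>. ennreal (len m \<omega>) \<partial>S)"
    by (rule nn_integral_liminf) measurable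
  also have "\<dots> \<le> ennreal K"
  proof (rule Liminf_le)
    show "\<forall>\<^sub>F m in sequentially. (\<integral>\<^sup>+\<omega>. ennreal (len m \<omega>) \<partial>S) \<le> ennreal K"
      using le by (intro always_eventually allI)
        (subst nn_integral_eq_integral, auto simp: integrable_len[OF moment] intro: ennreal_leI)
  qed simp
  finally have fin: "(\<integral>\<^sup>+\<omega>. liminf (\<lambda>m. ennreal (len m \<omega>)) \<partial>S) \<le> ennreal K" .
  have "AE \<omega> in S. liminf (\<lambda>m. ennreal (len m \<omega>)) = \<infinity>"
    using AE_orbit_converges
  proof eventually_elim
    case (elim \<omega>)
    have "filterlim (\<lambda>m. len m \<omega>) at_top sequentially"
      unfolding len_def by (rule gsim_dist_at_top[OF elim])
    then have "(\<lambda>m. ennreal (len m \<omega>)) \<longlonglongrightarrow> \<infinity>"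
      by (simp add: ennreal_tendsto_top_eq_at_top)
    then show ?case by (intro lim_imp_Liminf) auto
  qed
  then have "(\<integral>\<^sup>+\<omega>. liminf (\<lambda>m. ennreal (len m \<omega>)) \<partial>S) = (\<integral>\<^sup>+\<omega>. \<infinity> \<partial>S)"
    by (rule nn_integral_cong_AE)
  also have "\<dots> = \<infinity>" using P.emeasure_space_1 by simp
  finally show False using fin by (simp add: top_unique)
qed

text \<open>Once the mean of \<open>horo\<close> at a single time \<open>m\<close> is at least 1,
  superadditivity makes it at least \<open>k\<close> at time \<open>k * m\<close>, so l \<ge>
  1/m.\<close>

lemma rate_of_escape_pos: "rate_of_escape b \<mu> > 0"
proof -
  obtain R where R: "\<And>m. (1 - 1 / 2) * integral\<^sup>L S (len m) - R \<le> integral\<^sup>L S (horo m)"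
    using drift_lower_bound[of "1 / 2"] by auto
  obtain m where "2 * R + 2 < integral\<^sup>L S (len m)" using integral_len_unbounded by blast
  with R[of m] have horo1: "1 \<le> integral\<^sup>L S (horo m)" by simp
  have "m \<noteq> 0"
    using horo1 integral_horo_le_len[of m] by (auto intro: ccontr simp: len_def[abs_def])
  have "(\<lambda>k. integral\<^sup>L S (len (Suc k * m)) / real (Suc k * m)) \<longlonglongrightarrow> rate_of_escape b \<mu>"
    using LIMSEQ_subseq_LIMSEQ[OF rate_of_escape_lim[OF moment], of "\<lambda>k. Suc k * m"] \<open>m \<noteq> 0\<close>
    by (simp add: o_def strict_mono_Suc_iff)
  moreover have "1 / real m \<le> integral\<^sup>L S (len (Suc k * m)) / real (Suc k * m)" for k
  proof -
    have "real (Suc k) * 1 \<le> real (Suc k) * integral\<^sup>L S (horo m)"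
      using horo1 by (intro mult_left_mono) auto
    also have "\<dots> \<le> integral\<^sup>L S (len (Suc k * m))"
      using integral_horo_mult[of "Suc k" m] integral_horo_le_len[of "Suc k * m"] by linarith
    finally have "real (Suc k) / real (Suc k * m) \<le> integral\<^sup>L S (len (Suc k * m)) / real (Suc k * m)"
      by (intro divide_right_mono) auto
    moreover have "real (Suc k) / real (Suc k * m) = 1 / real m"
      using \<open>m \<noteq> 0\<close> by (simp only: of_nat_mult) (simp add: divide_simps)
    ultimately show ?thesis by simp
  qed
  ultimately have "1 / real m \<le> rate_of_escape b \<mu>"
    by (intro LIMSEQ_le_const) auto
  then show ?thesis using \<open>m \<noteq> 0\<close> by (auto intro: less_le_trans[rotated])
qed

lemma eventually_drift:
  assumes "c < rate_of_escape b \<mu>"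
  shows "\<forall>\<^sub>F m in sequentially. real m * c < integral\<^sup>L S (horo m)"
proof -
  define l where "l = rate_of_escape b \<mu>"
  have l: "l > 0" "c < l" using rate_of_escape_pos assms by (simp_all add: l_def)
  \<comment> \<open>Makes \<open>(1 - e) * l\<close> the midpoint of \<open>c\<close> and
    \<open>l\<close>.\<close>
  define e where "e = (l - c) / (2 * l)"
  have e: "e > 0" "(1 - e) * l > c" using l by (simp_all add: e_def field_simps)
  obtain R where R: "\<And>m. (1 - e) * integral\<^sup>L S (len m) - R \<le> integral\<^sup>L S (horo m)"
    using drift_lower_bound[OF e(1)] by auto
  have "(\<lambda>m. (1 - e) * (integral\<^sup>L S (len m) / real m) - R / real m) \<longlonglongrightarrow> (1 - e) * l - 0"
    unfolding l_def by (intro tendsto_intros rate_of_escape_lim[OF moment] lim_const_over_n)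
  then have "\<forall>\<^sub>F m in sequentially. c < (1 - e) * (integral\<^sup>L S (len m) / real m) - R / real m"
    using e(2) by (intro order_tendstoD(1)) auto
  then show ?thesis
    using eventually_gt_at_top[of 0]
  proof eventually_elim
    case (elim m)
    then have "real m * c < real m * ((1 - e) * (integral\<^sup>L S (len m) / real m) - R / real m)"
      by (intro mult_strict_left_mono) auto
    also have "\<dots> = (1 - e) * integral\<^sup>L S (len m) - R"
      using elim by (simp add: field_simps)
    also have "\<dots> \<le> integral\<^sup>L S (horo m)" by (rule R)
    finally show ?case .
  qed
qed

section \<open>Measures of balls\<close>

lemma ball_mass_lower_bound:
  assumes conv: "gsim b (orbit \<omega>) (rseq (X \<omega>))"
    and R: "R \<ge> 0" "\<And>z. P.prob {\<omega>. R < limprod z \<omega>} < 1 / 2"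
    and horo: "t \<le> horo n \<omega>" and r: "\<Lambda> * a powr (4 * \<delta> + R + 1 - t) < r"
  shows "pmf (conv_power \<mu> n) (wk \<omega> n) / 2 \<le> P.prob {\<omega>'. D (X \<omega>) (X \<omega>') < r}"
proof -
  define g where "g = wk \<omega> n"
  have g: "isom g" by (simp add: g_def)
  define A where "A = {\<omega>'. limprod (invf g b) \<omega>' \<le> R}"
  have A: "A \<in> sets S" "{\<omega>'. R < limprod (invf g b) \<omega>'} \<in> sets S"
  proof -
    have "{\<omega>' \<in> space S. limprod (invf g b) \<omega>' \<le> R} \<in> sets S"
      "{\<omega>' \<in> space S. R < limprod (invf g b) \<omega>'} \<in> sets S" by measurable
    then show "A \<in> sets S" "{\<omega>'. R < limprod (invf g b) \<omega>'} \<in> sets S" by (simp_all add: A_def)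
  qed
  have "A = space S - {\<omega>'. R < limprod (invf g b) \<omega>'}" by (auto simp: A_def)
  then have PA: "1 / 2 \<le> P.prob A"
    using P.prob_compl[OF A(2)] R(2)[of "invf g b"] by simp
  \<comment> \<open>Paths that pass through the same position at time \<open>n\<close> and
    afterwards do not return far towards \<open>b\<close>. The two conditions are independent, which
    gives the factor 1/2.\<close>
  define E where "E = {\<omega>'. wk \<omega>' n = g \<and> shift n \<omega>' \<in> A}"
  have PE: "P.prob E = pmf (conv_power \<mu> n) g * P.prob A"
    using emeasure_walk_eq_future[OF A(1), of n g]
    by (simp add: E_def P.emeasure_eq_measure flip: ennreal_mult)
  have ball: "{\<omega>'. D (X \<omega>) (X \<omega>') < r} \<in> sets S"
  proof -
    have "{\<omega>' \<in> space S. D (X \<omega>) (X \<omega>') < r} \<in> sets S" by measurable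
    then show ?thesis by simp
  qed
  have t_le: "t \<le> dist b (g b)"
    using horo horo_le_len[of n \<omega>] by (simp add: len_def g_def)
  \<comment> \<open>Twice the product is |gb| plus a Busemann difference, each at least
    \<open>t - 1\<close>. It is weakened to \<open>t - R - 1\<close>, the level available for the
    second path.\<close>
  have ev: "\<forall>\<^sub>F k in sequentially. t - R - 1 \<le> gromov b (g b) (orbit \<omega> k)"
  proof -
    have "\<forall>\<^sub>F k in sequentially. t - 1 < dist b (orbit \<omega> k) - dist (g b) (orbit \<omega> k)"
      unfolding g_def using horo by (intro eventually_gt_horo) simp
    then show ?thesis
    proof eventually_elim
      case (elim k)
      then have "2 * (t - R - 1) \<le> 2 * gromov b (g b) (orbit \<omega> k)"
        using t_le R(1) by (simp add: gromov_def field_simps)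
      then show ?case by simp
    qed
  qed
  have "P.prob E \<le> P.prob {\<omega>'. D (X \<omega>) (X \<omega>') < r}"
  proof (rule P.finite_measure_mono_AE[OF _ ball])
    show "AE \<omega>' in S. \<omega>' \<in> E \<longrightarrow> \<omega>' \<in> {\<omega>'. D (X \<omega>) (X \<omega>') < r}"
      using AE_orbit_converges
    proof eventually_elim
      case (elim \<omega>')
      show ?case
      proof
        assume "\<omega>' \<in> E"
        then have \<omega>': "wk \<omega>' n = g" "limprod (invf g b) (shift n \<omega>') < R + 1"
          by (auto simp: E_def A_def)
        obtain N where N: "\<And>k. k \<ge> N \<Longrightarrow> gromov b (invf g b) (wk (shift n \<omega>') k b) < R + 1"
          using eventually_gromov_less_if_limprod[OF \<omega>'(2)] by (auto simp: eventually_sequentially)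
        have "t - R - 1 \<le> gromov b (g b) (orbit \<omega>' k)" if "k \<ge> n + N" for k
        proof -
          define j where "j = k - n"
          have k: "k = n + j" "j \<ge> N" using that by (auto simp: j_def)
          have "gromov (g b) b (orbit \<omega>' k) = gromov b (invf g b) (wk (shift n \<omega>') j b)"
            using isom_gromov_inv[OF g, of b b "orbit \<omega>' k"] g by (simp add: k wk_add \<omega>'(1))
          then show ?thesis
            using N[OF k(2)] gromov_swap_base[of b "g b" "orbit \<omega>' k"] t_le by simp
        qed
        then have "\<forall>\<^sub>F k in sequentially. t - R - 1 \<le> gromov b (g b) (orbit \<omega>' k)"
          unfolding eventually_sequentially by blast
        from D_X_le[OF conv elim ev this] have "D (X \<omega>) (X \<omega>') \<le> \<Lambda> * a powr (3 * \<delta> - (t - R - 1))" .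
        also have "\<dots> \<le> \<Lambda> * a powr (4 * \<delta> + R + 1 - t)"
          using \<Lambda> a delta_nonneg by (intro mult_left_mono powr_mono) auto
        finally show "\<omega>' \<in> {\<omega>'. D (X \<omega>) (X \<omega>') < r}" using r by simp
      qed
    qed
  qed
  moreover have "pmf (conv_power \<mu> n) g / 2 \<le> P.prob E"
    unfolding PE using mult_left_mono[OF PA pmf_nonneg[of "conv_power \<mu> n" g]] by simp
  ultimately show ?thesis by (simp add: g_def)
qed

definition ball_mass :: "real \<Rightarrow> 'a hpoint \<Rightarrow> real" where
  "ball_mass r \<xi> = P.prob {\<omega>. D \<xi> (X \<omega>) < r}"

lemma sets_ball: "\<xi> \<in> hboundary \<Longrightarrow> {\<omega>. D \<xi> (X \<omega>) < r} \<in> sets S"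
proof -
  assume \<xi>: "\<xi> \<in> hboundary"
  then have "{\<omega> \<in> space S. D \<xi> (X \<omega>) < r} \<in> sets S" by measurable
  then show ?thesis by simp
qed

text \<open>Superlevel sets are open: by continuity from below a slightly smaller ball still has
  mass above \<open>t\<close>, and balls of radius \<open>r\<close> around nearby centres contain
  it. Measurability lets almost sure statements pass from paths to the boundary.\<close>

lemma measurable_ball_mass [measurable]: "ball_mass r \<in> borel_measurable (hboundary_borel b)"
  unfolding borel_measurable_iff_greater
proof
  fix t
  show "{\<xi> \<in> space (hboundary_borel b). t < ball_mass r \<xi>} \<in> sets (hboundary_borel b)"
  proof (rule sets_hboundary_borelI)
    fix \<eta> assume "\<eta> \<in> {\<xi> \<in> space (hboundary_borel b). t < ball_mass r \<xi>}"
    then have \<eta>: "\<eta> \<in> hboundary" "t < ball_mass r \<eta>" by auto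
    let ?s = "\<lambda>n. r - 1 / real (Suc n)"
    have "(\<lambda>n. P.prob {\<omega>. D \<eta> (X \<omega>) < ?s n}) \<longlonglongrightarrow> P.prob (\<Union>n. {\<omega>. D \<eta> (X \<omega>) < ?s n})"
    proof (rule P.finite_Lim_measure_incseq)
      show "range (\<lambda>n. {\<omega>. D \<eta> (X \<omega>) < ?s n}) \<subseteq> sets S" using sets_ball[OF \<eta>(1)] by blast
      show "incseq (\<lambda>n. {\<omega>. D \<eta> (X \<omega>) < ?s n})"
        unfolding incseq_def by (auto elim!: less_le_trans intro!: divide_left_mono)
    qed
    moreover have "(\<Union>n. {\<omega>. D \<eta> (X \<omega>) < ?s n}) = {\<omega>. D \<eta> (X \<omega>) < r}"
    proof (intro equalityI subsetI)
      fix \<omega> assume "\<omega> \<in> {\<omega>. D \<eta> (X \<omega>) < r}"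
      then obtain n where "1 / real (Suc n) < r - D \<eta> (X \<omega>)"
        using nat_approx_posE[of "r - D \<eta> (X \<omega>)"] by auto
      then show "\<omega> \<in> (\<Union>n. {\<omega>. D \<eta> (X \<omega>) < ?s n})" by (intro UN_I[of n]) auto
    qed (auto elim!: less_trans)
    ultimately have "(\<lambda>n. P.prob {\<omega>. D \<eta> (X \<omega>) < ?s n}) \<longlonglongrightarrow> ball_mass r \<eta>"
      by (simp add: ball_mass_def)
    from order_tendstoD(1)[OF this \<eta>(2)] obtain n where n: "t < P.prob {\<omega>. D \<eta> (X \<omega>) < ?s n}"
      by (auto dest: eventually_happens)
    have "t < ball_mass r \<zeta>" if \<zeta>: "\<zeta> \<in> hboundary" "D \<eta> \<zeta> < 1 / real (Suc n)" for \<zeta>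
    proof -
      have "{\<omega>. D \<eta> (X \<omega>) < ?s n} \<subseteq> {\<omega>. D \<zeta> (X \<omega>) < r}"
      proof
        fix \<omega> assume "\<omega> \<in> {\<omega>. D \<eta> (X \<omega>) < ?s n}"
        then show "\<omega> \<in> {\<omega>. D \<zeta> (X \<omega>) < r}"
          using D_facts(4)[OF \<zeta>(1) \<eta>(1) X_in[of \<omega>]] D_facts(2)[OF \<zeta>(1) \<eta>(1)] \<zeta>(2) by simp
      qed
      then show ?thesis
        unfolding ball_mass_def using P.finite_measure_mono[OF _ sets_ball[OF \<zeta>(1)]] n by (meson less_le_trans)
    qed
    then show "\<exists>s>0. \<forall>\<zeta>\<in>hboundary. D \<eta> \<zeta> < s \<longrightarrow> \<zeta> \<in> {\<xi> \<in> space (hboundary_borel b). t < ball_mass r \<xi>}"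
      by (intro exI[of _ "1 / real (Suc n)"]) auto
  qed auto
qed

lemma measure_mball:
  assumes "\<xi> \<in> hboundary"
  shows "measure (distr S (hboundary_borel b) X) (Metric_space.mball hboundary D \<xi> r) = ball_mass r \<xi>"
proof -
  have "Metric_space hboundary D"
    using Metric_space.subspace[OF metric hboundary_subset] .
  then have eq: "Metric_space.mball hboundary D \<xi> r = {\<eta> \<in> space (hboundary_borel b). D \<xi> \<eta> < r}"
    using assms by (auto simp: Metric_space.in_mball)
  have "{\<eta> \<in> space (hboundary_borel b). D \<xi> \<eta> < r} \<in> sets (hboundary_borel b)"
    using measurable_D[OF assms] unfolding borel_measurable_iff_less by blast
  then have "measure (distr S (hboundary_borel b) X) (Metric_space.mball hboundary D \<xi> r) =
      P.prob (X -` {\<eta> \<in> space (hboundary_borel b). D \<xi> \<eta> < r} \<inter> space S)"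
    unfolding eq by (rule measure_distr[OF X_meas])
  also have "X -` {\<eta> \<in> space (hboundary_borel b). D \<xi> \<eta> < r} \<inter> space S = {\<omega>. D \<xi> (X \<omega>) < r}"
    by auto
  finally show ?thesis unfolding ball_mass_def .
qed

text \<open>The one-sided ergodic bound, applied to \<open>info m\<close> and to
  \<open>- horo m\<close> over blocks of length \<open>m\<close>, controls mass and radius along one
  geometric sequence of radii.\<close>

lemma AE_ball_mass_lower_bound:
  assumes "m > 0" and c: "c < integral\<^sup>L S (horo m)"
    and h: "integrable S (info m)" "integral\<^sup>L S (info m) < h"
  shows "\<exists>C>0. AE \<xi> in distr S (hboundary_borel b) X.
    \<forall>\<^sub>F k in sequentially. exp (- real k * h) / 2 \<le> ball_mass (C * a powr (- real k * c)) \<xi>"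
proof -
  obtain R where R: "R \<ge> 0" "\<And>z. P.prob {\<omega>. R < limprod z \<omega>} < 1 / 2"
    using limprod_uniformly_tight[of "1 / 2"] by auto
  \<comment> \<open>The factor 2 supplies the strict inequality required of the radius in
    \<open>ball_mass_lower_bound\<close>.\<close>
  define C where "C = 2 * \<Lambda> * a powr (4 * \<delta> + R + 1)"
  have "C > 0" using \<Lambda> a by (simp add: C_def)
  have "AE \<omega> in S. \<forall>\<^sub>F k in sequentially. (\<Sum>i<k. - horo m (shift (i * m) \<omega>)) \<le> real k * (- c)"
    using c integrable_horo \<open>m > 0\<close> by (intro shift_sums_eventually_le) auto
  moreover have "AE \<omega> in S. \<forall>\<^sub>F k in sequentially. (\<Sum>i<k. info m (shift (i * m) \<omega>)) \<le> real k * h"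
    using h \<open>m > 0\<close> by (intro shift_sums_eventually_le)
  moreover have "AE \<omega> in S. \<forall>n. pmf (conv_power \<mu> n) (wk \<omega> n) > 0"
    unfolding AE_all_countable by (intro allI AE_pmf_wk_pos)
  ultimately have "AE \<omega> in S. \<forall>\<^sub>F k in sequentially. exp (- real k * h) / 2 \<le> ball_mass (C * a powr (- real k * c)) (X \<omega>)"
    using info_sum[of m] AE_orbit_converges
  proof eventually_elim
    case (elim \<omega>)
    note good = elim(3-5)
    show ?case
      using elim(1,2)
    proof eventually_elim
      case (elim k)
      have "real k * c \<le> horo (k * m) \<omega>"
        using elim(1) horo_sum[of m \<omega> k] by (simp add: sum_negf)
      moreover have "\<Lambda> * a powr (4 * \<delta> + R + 1 - real k * c) < C * a powr (- real k * c)"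
        using \<Lambda> a by (simp add: C_def powr_diff powr_minus field_simps)
      ultimately have "pmf (conv_power \<mu> (k * m)) (wk \<omega> (k * m)) / 2 \<le> ball_mass (C * a powr (- real k * c)) (X \<omega>)"
        unfolding ball_mass_def using good(3) R by (intro ball_mass_lower_bound)
      moreover have "exp (- real k * h) \<le> pmf (conv_power \<mu> (k * m)) (wk \<omega> (k * m))"
      proof -
        have "info (k * m) \<omega> \<le> real k * h"
          using good(2)[rule_format, of k] elim(2) by (rule order_trans)
        then have "- real k * h \<le> ln (pmf (conv_power \<mu> (k * m)) (wk \<omega> (k * m)))"
          by (simp add: info_def)
        then show ?thesis
          using good(1) by (simp add: ln_ge_iff)
      qed
      ultimately show ?case by simp
    qed
  qed
  then have "AE \<xi> in distr S (hboundary_borel b) X.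
      \<forall>\<^sub>F k in sequentially. exp (- real k * h) / 2 \<le> ball_mass (C * a powr (- real k * c)) \<xi>"
    unfolding eventually_sequentially by (subst AE_distr_iff[OF X_meas]) measurable
  with \<open>C > 0\<close> show ?thesis by blast
qed

end

text \<open>Geometric radii suffice: between consecutive ones the logarithm of the radius changes by
  the constant \<open>q\<close>, which vanishes after division by \<open>ln r\<close>.\<close>

lemma upper_dim_le:
  fixes V :: "real \<Rightarrow> real"
  assumes mono: "\<And>r s. r \<le> s \<Longrightarrow> V r \<le> V s" and le1: "\<And>r. V r \<le> 1"
    and "a > 1" "c > 0" "h \<ge> 0" "C > 0"
    and lower: "\<forall>\<^sub>F k in sequentially. exp (- real k * h) / 2 \<le> V (C * a powr (- real k * c))"
  shows "Limsup (at_right 0) (\<lambda>r. if V r = 0 then \<infinity> else ereal (ln (V r) / ln r)) \<le> ereal (h / (c * ln a))"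
proof -
  define q where "q = c * ln a"
  have q: "q > 0" using assms by (simp add: q_def)
  define F where "F r = (((- ln r + ln C) / q + 1) * h + ln 2) / (- ln r)" for r :: real
  obtain N where N: "\<And>k. k \<ge> N \<Longrightarrow> exp (- real k * h) / 2 \<le> V (C * a powr (- real k * c))"
    using lower by (auto simp: eventually_sequentially)
  have ln_lim: "filterlim (\<lambda>r::real. - ln r) at_top (at_right 0)"
    unfolding filterlim_uminus_at_top using ln_at_0 by simp
  \<comment> \<open>The second entry puts the index belonging to \<open>r\<close> beyond
    \<open>N\<close>; the 1 keeps the divisor \<open>- ln r\<close> positive.\<close>
  have "\<forall>\<^sub>F r in at_right 0. max 1 (\<bar>ln C\<bar> + q * real N) \<le> - ln r"
    using ln_lim unfolding filterlim_at_top by blast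
  moreover have "\<forall>\<^sub>F r::real in at_right 0. 0 < r"
    by (simp add: eventually_at_right_less)
  ultimately have ev: "\<forall>\<^sub>F r in at_right 0. (if V r = 0 then \<infinity> else ereal (ln (V r) / ln r)) \<le> ereal (F r)"
  proof eventually_elim
    case (elim r)
    define t where "t = - ln r"
    have t: "t \<ge> 1" "t + ln C \<ge> q * real N" using elim by (auto simp: t_def)
    define x where "x = (t + ln C) / q"
    have x: "x \<ge> real N" using t q by (simp add: x_def pos_le_divide_eq mult.commute)
    \<comment> \<open>The first index whose geometric radius is at most \<open>r\<close>; rounding
      up accounts for the 1 in \<open>F\<close>.\<close>
    define k where "k = nat \<lceil>x\<rceil>"
    have k: "k \<ge> N" "x \<le> real k" "real k \<le> x + 1" using x by (auto simp: k_def) linarith+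
    have "C * a powr (- real k * c) \<le> r"
    proof -
      have "ln (C * a powr (- real k * c)) = ln C - real k * q"
        using assms by (simp add: ln_mult ln_powr q_def)
      also have "\<dots> \<le> ln C - x * q" using k q by (simp add: mult_right_mono)
      also have "\<dots> = ln r" using q by (simp add: x_def t_def)
      finally show ?thesis using elim assms by (subst (asm) ln_le_cancel_iff) auto
    qed
    then have V: "exp (- real k * h) / 2 \<le> V r"
      using N[OF k(1)] mono by (meson order_trans)
    then have Vpos: "V r > 0" by (rule less_le_trans[rotated]) simp
    have "ln (exp (- real k * h) / 2) \<le> ln (V r)" using V Vpos by (subst ln_le_cancel_iff) auto
    then have "- ln (V r) \<le> real k * h + ln 2" by (simp add: ln_div)
    also have "\<dots> \<le> (x + 1) * h + ln 2" using k assms by (simp add: mult_right_mono)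
    finally have "- ln (V r) / t \<le> ((x + 1) * h + ln 2) / t" using t by (intro divide_right_mono) auto
    then show ?case
      using Vpos by (simp add: F_def x_def t_def)
  qed
  have F_eq: "F r = (\<lambda>s. (((1 / q) * h + (((ln C / q + 1) * h + ln 2)) / s))) (- ln r)" if "ln r \<noteq> 0" for r
    using that q by (simp add: F_def field_simps)
  have "((\<lambda>s::real. (1 / q) * h + ((ln C / q + 1) * h + ln 2) / s) \<longlongrightarrow> (1 / q) * h + 0) at_top"
    by (intro tendsto_intros tendsto_divide_0[OF tendsto_const] filterlim_at_top_imp_at_infinity filterlim_ident)
  from filterlim_compose[OF this ln_lim]
  have "((\<lambda>r. (1 / q) * h + ((ln C / q + 1) * h + ln 2) / (- ln r)) \<longlongrightarrow> h / q) (at_right 0)" by simp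
  moreover have "\<forall>\<^sub>F r in at_right 0. (1 / q) * h + ((ln C / q + 1) * h + ln 2) / (- ln r) = F r"
  proof -
    have "\<forall>\<^sub>F r in at_right 0. 1 \<le> - ln (r::real)" using ln_lim unfolding filterlim_at_top by blast
    then show ?thesis by eventually_elim (subst F_eq, auto)
  qed
  ultimately have "(F \<longlongrightarrow> h / q) (at_right 0)" by (rule Lim_transform_eventually)
  then have "Limsup (at_right 0) (\<lambda>r. ereal (F r)) = ereal (h / q)"
    by (intro lim_imp_Limsup) auto
  then show ?thesis
    using Limsup_mono[OF ev] by (simp add: q_def)
qed

section \<open>Letting the block length grow\<close>

context harmonic_walk
begin

lemma upper_pointwise_dim_le:
  "AE \<xi> in distr S (hboundary_borel b) X.
    upper_pointwise_dim hboundary D (distr S (hboundary_borel b) X) \<xi>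
      \<le> ereal (1 / ln a) * (asymptotic_entropy \<mu> / ereal (rate_of_escape b \<mu>))"
proof (cases rule: asymptotic_entropy_cases)
  case 1
  have "asymptotic_entropy \<mu> / ereal (rate_of_escape b \<mu>) = \<infinity>"
    using 1 rate_of_escape_pos by simp
  then show ?thesis using a by simp
next
  case (2 h)
  let ?\<nu> = "distr S (hboundary_borel b) X"
  define l where "l = rate_of_escape b \<mu>"
  have l: "l > 0" by (simp add: l_def rate_of_escape_pos)
  have "h \<ge> 0"
    by (rule LIMSEQ_le_const[OF 2(3)]) (auto intro!: divide_nonneg_nonneg integral_nonneg_AE info_nonneg)
  have dim: "AE \<xi> in ?\<nu>. upper_pointwise_dim hboundary D ?\<nu> \<xi> \<le> ereal ((h + e) / ((l - e) * ln a))"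
    if e: "0 < e" "e < l" for e
  proof -
    have "\<forall>\<^sub>F m in sequentially. real m * (l - e) < integral\<^sup>L S (horo m)"
      using e by (intro eventually_drift) (simp add: l_def)
    moreover have "\<forall>\<^sub>F m in sequentially. integral\<^sup>L S (info m) / real m < h + e"
      using 2(3) e by (intro order_tendstoD(2)) auto
    ultimately have "\<forall>\<^sub>F m in sequentially. real m * (l - e) < integral\<^sup>L S (horo m) \<and>
        integral\<^sup>L S (info m) / real m < h + e \<and> m > 0"
      using eventually_gt_at_top[of 0] by eventually_elim simp
    then obtain m where m: "real m * (l - e) < integral\<^sup>L S (horo m)"
        "integral\<^sup>L S (info m) / real m < h + e" "m > 0"
      by (auto dest: eventually_happens)
    have "integral\<^sup>L S (info m) < real m * (h + e)"
      using m by (simp add: divide_less_eq mult.commute)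
    from AE_ball_mass_lower_bound[OF m(3,1) 2(2) this] obtain C where "C > 0" and
      C: "AE \<xi> in ?\<nu>. \<forall>\<^sub>F k in sequentially. exp (- real k * (real m * (h + e))) / 2
          \<le> ball_mass (C * a powr (- real k * (real m * (l - e)))) \<xi>"
      by blast
    have "AE \<xi> in ?\<nu>. \<xi> \<in> hboundary" using AE_space[of ?\<nu>] by simp
    with C show ?thesis
    proof eventually_elim
      case (elim \<xi>)
      have "Limsup (at_right 0) (\<lambda>r. if ball_mass r \<xi> = 0 then \<infinity> else ereal (ln (ball_mass r \<xi>) / ln r))
          \<le> ereal (real m * (h + e) / (real m * (l - e) * ln a))"
      proof (rule upper_dim_le[OF _ _ a _ _ \<open>C > 0\<close> elim(1)])
        show "ball_mass r \<xi> \<le> ball_mass s \<xi>" if "r \<le> s" for r s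
          unfolding ball_mass_def using that by (intro P.finite_measure_mono sets_ball elim(2)) auto
        show "ball_mass r \<xi> \<le> 1" for r by (simp add: ball_mass_def)
      qed (use m e \<open>h \<ge> 0\<close> in auto)
      moreover have "real m * (h + e) / (real m * (l - e) * ln a) = (h + e) / ((l - e) * ln a)"
        using m by simp
      ultimately show ?case
        by (simp add: upper_pointwise_dim_def measure_mball[OF elim(2)] Let_def)
    qed
  qed
  \<comment> \<open>The exceptional null set depends on the error, so only countably many errors are
    allowed; the 2 keeps them strictly below \<open>l\<close>.\<close>
  define e where "e n = l / real (n + 2)" for n
  have e: "0 < e n" "e n < l" for n using l by (simp_all add: e_def field_simps add_pos_nonneg)
  have "AE \<xi> in ?\<nu>. \<forall>n. upper_pointwise_dim hboundary D ?\<nu> \<xi> \<le> ereal ((h + e n) / ((l - e n) * ln a))"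
    unfolding AE_all_countable by (intro allI dim e)
  then show ?thesis
  proof eventually_elim
    case (elim \<xi>)
    have "e \<longlonglongrightarrow> 0"
      unfolding e_def by (rule LIMSEQ_ignore_initial_segment[OF lim_const_over_n])
    then have "(\<lambda>n. (h + e n) / ((l - e n) * ln a)) \<longlonglongrightarrow> (h + 0) / ((l - 0) * ln a)"
      using l a by (intro tendsto_intros) auto
    then have lim: "(\<lambda>n. ereal ((h + e n) / ((l - e n) * ln a))) \<longlonglongrightarrow> ereal (h / (l * ln a))"
      by simp
    have "upper_pointwise_dim hboundary D ?\<nu> \<xi> \<le> ereal (h / (l * ln a))"
      by (rule LIMSEQ_le_const[OF lim]) (use elim in blast)
    also have "\<dots> = ereal (1 / ln a) * (asymptotic_entropy \<mu> / ereal (rate_of_escape b \<mu>))"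
      using l 2(1) by (simp add: l_def[symmetric])
    finally show ?case .
  qed
qed

end

section \<open>From the hypotheses of the theorem to the locales\<close>

lemma isometry_group_inv:
  assumes "isom g"
  shows "m_inv isometry_group g = invf g"
  unfolding m_inv_def
proof (rule the_equality)
  show "invf g \<in> carrier isometry_group \<and> g \<otimes>\<^bsub>isometry_group\<^esub> invf g = \<one>\<^bsub>isometry_group\<^esub> \<and>
      invf g \<otimes>\<^bsub>isometry_group\<^esub> g = \<one>\<^bsub>isometry_group\<^esub>"
    using assms isom_inv[OF assms] by (simp add: isometry_group_def fun_eq_iff isom_def)
next
  fix f assume "f \<in> carrier isometry_group \<and> g \<otimes>\<^bsub>isometry_group\<^esub> f = \<one>\<^bsub>isometry_group\<^esub> \<and>
      f \<otimes>\<^bsub>isometry_group\<^esub> g = \<one>\<^bsub>isometry_group\<^esub>"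
  then have "g \<circ> f = id" by (simp add: isometry_group_def)
  then have "invf g (g (f x)) = invf g x" for x by (simp add: fun_eq_iff)
  then show "f = invf g" using assms by (simp add: fun_eq_iff)
qed

lemma group_walkI:
  fixes b :: "'a::metric_space"
  assumes "proper_space TYPE('a)" and G: "subgroup G isometry_group"
    and pd: "properly_discontinuous G" and "set_pmf \<mu> \<subseteq> G"
  shows "group_walk b G \<mu>"
proof
  show isom: "isom g" if "g \<in> G" for g
    using subgroup.subset[OF G] that by (auto simp: isometry_group_def isom_def)
  show "invf g \<in> G" if "g \<in> G" for g
    using subgroup.m_inv_closed[OF G that] isometry_group_inv[OF isom[OF that]] by simp
  show "g \<circ> h \<in> G" if "g \<in> G" "h \<in> G" for g h
    using subgroup.m_closed[OF G that] by (simp add: isometry_group_def)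
  show "id \<in> G"
    using subgroup.one_closed[OF G] by (simp add: isometry_group_def)
  show "finite {g \<in> G. dist b (g b) \<le> K}" for K
  proof (rule finite_subset)
    \<comment> \<open>The absolute value keeps \<open>b\<close> in the ball when \<open>K\<close> is
      negative.\<close>
    have "compact (cball b \<bar>K\<bar>)"
      using assms(1) by (simp add: proper_space_def)
    then show "finite {g \<in> G. g ` cball b \<bar>K\<bar> \<inter> cball b \<bar>K\<bar> \<noteq> {}}"
      using pd by (simp add: properly_discontinuous_def)
    show "{g \<in> G. dist b (g b) \<le> K} \<subseteq> {g \<in> G. g ` cball b \<bar>K\<bar> \<inter> cball b \<bar>K\<bar> \<noteq> {}}"
    proof
      fix g assume "g \<in> {g \<in> G. dist b (g b) \<le> K}"
      then have "g \<in> G" "g b \<in> g ` cball b \<bar>K\<bar> \<inter> cball b \<bar>K\<bar>" by auto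
      then show "g \<in> {g \<in> G. g ` cball b \<bar>K\<bar> \<inter> cball b \<bar>K\<bar> \<noteq> {}}" by blast
    qed
  qed
qed (rule assms)

theorem proposition2p1:
  fixes b :: "'a::metric_space"
    and \<delta> a :: real
    and D :: "'a hpoint \<Rightarrow> 'a hpoint \<Rightarrow> real"
    and G :: "('a \<Rightarrow> 'a) set"
    and \<mu> :: "('a \<Rightarrow> 'a) pmf"
    and \<nu> :: "'a hpoint measure"
  assumes "hyperbolic_space TYPE('a) \<delta>"
    and "a > 1" and "visual_metric b a D"
    and "subgroup G isometry_group"
    and "properly_discontinuous G" and "non_elementary b G"
    and "set_pmf \<mu> \<subseteq> G" and "generated_semigroup (set_pmf \<mu>) = G"
    and "finite_first_moment b \<mu>"
    and "harmonic_measure b \<mu> \<nu>"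
  shows "AE \<xi> in \<nu>. upper_pointwise_dim hboundary D \<nu> \<xi>
           \<le> ereal (1 / ln a) * (asymptotic_entropy \<mu> / ereal (rate_of_escape b \<mu>))"
proof -
  obtain X where X: "X \<in> measurable (path_space \<mu>) (hboundary_borel b)"
      "AE \<omega> in path_space \<mu>. limitin (htopology b) (\<lambda>n. Inner (walk \<omega> n b)) (X \<omega>) sequentially"
    and \<nu>: "\<nu> = distr (path_space \<mu>) (hboundary_borel b) X"
    using assms(10) unfolding harmonic_measure_def by blast
  obtain \<Lambda> where \<Lambda>: "\<Lambda> > 0" "\<And>x y. x \<in> hclosure \<Longrightarrow> y \<in> hclosure \<Longrightarrow> D x y \<le> \<Lambda> * neg_powr a (gromov_ext b x y)"
    using assms(3) unfolding visual_metric_def by blast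
  have walk: "group_walk b G \<mu>"
    using assms(1,4,5,7) by (intro group_walkI) (simp_all add: hyperbolic_space_def)
  \<comment> \<open>The hyperbolic inequality is assumed at all base points, so this predicate
    depends on the type and not on \<open>b\<close>.\<close>
  have "gromov_hyperbolic TYPE('a) \<delta>"
    using assms(1) by (intro gromov_hyperbolic.intro) (simp add: hyperbolic_space_def)
  then have "visual_hyperbolic b \<delta> a D \<Lambda>"
    using assms(2,3) \<Lambda>
    by (intro visual_hyperbolic.intro visual_hyperbolic_axioms.intro) (simp_all add: visual_metric_def)
  then interpret harmonic_walk b \<delta> a D \<Lambda> G \<mu> X
    using walk assms(6,8,9) X unfolding path_space_def
    by (intro harmonic_walk.intro harmonic_walk_axioms.intro)
  show ?thesis
    using upper_pointwise_dim_le by (simp only: \<nu> path_space_def)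
qed

end
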